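(* Let $\mathcal H$ be an infinite-dimensional separable complex Hilbert space, and let $C\in\mathcal B^1(\mathcal H)$ and $T\in\mathcal K(\mathcal H)$ both be normal. Assume that the eigenvalues of $C$ or the eigenvalues of $T$ are collinear. Then $$\overline{W_C(T)}=\operatorname{conv}(\overline{P_C(T)})\,.$$
   Context: $\mathcal B(\mathcal H)$, $\mathcal K(\mathcal H)$, $\mathcal B^1(\mathcal H)$ denote the bounded, compact and trace-class operators on $\mathcal H$, respectively. $\overline{S}$ and $\operatorname{conv}(S)$ denote closure and convex hull of $S\subseteq\mathbb C$. A subset of $\mathbb C$ is collinear if all its elements lie on a common (real) line in the complex plane. The $C$-numerical range of $T$ is $W_C(T):=\{\operatorname{tr}(CU^\dagger TU)\mid U\in\mathcal B(\mathcal H)\text{ unitary}\}$. Eigenvalue sequence of a compact operator $T$: arrange the non-zero eigenvalues in decreasing order with respect to their absolute values, each repeated according to its (finite) algebraic multiplicity; if there are only finitely many non-zero eigenvalues, fill up with zeros. Modified eigenvalue sequence: (i) if the range of $T$ is infinite-dimensional and the kernel of $T$ is finite-dimensional, put $\dim(\ker T)$ zeros at the beginning of the eigenvalue sequence; (ii) if range and kernel of $T$ are both infinite-dimensional, mix infinitely many zeros into the eigenvalue sequence (how this is done is immaterial); (iii) if the range of $T$ is finite-dimensional, leave the eigenvalue sequence unchanged. The $C$-spectrum of $T$: for $C\in\mathcal B^1(\mathcal H)$ with modified eigenvalue sequence $(\gamma_n)_{n\in\mathbb N}$ and $T\in\mathcal K(\mathcal H)$ with modified eigenvalue sequence $(\tau_n)_{n\in\mathbb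 N}$, $$P_C(T):=\Big\{\sum_{n=1}^\infty\gamma_n\tau_{\sigma(n)}\,\Big|\,\sigma:\mathbb N\to\mathbb N\text{ is a permutation}\Big\}.$$ *)

theory Defs
  imports "HOL-Analysis.Analysis"
begin

section \<open>Complex Hilbert spaces\<close>

text \<open>The inner product is conjugate-linear in the first argument. The topology is that of the
  norm, which is complete by the superclass \<^class>\<open>banach\<close>.\<close>

class complex_hilbert_space = banach +
  fixes scaleC :: "complex \<Rightarrow> 'a \<Rightarrow> 'a"  (infixr \<open>*\<^sub>C\<close> 75)
    and cinner :: "'a \<Rightarrow> 'a \<Rightarrow> complex"
  assumes scaleC_add_right: "a *\<^sub>C (x + y) = a *\<^sub>C x + a *\<^sub>C y"
    and scaleC_add_left: "(a + b) *\<^sub>C x = a *\<^sub>C x + b *\<^sub>C x"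
    and scaleC_scaleC: "a *\<^sub>C b *\<^sub>C x = (a * b) *\<^sub>C x"
    and scaleC_of_real: "complex_of_real r *\<^sub>C x = r *\<^sub>R x"
    and cinner_commute: "cinner x y = cnj (cinner y x)"
    and cinner_add_right: "cinner x (y + z) = cinner x y + cinner x z"
    and cinner_scaleC_right: "cinner x (a *\<^sub>C y) = a * cinner x y"
    and cinner_self: "cinner x x = complex_of_real ((norm x)\<^sup>2)"

global_interpretation complex_vector:
  vector_space "scaleC :: complex \<Rightarrow> 'a \<Rightarrow> 'a::complex_hilbert_space"
  defines cspan = complex_vector.span
    and cdim = complex_vector.dim
proof
  fix a b :: complex and x y :: 'a
  show "a *\<^sub>C (x + y) = a *\<^sub>C x + a *\<^sub>C y" by (rule scaleC_add_right)
  show "(a + b) *\<^sub>C x = a *\<^sub>C x + b *\<^sub>C x" by (rule scaleC_add_left)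
  show "a *\<^sub>C b *\<^sub>C x = (a * b) *\<^sub>C x" by (rule scaleC_scaleC)
  show "1 *\<^sub>C x = x" using scaleC_of_real[of 1 x] by simp
qed

definition finite_cdim :: "'a::complex_hilbert_space set \<Rightarrow> bool" where
  "finite_cdim S \<longleftrightarrow> (\<exists>B. finite B \<and> S \<subseteq> cspan B)"

text \<open>Orthonormal systems and bases are indexed by the natural numbers, as is appropriate for an
  infinite-dimensional separable space.\<close>

definition orthonormal_seq :: "(nat \<Rightarrow> 'a::complex_hilbert_space) \<Rightarrow> bool" where
  "orthonormal_seq e \<longleftrightarrow> (\<forall>m n. cinner (e m) (e n) = (if m = n then 1 else 0))"

definition orthonormal_basis :: "(nat \<Rightarrow> 'a::complex_hilbert_space) \<Rightarrow> bool" where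
  "orthonormal_basis e \<longleftrightarrow> orthonormal_seq e \<and> closure (cspan (range e)) = UNIV"

section \<open>Operators\<close>

definition bounded_clinear :: "('a::complex_hilbert_space \<Rightarrow> 'a) \<Rightarrow> bool" where
  "bounded_clinear T \<longleftrightarrow> bounded_linear T \<and> (\<forall>a x. T (a *\<^sub>C x) = a *\<^sub>C T x)"

definition cadjoint :: "('a::complex_hilbert_space \<Rightarrow> 'a) \<Rightarrow> 'a \<Rightarrow> 'a" where
  "cadjoint T = (THE S. \<forall>x y. cinner (S x) y = cinner x (T y))"

definition unitary_op :: "('a::complex_hilbert_space \<Rightarrow> 'a) \<Rightarrow> bool" where
  "unitary_op U \<longleftrightarrow> bounded_clinear U \<and> cadjoint U \<circ> U = id \<and> U \<circ> cadjoint U = id"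

definition normal_op :: "('a::complex_hilbert_space \<Rightarrow> 'a) \<Rightarrow> bool" where
  "normal_op T \<longleftrightarrow> bounded_clinear T \<and> cadjoint T \<circ> T = T \<circ> cadjoint T"

definition compact_op :: "('a::complex_hilbert_space \<Rightarrow> 'a) \<Rightarrow> bool" where
  "compact_op T \<longleftrightarrow> bounded_clinear T \<and> compact (closure (T ` ball 0 1))"

text \<open>A Schmidt decomposition (singular value decomposition) of \<open>T\<close>, with singular values \<open>s\<close>.
  As \<open>s\<close> tends to zero, pointwise convergence of the series is equivalent to convergence in
  operator norm.\<close>

definition schmidt_decomposition ::
  "('a::complex_hilbert_space \<Rightarrow> 'a) \<Rightarrow> (nat \<Rightarrow> real) \<Rightarrow> (nat \<Rightarrow> 'a) \<Rightarrow> (nat \<Rightarrow> 'a) \<Rightarrow> bool" where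
  "schmidt_decomposition T s f g \<longleftrightarrow>
     orthonormal_seq f \<and> orthonormal_seq g \<and>
     (\<forall>n. 0 \<le> s n) \<and> decseq s \<and> s \<longlonglongrightarrow> 0 \<and>
     (\<forall>x. (\<lambda>n. (complex_of_real (s n) * cinner (f n) x) *\<^sub>C g n) sums T x)"

text \<open>The trace class as the first Schatten class: compact operators with summable singular
  values.\<close>

definition trace_class :: "('a::complex_hilbert_space \<Rightarrow> 'a) \<Rightarrow> bool" where
  "trace_class T \<longleftrightarrow> compact_op T \<and> (\<exists>s f g. schmidt_decomposition T s f g \<and> summable s)"

text \<open>The common value over all orthonormal bases.\<close>

definition op_trace :: "('a::complex_hilbert_space \<Rightarrow> 'a) \<Rightarrow> complex" where
  "op_trace T = (THE z. \<forall>e. orthonormal_basis e \<longrightarrow> (\<lambda>n. cinner (e n) (T (e n))) sums z)"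

definition C_numerical_range ::
  "('a::complex_hilbert_space \<Rightarrow> 'a) \<Rightarrow> ('a \<Rightarrow> 'a) \<Rightarrow> complex set" where
  "C_numerical_range C T = {op_trace (C \<circ> cadjoint U \<circ> T \<circ> U) | U. unitary_op U}"

section \<open>Eigenvalues\<close>

definition op_kernel :: "('a::complex_hilbert_space \<Rightarrow> 'a) \<Rightarrow> 'a set" where
  "op_kernel T = {x. T x = 0}"

definition eigenvalues :: "('a::complex_hilbert_space \<Rightarrow> 'a) \<Rightarrow> complex set" where
  "eigenvalues T = {z. \<exists>x. x \<noteq> 0 \<and> T x = z *\<^sub>C x}"

definition algebraic_multiplicity :: "('a::complex_hilbert_space \<Rightarrow> 'a) \<Rightarrow> complex \<Rightarrow> nat" where
  "algebraic_multiplicity T z = cdim (\<Union>k. op_kernel ((\<lambda>x. T x - z *\<^sub>C x) ^^ k))"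

text \<open>For \<open>z \<noteq> 0\<close> that is not an eigenvalue the multiplicity is 0, so only eigenvalues and zeros
  occur in the sequence. By monotonicity, a zero can only be followed by zeros, so zeros occur
  exactly as padding when there are finitely many non-zero eigenvalues. Only the order among
  eigenvalues of equal modulus is left open.\<close>

definition eigenvalue_seq :: "('a::complex_hilbert_space \<Rightarrow> 'a) \<Rightarrow> (nat \<Rightarrow> complex) \<Rightarrow> bool" where
  "eigenvalue_seq T l \<longleftrightarrow>
     decseq (\<lambda>n. norm (l n)) \<and>
     (\<forall>z. z \<noteq> 0 \<longrightarrow> finite {n. l n = z} \<and> card {n. l n = z} = algebraic_multiplicity T z)"

text \<open>The three cases: finite-dimensional range; infinite-dimensional range and finite-dimensional
  kernel; both infinite-dimensional. In the last case \<open>r\<close> lists the positions of the original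
  sequence, and the infinitely many other positions hold the zeros mixed in.\<close>

definition modified_eigenvalue_seq ::
  "('a::complex_hilbert_space \<Rightarrow> 'a) \<Rightarrow> (nat \<Rightarrow> complex) \<Rightarrow> bool" where
  "modified_eigenvalue_seq T t \<longleftrightarrow>
     (\<exists>l. eigenvalue_seq T l \<and>
       (if finite_cdim (range T) then t = l
        else if finite_cdim (op_kernel T) then
          t = (\<lambda>n. if n < cdim (op_kernel T) then 0 else l (n - cdim (op_kernel T)))
        else (\<exists>r. strict_mono r \<and> infinite (- range r) \<and>
               (\<forall>n. t (r n) = l n) \<and> (\<forall>m. m \<notin> range r \<longrightarrow> t m = 0))))"

text \<open>Any two modified eigenvalue sequences of an operator are permutations of each other, so
  every choice of \<open>\<gamma>\<close> and \<open>\<tau>\<close> yields the same set, and the union over all choices taken here is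
  that set.\<close>

definition C_spectrum ::
  "('a::complex_hilbert_space \<Rightarrow> 'a) \<Rightarrow> ('a \<Rightarrow> 'a) \<Rightarrow> complex set" where
  "C_spectrum C T = {(\<Sum>n. \<gamma> n * \<tau> (\<sigma> n)) | \<gamma> \<tau> (\<sigma> :: nat \<Rightarrow> nat).
     modified_eigenvalue_seq C \<gamma> \<and> modified_eigenvalue_seq T \<tau> \<and> bij \<sigma>}"

end

theory Submission
  imports Defs "HOL-Combinatorics.Permutations"
begin

text \<open>Let \<open>c\<close> and \<open>t\<close> be the diagonals of \<open>C\<close> and \<open>T\<close> in orthonormal bases of eigenvectors \<open>e\<close> and \<open>f\<close>. Then
\<open>tr (C U\<^sup>* T U)\<close> is the double sum of \<open>D i j * (c i * t j)\<close>, where \<open>D i j\<close> is the squared modulus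
of the matrix entry of \<open>U\<close> at \<open>(f j, e i)\<close>. Such a matrix \<open>D\<close> is doubly stochastic, and the
\<open>C\<close>-numerical range is the set of values of this pairing on the orthostochastic matrices, whereas
the \<open>C\<close>-spectrum is the set of its values on the permutation matrices. Let \<open>V\<close> be the set of its
values on all doubly stochastic matrices. \<open>V\<close> is convex and contains both sets. The theorem follows
once every point of \<open>V\<close> is shown to be a limit of points of the numerical range and also a limit of
convex combinations of points of the spectrum: all three sets then have the same closure, and
closure and convex hull commute on the bounded set \<open>P\<^sub>C(T)\<close>.

For these two limits (\<open>pairing_in_closure_orthostochastic\<close> and \<open>pairing_in_closure_convex_hull\<close>) the
collinearity hypothesis is used. As \<open>c\<close> and \<open>t\<close> tend to zero, the line passes through zero, so that one of the two sequences is a real sequence \<open>\<rho>\<close> up to a complex factor. The pairing is uniformly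
approximated by its finite corners (\<open>pairing_uniform_truncation\<close>), and a corner of a doubly
stochastic matrix extends to a finite doubly stochastic matrix of twice the size. It remains to
treat a matrix \<open>D\<close> which is the identity off a finite block. Then only the vector \<open>x = D \<rho>\<close> matters, a
real vector, and by Hardy, Littlewood and Polya it arises from \<open>\<rho>\<close> by finitely many averagings of
two coordinates (\<open>swap_averaging_reaches_doubly_stochastic_image\<close>). Averaging two coordinates is a
convex combination of two permutations, which gives the convex hull of the spectrum. It is also the
effect on the diagonal of a selfadjoint operator of rotating two vectors of an orthonormal basis,
with a phase that removes the contribution of the off-diagonal entry. This gives the numerical range, and is the proof
of Horn's theorem on diagonals.

What else is needed is the spectral theorem for compact normal operators, the basis independence
of the trace of \<open>C X\<close>, and the fact that every modified eigenvalue sequence is a rearrangement of the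
diagonal in an eigenbasis.\<close>

section \<open>Majorization by averaging pairs of coordinates\<close>

text \<open>The two new coordinates are the images of the old ones under a symmetric doubly stochastic \<open>2 \<times> 2\<close>
matrix, so these moves are the T-transforms of majorization theory. The case \<open>s = 1\<close> is the
transposition of the two coordinates.\<close>

definition swap_averaging_closed :: "nat \<Rightarrow> (nat \<Rightarrow> real) set \<Rightarrow> bool" where
  "swap_averaging_closed M S \<longleftrightarrow>
    (\<forall>x\<in>S. \<forall>i<M. \<forall>j<M. \<forall>s. i \<noteq> j \<longrightarrow> 0 \<le> s \<longrightarrow> s \<le> 1 \<longrightarrow>
       x(i := (1 - s) * x i + s * x j, j := s * x i + (1 - s) * x j) \<in> S)"

text \<open>The step in the theorem of Hardy, Littlewood and Polya. Let \<open>k\<close> be the first place where \<open>y\<close> is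
too small, and \<open>j < k\<close> a place where \<open>y\<close> is too large. Mass is moved from \<open>j\<close> to \<open>k\<close> until one of the
two coordinates is correct. As \<open>x\<close> is sorted, \<open>y k < x k \<le> x j < y j\<close>, so that the move is an averaging.
The partial sums stay dominated because \<open>y\<close> is at least \<open>x\<close> everywhere before \<open>k\<close>, and the number of
wrong coordinates drops.\<close>

lemma swap_averaging_reaches_dominated:
  assumes S: "swap_averaging_closed M S" and y: "y \<in> S"
    and anti: "\<And>i j. i \<le> j \<Longrightarrow> j < M \<Longrightarrow> x j \<le> x i"
    and dom: "\<And>m. m \<le> M \<Longrightarrow> (\<Sum>i<m. x i) \<le> (\<Sum>i<m. y i)"
    and tot: "(\<Sum>i<M. x i) = (\<Sum>i<M. y i)"
    and out: "\<And>i. M \<le> i \<Longrightarrow> x i = y i"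
  shows "x \<in> S"
  using y dom tot out
proof (induction "card {i. i < M \<and> x i \<noteq> y i}" arbitrary: y rule: less_induct)
  case less
  note dom = less.prems(2) and tot = less.prems(3) and out = less.prems(4)
  show ?case
  proof (cases "x = y")
    case True then show ?thesis using less.prems(1) by simp
  next
    case False
    then obtain i0 where i0: "x i0 \<noteq> y i0" by auto
    have "i0 < M" using out i0 by (meson not_le)
    have "\<exists>k<M. y k < x k"
    proof (rule ccontr)
      assume "\<not> ?thesis"
      then have *: "\<And>k. k < M \<Longrightarrow> x k \<le> y k" by (meson not_le)
      have "(\<Sum>i<M. x i) < (\<Sum>i<M. y i)"
        by (rule sum_strict_mono_ex1) (use * i0 \<open>i0 < M\<close> in \<open>auto intro!: bexI[of _ i0] simp: less_le\<close>)
      then show False using tot by simp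
    qed
    define k where "k = (LEAST k. k < M \<and> y k < x k)"
    have k: "k < M" "y k < x k"
      using LeastI_ex[of "\<lambda>k. k < M \<and> y k < x k"] \<open>\<exists>k<M. y k < x k\<close> unfolding k_def by auto
    have below: "x i \<le> y i" if "i < k" for i
      using not_less_Least[of i "\<lambda>k. k < M \<and> y k < x k"] that k(1) unfolding k_def[symmetric] by auto
    have "\<exists>j<k. x j < y j"
    proof (rule ccontr)
      assume "\<not> ?thesis"
      then have "\<And>j. j < k \<Longrightarrow> y j \<le> x j" by (meson not_le)
      then have "(\<Sum>i<k. y i) \<le> (\<Sum>i<k. x i)" by (intro sum_mono) auto
      moreover have "(\<Sum>i<Suc k. x i) \<le> (\<Sum>i<Suc k. y i)" using dom[of "Suc k"] k(1) by simp
      ultimately show False using k(2) by simp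
    qed
    \<comment> \<open>Before \<open>k\<close> no coordinate of \<open>y\<close> is too small, and the partial sum up to \<open>k\<close> must make up for \<open>y k < x k\<close>.\<close>
    then obtain j where j: "j < k" "x j < y j" by blast
    define \<delta> where "\<delta> = min (y j - x j) (x k - y k)"
    have \<delta>: "0 < \<delta>" "\<delta> \<le> y j - x j" "\<delta> \<le> x k - y k" using j k by (auto simp: \<delta>_def)
    have xjk: "x k \<le> x j" using anti[of j k] j k by simp
    define s where "s = \<delta> / (y j - y k)"
    have gap: "0 < y j - y k" "\<delta> \<le> y j - y k" using j k xjk \<delta> by linarith+
    have s: "0 \<le> s" "s \<le> 1" "s * (y j - y k) = \<delta>" using gap \<delta> by (auto simp: s_def)
    define y' where "y' = y(j := y j - \<delta>, k := y k + \<delta>)"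
    have "y' = y(j := (1 - s) * y j + s * y k, k := s * y j + (1 - s) * y k)"
      unfolding y'_def using s(3) by (auto simp: algebra_simps)
    then have y'S: "y' \<in> S"
      using S less.prems(1) s j k unfolding swap_averaging_closed_def by auto
    have sum': "(\<Sum>i<m. y' i) = (\<Sum>i<m. y i) - (if j < m then \<delta> else 0) + (if k < m then \<delta> else 0)" for m
    proof -
      have "y' i = y i - (if i = j then \<delta> else 0) + (if i = k then \<delta> else 0)" for i
        using j by (auto simp: y'_def)
      then show ?thesis by (simp add: sum.distrib sum_subtractf sum.delta)
    qed
    have "x \<in> S"
    proof (rule less.hyps[of y'])
      show "y' \<in> S" by fact
      have "{i. i < M \<and> x i \<noteq> y' i} \<subset> {i. i < M \<and> x i \<noteq> y i}"
      proof
        show "{i. i < M \<and> x i \<noteq> y' i} \<subseteq> {i. i < M \<and> x i \<noteq> y i}"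
          using j k by (auto simp: y'_def split: if_splits)
        have "x j = y' j \<or> x k = y' k" using j k unfolding y'_def \<delta>_def by auto
        then show "{i. i < M \<and> x i \<noteq> y' i} \<noteq> {i. i < M \<and> x i \<noteq> y i}" using j k by force
      qed
      then show "card {i. i < M \<and> x i \<noteq> y' i} < card {i. i < M \<and> x i \<noteq> y i}"
        by (intro psubset_card_mono) auto
      show "(\<Sum>i<M. x i) = (\<Sum>i<M. y' i)" using tot sum'[of M] j k by simp
      show "x i = y' i" if "M \<le> i" for i using out[OF that] that j k by (simp add: y'_def)
      fix m assume m: "m \<le> M"
      show "(\<Sum>i<m. x i) \<le> (\<Sum>i<m. y' i)"
      proof (cases "j < m \<and> m \<le> k")
        case True
        have "y j - x j \<le> (\<Sum>i<m. y i - x i)"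
          by (rule member_le_sum) (use True below in auto)
        then show ?thesis using sum'[of m] True \<delta> by (simp add: sum_subtractf)
      next
        case False
        then show ?thesis using sum'[of m] dom[OF m] j by auto
      qed
    qed
    then show ?thesis .
  qed
qed

text \<open>Subtracting the threshold \<open>c (m - 1)\<close> from \<open>c\<close> changes both sides by the same amount; afterwards the
first \<open>m\<close> terms are nonnegative and the others are not positive, so that the weights \<open>1\<close> on the
former and \<open>0\<close> on the latter are optimal.\<close>

lemma weighted_sum_le_initial_sum:
  fixes c w :: "nat \<Rightarrow> real"
  assumes anti: "\<And>i j. i \<le> j \<Longrightarrow> j < M \<Longrightarrow> c j \<le> c i"
    and w: "\<And>i. i < M \<Longrightarrow> 0 \<le> w i \<and> w i \<le> 1" and m: "(\<Sum>i<M. w i) = real m" "m \<le> M"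
  shows "(\<Sum>i<M. w i * c i) \<le> (\<Sum>i<m. c i)"
proof (cases m)
  case 0
  then have "\<forall>i\<in>{..<M}. w i = 0"
    using m w sum_nonneg_eq_0_iff[of "{..<M}" w] by auto
  then show ?thesis using 0 by simp
next
  case (Suc l)
  define a where "a = c l"
  have "(\<Sum>i<M. w i * (c i - a)) \<le> (\<Sum>i<M. if i < m then c i - a else 0)"
  proof (rule sum_mono)
    fix i assume i: "i \<in> {..<M}"
    show "w i * (c i - a) \<le> (if i < m then c i - a else 0)"
    proof (cases "i < m")
      case True
      then have "0 \<le> c i - a" using anti[of i l] Suc m by (simp add: a_def)
      then show ?thesis using True w[of i] i by (simp add: mult_left_le_one_le)
    next
      case False
      then have "c i - a \<le> 0" using anti[of l i] Suc i by (simp add: a_def)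
      then show ?thesis using False w[of i] i by (simp add: mult_nonneg_nonpos)
    qed
  qed
  also have "\<dots> = (\<Sum>i<m. c i - a)"
    by (rule sum.mono_neutral_cong_right) (use m in auto)
  finally have "(\<Sum>i<M. w i * c i) - (\<Sum>i<M. w i) * a \<le> (\<Sum>i<m. c i) - real m * a"
    by (simp add: sum_subtractf right_diff_distrib sum_distrib_right)
  then show ?thesis using m by simp
qed

lemma antitone_rearrangement:
  fixes c :: "nat \<Rightarrow> real"
  shows "\<exists>p. p permutes {..<M} \<and> (\<forall>i j. i \<le> j \<longrightarrow> j < M \<longrightarrow> c (p j) \<le> c (p i))"
proof (induction M arbitrary: c)
  case 0 then show ?case by (auto intro!: exI[of _ id] permutes_id)
next
  case (Suc M)
  obtain k where k: "k \<le> M" "\<And>i. i \<le> M \<Longrightarrow> c k \<le> c i"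
    using arg_min_if_finite(1)[of "{..M}" c] arg_min_least[of "{..M}" _ c]
    by (metis atMost_iff empty_iff finite_atMost order_refl)
  \<comment> \<open>A smallest entry is moved to the last place and the others are sorted recursively.\<close>
  let ?t = "Transposition.transpose k M"
  obtain q where q: "q permutes {..<M}"
      "\<And>i j. i \<le> j \<Longrightarrow> j < M \<Longrightarrow> (c \<circ> ?t) (q j) \<le> (c \<circ> ?t) (q i)"
    using Suc.IH[of "c \<circ> ?t"] by blast
  have "?t permutes {..<Suc M}" using k by (intro permutes_swap_id) auto
  moreover have q': "q permutes {..<Suc M}" using q(1) by (rule permutes_subset) auto
  ultimately have "?t \<circ> q permutes {..<Suc M}" by (rule permutes_compose[rotated])
  moreover have "c ((?t \<circ> q) j) \<le> c ((?t \<circ> q) i)" if "i \<le> j" "j < Suc M" for i j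
  proof (cases "j < M")
    case True then show ?thesis using q(2)[of i j] that by simp
  next
    case False
    then have "j = M" "q M = M" using that permutes_not_in[OF q(1), of M] by auto
    moreover have "(?t \<circ> q) i \<in> {..<Suc M}"
      using permutes_in_image[OF \<open>?t \<circ> q permutes {..<Suc M}\<close>, of i] that by auto
    ultimately show ?thesis using k(2) by auto
  qed
  ultimately show ?case by blast
qed

text \<open>After sorting \<open>a\<close> and its image \<open>x\<close>, an initial sum of \<open>x\<close> is a weighted sum of \<open>a\<close>, with weights that
are partial column sums of the matrix and hence lie between \<open>0\<close> and \<open>1\<close>. So \<open>a\<close> dominates \<open>x\<close>. The set
\<open>S\<close> is arbitrary because the theorem is applied to two sets: vectors whose pairing
with a given sequence lies in a convex set under all rearrangements, and diagonals of a fixed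
selfadjoint operator.\<close>

theorem swap_averaging_reaches_doubly_stochastic_image:
  assumes S: "swap_averaging_closed M S"
    and perm: "\<And>x p. x \<in> S \<Longrightarrow> p permutes {..<M} \<Longrightarrow> x \<circ> p \<in> S"
    and a: "a \<in> S"
    and D: "\<And>i j. i < M \<Longrightarrow> j < M \<Longrightarrow> 0 \<le> D i j"
      "\<And>i. i < M \<Longrightarrow> (\<Sum>j<M. D i j) = 1" "\<And>j. j < M \<Longrightarrow> (\<Sum>i<M. D i j) = 1"
    and x: "\<And>i. i < M \<Longrightarrow> x i = (\<Sum>j<M. D i j * a j)" "\<And>i. M \<le> i \<Longrightarrow> x i = a i"
  shows "x \<in> S"
proof -
  obtain p where p: "p permutes {..<M}" "\<And>i j. i \<le> j \<Longrightarrow> j < M \<Longrightarrow> x (p j) \<le> x (p i)"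
    using antitone_rearrangement[of M x] by blast
  obtain q where q: "q permutes {..<M}" "\<And>i j. i \<le> j \<Longrightarrow> j < M \<Longrightarrow> a (q j) \<le> a (q i)"
    using antitone_rearrangement[of M a] by blast
  have pM: "p i < M" if "i < M" for i using permutes_in_image[OF p(1), of i] that by simp
  have qM: "q i < M" if "i < M" for i using permutes_in_image[OF q(1), of i] that by simp
  have initial: "(\<Sum>i<m. (x \<circ> p) i) = (\<Sum>j<M. (\<Sum>i<m. D (p i) (q j)) * (a \<circ> q) j)" if "m \<le> M" for m
  proof -
    have "(\<Sum>i<m. (x \<circ> p) i) = (\<Sum>i<m. \<Sum>j<M. D (p i) j * a j)"
      by (intro sum.cong) (use pM that x(1) in auto)
    also have "\<dots> = (\<Sum>i<m. \<Sum>j<M. D (p i) (q j) * a (q j))"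
      by (intro sum.cong refl sum.permute[OF q(1), unfolded comp_def])
    also have "\<dots> = (\<Sum>j<M. (\<Sum>i<m. D (p i) (q j)) * (a \<circ> q) j)"
      by (subst sum.swap) (simp add: sum_distrib_right)
    finally show ?thesis .
  qed
  have col: "(\<Sum>i<M. D (p i) (q j)) = 1" if "j < M" for j
    using sum.permute[OF p(1), of "\<lambda>i. D i (q j)"] D(3)[OF qM[OF that]] by (simp add: comp_def)
  have row: "(\<Sum>j<M. D (p i) (q j)) = 1" if "i < M" for i
    using sum.permute[OF q(1), of "\<lambda>j. D (p i) j"] D(2)[OF pM[OF that]] by (simp add: comp_def)
  have "x \<circ> p \<in> S"
  proof (rule swap_averaging_reaches_dominated[OF S perm[OF a q(1)]])
    show "(x \<circ> p) j \<le> (x \<circ> p) i" if "i \<le> j" "j < M" for i j using p(2)[OF that] by simp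
    show "(\<Sum>i<m. (x \<circ> p) i) \<le> (\<Sum>i<m. (a \<circ> q) i)" if m: "m \<le> M" for m
      unfolding initial[OF m]
    proof (rule weighted_sum_le_initial_sum[OF _ _ _ m])
      show "(a \<circ> q) j \<le> (a \<circ> q) i" if "i \<le> j" "j < M" for i j using q(2)[OF that] by simp
      show "0 \<le> (\<Sum>i<m. D (p i) (q j)) \<and> (\<Sum>i<m. D (p i) (q j)) \<le> 1" if j: "j < M" for j
      proof
        show "0 \<le> (\<Sum>i<m. D (p i) (q j))" by (intro sum_nonneg D(1)) (use pM qM m j in auto)
        have "(\<Sum>i<m. D (p i) (q j)) \<le> (\<Sum>i<M. D (p i) (q j))"
          by (rule sum_mono2) (use m pM qM j D(1) in auto)
        then show "(\<Sum>i<m. D (p i) (q j)) \<le> 1" using col[OF j] by simp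
      qed
      show "(\<Sum>j<M. \<Sum>i<m. D (p i) (q j)) = real m"
        by (subst sum.swap) (use row m in simp)
    qed
    show "(\<Sum>i<M. (x \<circ> p) i) = (\<Sum>i<M. (a \<circ> q) i)"
      using initial[of M] col by simp
    show "(x \<circ> p) i = (a \<circ> q) i" if "M \<le> i" for i
      using x(2)[OF that] permutes_not_in[OF p(1), of i] permutes_not_in[OF q(1), of i] that by simp
  qed
  then have "x \<circ> p \<circ> inv p \<in> S" by (rule perm) (rule permutes_inv[OF p(1)])
  then show ?thesis using permutes_inv_o[OF p(1)] by (simp add: comp_assoc)
qed

section \<open>Pairing two sequences by a doubly stochastic matrix\<close>

definition doubly_stochastic :: "(nat \<Rightarrow> nat \<Rightarrow> real) \<Rightarrow> bool" where
  "doubly_stochastic D \<longleftrightarrow> (\<forall>i j. 0 \<le> D i j) \<and>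
     (\<forall>i. ((\<lambda>j. D i j) has_sum 1) UNIV) \<and> (\<forall>j. ((\<lambda>i. D i j) has_sum 1) UNIV)"

text \<open>For operators, one sequence belongs to a trace-class and the other to a compact operator. The
condition is symmetric since the real one of the two sequences may be either of them.\<close>

definition pairable :: "(nat \<Rightarrow> complex) \<Rightarrow> (nat \<Rightarrow> complex) \<Rightarrow> bool" where
  "pairable b r \<longleftrightarrow> (\<lambda>i. norm (b i)) summable_on UNIV \<and> r \<longlonglongrightarrow> 0 \<or> (\<lambda>i. norm (r i)) summable_on UNIV \<and> b \<longlonglongrightarrow> 0"

text \<open>The value of \<open>tr (C U\<^sup>* T U)\<close> if \<open>b\<close> and \<open>r\<close> are the diagonals of \<open>C\<close> and \<open>T\<close> and \<open>D\<close> holds the squared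
moduli of the entries of \<open>U\<close>.\<close>

definition pairing :: "(nat \<Rightarrow> complex) \<Rightarrow> (nat \<Rightarrow> complex) \<Rightarrow> (nat \<Rightarrow> nat \<Rightarrow> real) \<Rightarrow> complex" where
  "pairing b r D = (\<Sum>\<^sub>\<infinity>(i, j). complex_of_real (D i j) * (b i * r j))"

definition matrix_transpose :: "(nat \<Rightarrow> nat \<Rightarrow> real) \<Rightarrow> nat \<Rightarrow> nat \<Rightarrow> real" where
  "matrix_transpose D i j = D j i"

definition permutation_matrix :: "(nat \<Rightarrow> nat) \<Rightarrow> nat \<Rightarrow> nat \<Rightarrow> real" where
  "permutation_matrix \<sigma> i j = (if j = \<sigma> i then 1 else 0)"

lemma pairable_commute: "pairable b r \<longleftrightarrow> pairable r b"
  by (auto simp: pairable_def)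

text \<open>Reduction to the case in which the first sequence is the summable one.\<close>

lemma pairable_cases [consumes 1, case_names summable commute]:
  assumes "pairable b r"
    and "\<And>b r. (\<lambda>i. norm (b i)) summable_on UNIV \<Longrightarrow> r \<longlonglongrightarrow> 0 \<Longrightarrow> Q b r"
    and "\<And>b r. pairable b r \<Longrightarrow> Q b r \<Longrightarrow> Q r b"
  shows "Q b r"
  using assms unfolding pairable_def by blast

lemma doubly_stochasticD:
  assumes "doubly_stochastic D"
  shows "0 \<le> D i j" "((\<lambda>j. D i j) has_sum 1) UNIV" "((\<lambda>i. D i j) has_sum 1) UNIV" "D i j \<le> 1"
proof -
  show *: "0 \<le> D i j" for i j using assms by (simp add: doubly_stochastic_def)
  show row: "((\<lambda>j. D i j) has_sum 1) UNIV" using assms by (simp add: doubly_stochastic_def)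
  show "((\<lambda>i. D i j) has_sum 1) UNIV" using assms by (simp add: doubly_stochastic_def)
  have "sum (D i) {j} \<le> 1"
    by (rule has_sum_mono2[OF has_sum_finite row]) (use * in auto)
  then show "D i j \<le> 1" by simp
qed

lemma doubly_stochastic_transpose:
  "doubly_stochastic D \<Longrightarrow> doubly_stochastic (matrix_transpose D)"
  by (auto simp: doubly_stochastic_def matrix_transpose_def)

lemma pairing_transpose: "pairing r b (matrix_transpose D) = pairing b r D"
proof -
  have "pairing b r D = (\<Sum>\<^sub>\<infinity>(i, j)\<in>prod.swap ` UNIV. complex_of_real (D i j) * (b i * r j))"
    by (simp add: pairing_def)
  also have "\<dots> = pairing r b (matrix_transpose D)"
    unfolding pairing_def
    by (subst infsum_reindex) (auto simp: o_def case_prod_unfold matrix_transpose_def mult_ac intro!: infsum_cong)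
  finally show ?thesis by simp
qed

text \<open>As all rows have sum \<open>1\<close>, weights on the rows give bounds on double sums that do not depend on the
matrix.\<close>

lemma doubly_stochastic_row_weights_has_sum:
  assumes D: "doubly_stochastic D" and w: "(w has_sum S) UNIV" "\<And>i. 0 \<le> w i"
  shows "((\<lambda>(i, j). D i j * w i) has_sum S) UNIV"
proof -
  have row: "((\<lambda>j. D i j * w i) has_sum w i) UNIV" for i
    using has_sum_cmult_left[OF doubly_stochasticD(2)[OF D, of i], of "w i"] by simp
  have "(\<lambda>(i, j). D i j * w i) summable_on (SIGMA i:UNIV. UNIV)"
    by (rule summable_on_SigmaI[where g = w])
       (use row w doubly_stochasticD(1)[OF D] in \<open>auto simp: summable_on_def\<close>)
  then have "((\<lambda>(i, j). D i j * w i) has_sum S) (SIGMA i:UNIV. UNIV)"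
    by (intro has_sum_SigmaI[where g = w]) (use row w in auto)
  then show ?thesis by simp
qed

lemma pairing_abs_summable:
  assumes "pairable b r" and D: "doubly_stochastic D"
  shows "(\<lambda>x. norm (case x of (i, j) \<Rightarrow> complex_of_real (D i j) * (b i * r j))) summable_on UNIV"
  using assms
proof (induction arbitrary: D rule: pairable_cases)
  case (summable b r)
  obtain K where K: "\<And>j. norm (r j) \<le> K"
    using convergent_imp_Bseq[of r] summable(2) by (auto simp: convergent_def Bseq_def)
  have "(\<lambda>(i, j). D i j * (norm (b i) * K)) summable_on UNIV"
    using doubly_stochastic_row_weights_has_sum[OF summable(3), of "\<lambda>i. norm (b i) * K"]
      summable_on_cmult_left[OF summable(1), of K] order_trans[OF norm_ge_zero K[of 0]]
    by (auto simp: summable_on_def)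
  then show ?case
    by (rule summable_on_comparison_test)
       (use K doubly_stochasticD(1)[OF summable(3)] in
         \<open>auto simp: norm_mult intro!: mult_left_mono\<close>)
next
  case (commute b r)
  have "(\<lambda>x. norm (case x of (i, j) \<Rightarrow> complex_of_real (matrix_transpose D i j) * (b i * r j)))
          summable_on (prod.swap ` UNIV)"
    using commute(2)[OF doubly_stochastic_transpose[OF commute(3)]] by simp
  then show ?case
    by (subst (asm) summable_on_reindex)
       (auto simp: o_def case_prod_unfold matrix_transpose_def mult_ac)
qed

text \<open>The truncation index is the same for all doubly stochastic matrices. Off the corner, the terms are
dominated by \<open>D i j * w i\<close> with a weight \<open>w\<close> whose sum is small: for \<open>i \<ge> N\<close> it is a tail of \<open>b\<close>, and
for \<open>i < N\<close> the index \<open>j \<ge> N\<close> makes \<open>r j\<close> small.\<close>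

lemma pairing_uniform_truncation:
  assumes "pairable b r" and "0 < \<epsilon>"
  shows "\<exists>N. \<forall>D. doubly_stochastic D \<longrightarrow>
    norm (pairing b r D - (\<Sum>i<N. \<Sum>j<N. complex_of_real (D i j) * (b i * r j))) \<le> \<epsilon>"
  using assms
proof (induction rule: pairable_cases)
  case (summable b r)
  obtain K where K: "0 < K" "\<And>j. norm (r j) \<le> K"
    using convergent_imp_Bseq[of r] summable(2) by (auto simp: convergent_def Bseq_def)
  define B where "B = (\<Sum>\<^sub>\<infinity>i. norm (b i))"
  have bB: "((\<lambda>i. norm (b i)) has_sum B) UNIV" using summable(1) by (simp add: B_def)
  have B0: "0 \<le> B" unfolding B_def by (rule infsum_nonneg) simp
  define \<eta> where "\<eta> = \<epsilon> / (2 * (B + 1))"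
  have \<eta>: "0 < \<eta>" "\<eta> * B \<le> \<epsilon> / 2" using B0 \<open>0 < \<epsilon>\<close> by (auto simp: \<eta>_def field_simps)
  obtain N1 where N1: "\<And>j. N1 \<le> j \<Longrightarrow> norm (r j) < \<eta>"
    using LIMSEQ_D[OF summable(2) \<eta>(1)] by auto
  have "(\<lambda>i. norm (b i)) sums B" using bB by (rule has_sum_imp_sums)
  then have "(\<lambda>n. \<Sum>i<n. norm (b i)) \<longlonglongrightarrow> B" by (simp add: sums_def)
  then obtain N2 where N2: "\<And>n. N2 \<le> n \<Longrightarrow> norm ((\<Sum>i<n. norm (b i)) - B) < \<epsilon> / (2 * K)"
    using LIMSEQ_D[of _ B "\<epsilon> / (2 * K)"] \<open>0 < \<epsilon>\<close> K(1) by fastforce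
  define N where "N = max N1 N2"
  \<comment> \<open>\<open>K\<close> bounds \<open>r\<close> where \<open>i \<ge> N\<close>, and \<open>\<eta>\<close> bounds it where \<open>j \<ge> N\<close>.\<close>
  define w where "w i = (if i < N then 0 else norm (b i)) * K + \<eta> * norm (b i)" for i
  have tail: "((\<lambda>i. if i < N then 0 else norm (b i)) has_sum (B - (\<Sum>i<N. norm (b i)))) UNIV"
  proof -
    have "((\<lambda>i. norm (b i)) has_sum (B - (\<Sum>i<N. norm (b i)))) (UNIV - {..<N})"
      by (rule has_sum_Diff[OF bB]) (auto intro: has_sum_finite)
    then show ?thesis
      by (rule has_sum_cong_neutral[THEN iffD1, rotated -1]) auto
  qed
  define W where "W = (B - (\<Sum>i<N. norm (b i))) * K + \<eta> * B"
  have wW: "(w has_sum W) UNIV"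
    unfolding w_def W_def by (intro has_sum_add has_sum_cmult_left has_sum_cmult_right tail bB)
  have w0: "0 \<le> w i" for i using K \<eta> by (auto simp: w_def)
  have "norm ((\<Sum>i<N. norm (b i)) - B) < \<epsilon> / (2 * K)" using N2 by (simp add: N_def)
  then have "B - (\<Sum>i<N. norm (b i)) \<le> \<epsilon> / (2 * K)" by (simp add: abs_less_iff)
  then have "(B - (\<Sum>i<N. norm (b i))) * K \<le> \<epsilon> / 2"
    using K(1) by (simp add: field_simps)
  then have W: "W \<le> \<epsilon>" using \<eta> by (simp add: W_def)
  show ?case
  proof (intro exI allI impI)
    fix D assume D: "doubly_stochastic D"
    let ?f = "\<lambda>(i, j). complex_of_real (D i j) * (b i * r j)"
    let ?R = "- ({..<N} \<times> {..<N})"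
    have abs: "(\<lambda>x. norm (?f x)) summable_on UNIV"
      by (rule pairing_abs_summable) (use summable D in \<open>auto simp: pairable_def\<close>)
    then have absR: "(\<lambda>x. norm (?f x)) summable_on ?R" by (rule summable_on_subset_banach) simp
    have "?f summable_on UNIV" using abs by (rule abs_summable_summable)
    then have "infsum ?f ?R = infsum ?f UNIV - infsum ?f ({..<N} \<times> {..<N})"
      by (subst Compl_eq_Diff_UNIV) (rule infsum_Diff, auto)
    also have "\<dots> = pairing b r D - (\<Sum>i<N. \<Sum>j<N. complex_of_real (D i j) * (b i * r j))"
      by (simp add: pairing_def sum.cartesian_product)
    finally have eq: "pairing b r D - (\<Sum>i<N. \<Sum>j<N. complex_of_real (D i j) * (b i * r j)) = infsum ?f ?R" ..
    have Dw: "((\<lambda>(i, j). D i j * w i) has_sum W) UNIV"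
      by (rule doubly_stochastic_row_weights_has_sum[OF D wW w0])
    have "norm (infsum ?f ?R) \<le> infsum (\<lambda>x. norm (?f x)) ?R" by (rule norm_infsum_bound[OF absR])
    also have "\<dots> \<le> infsum (\<lambda>(i, j). D i j * w i) UNIV"
    proof (rule infsum_mono_neutral[OF absR])
      show "(\<lambda>(i, j). D i j * w i) summable_on UNIV" using Dw by (auto simp: summable_on_def)
      fix x assume "x \<in> ?R \<inter> UNIV"
      then obtain i j where x: "x = (i, j)" "N \<le> i \<or> N \<le> j" by (cases x) auto
      have "norm (b i) * norm (r j) \<le> w i"
      proof (cases "N \<le> i")
        case True
        then have "norm (b i) * norm (r j) \<le> norm (b i) * K" using K by (intro mult_left_mono) auto
        then show ?thesis using True \<eta>(1) by (simp add: w_def add_increasing2)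
      next
        case False
        then have "N \<le> j" using x(2) by blast
        then have "N1 \<le> j" by (simp add: N_def)
        then have "norm (r j) \<le> \<eta>" using N1[of j] by simp
        then have "norm (b i) * norm (r j) \<le> norm (b i) * \<eta>" by (intro mult_left_mono) auto
        then show ?thesis using False by (simp add: w_def mult.commute)
      qed
      then show "norm (?f x) \<le> (case x of (i, j) \<Rightarrow> D i j * w i)"
        using doubly_stochasticD(1)[OF D] by (auto simp: x norm_mult intro!: mult_left_mono)
    next
      show "\<And>x. x \<in> UNIV - ?R \<Longrightarrow> 0 \<le> (case x of (i, j) \<Rightarrow> D i j * w i)"
        using doubly_stochasticD(1)[OF D] w0 by auto
    qed auto
    also have "\<dots> = W" using Dw by (rule infsumI)
    finally show "norm (pairing b r D - (\<Sum>i<N. \<Sum>j<N. complex_of_real (D i j) * (b i * r j))) \<le> \<epsilon>"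
      using W eq by simp
  qed
next
  case (commute b r)
  then obtain N where N: "\<And>D. doubly_stochastic D \<Longrightarrow>
    norm (pairing b r D - (\<Sum>i<N. \<Sum>j<N. complex_of_real (D i j) * (b i * r j))) \<le> \<epsilon>" by blast
  show ?case
  proof (intro exI allI impI)
    fix D assume D: "doubly_stochastic D"
    have "(\<Sum>i<N. \<Sum>j<N. complex_of_real (matrix_transpose D i j) * (b i * r j))
        = (\<Sum>i<N. \<Sum>j<N. complex_of_real (D i j) * (r i * b j))"
      by (subst sum.swap) (simp add: matrix_transpose_def mult_ac)
    then show "norm (pairing r b D - (\<Sum>i<N. \<Sum>j<N. complex_of_real (D i j) * (r i * b j))) \<le> \<epsilon>"
      using N[OF doubly_stochastic_transpose[OF D]] pairing_transpose[of b r D]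
      by (simp add: pairing_transpose)
  qed
qed

text \<open>The pairing depends on \<open>D\<close> only through the image of \<open>r\<close> under \<open>D\<close>.\<close>

lemma pairing_by_rows:
  assumes "pairable b r" "doubly_stochastic D"
    and x: "\<And>i. ((\<lambda>j. complex_of_real (D i j) * r j) has_sum x i) UNIV"
  shows "((\<lambda>i. b i * x i) has_sum pairing b r D) UNIV"
proof -
  let ?f = "\<lambda>(i, j). complex_of_real (D i j) * (b i * r j)"
  have "?f summable_on UNIV"
    using pairing_abs_summable[OF assms(1,2)] by (rule abs_summable_summable)
  then have "(?f has_sum pairing b r D) (SIGMA i:UNIV. UNIV)" by (simp add: pairing_def)
  then show ?thesis
  proof (rule has_sum_SigmaD)
    fix i
    show "((\<lambda>j. ?f (i, j)) has_sum b i * x i) UNIV"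
      using has_sum_cmult_right[OF x[of i], of "b i"] by (simp add: mult_ac)
  qed
qed

lemma doubly_stochastic_permutation_matrix:
  assumes "bij \<sigma>"
  shows "doubly_stochastic (permutation_matrix \<sigma>)"
proof -
  have eq: "permutation_matrix \<sigma> i j = (if i = inv \<sigma> j then 1 else 0)" for i j
    using assms by (auto simp: permutation_matrix_def bij_inv_eq_iff)
  have "((\<lambda>j. permutation_matrix \<sigma> i j) has_sum 1) UNIV" for i
    by (rule has_sum_finite_neutralI[of "{\<sigma> i}"]) (auto simp: permutation_matrix_def)
  moreover have "((\<lambda>i. permutation_matrix \<sigma> i j) has_sum 1) UNIV" for j
    unfolding eq by (rule has_sum_finite_neutralI[of "{inv \<sigma> j}"]) auto
  ultimately show ?thesis by (auto simp: doubly_stochastic_def permutation_matrix_def)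
qed

lemma pairing_permutation_matrix:
  assumes "pairable b r" "bij \<sigma>"
  shows "((\<lambda>i. b i * r (\<sigma> i)) has_sum pairing b r (permutation_matrix \<sigma>)) UNIV"
proof (rule pairing_by_rows[OF assms(1) doubly_stochastic_permutation_matrix[OF assms(2)]])
  show "((\<lambda>j. complex_of_real (permutation_matrix \<sigma> i j) * r j) has_sum r (\<sigma> i)) UNIV" for i
    by (rule has_sum_finite_neutralI[of "{\<sigma> i}"]) (auto simp: permutation_matrix_def)
qed

lemma permutation_matrix_transpose:
  "bij \<sigma> \<Longrightarrow> matrix_transpose (permutation_matrix \<sigma>) = permutation_matrix (inv \<sigma>)"
  by (auto simp: fun_eq_iff matrix_transpose_def permutation_matrix_def bij_inv_eq_iff)

definition permutation_pairings :: "(nat \<Rightarrow> complex) \<Rightarrow> (nat \<Rightarrow> complex) \<Rightarrow> complex set" where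
  "permutation_pairings b r = {pairing b r (permutation_matrix \<sigma>) | \<sigma>. bij \<sigma>}"

lemma permutation_pairings_commute: "permutation_pairings b r = permutation_pairings r b"
proof -
  have "permutation_pairings b r \<subseteq> permutation_pairings r b" for b r
  proof
    fix z assume "z \<in> permutation_pairings b r"
    then obtain \<sigma> where \<sigma>: "bij \<sigma>" "z = pairing b r (permutation_matrix \<sigma>)"
      by (auto simp: permutation_pairings_def)
    then have "z = pairing r b (permutation_matrix (inv \<sigma>))"
      by (simp add: pairing_transpose[symmetric, of b r] permutation_matrix_transpose)
    then show "z \<in> permutation_pairings r b"
      using bij_imp_bij_inv[OF \<sigma>(1)] by (auto simp: permutation_pairings_def)
  qed
  then show ?thesis by blast
qed

lemma convex_doubly_stochastic_pairings:
  assumes br: "pairable b r"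
  shows "convex {pairing b r D | D. doubly_stochastic D}"
proof (rule convexI)
  fix x y :: complex and s t :: real
  assume "x \<in> {pairing b r D | D. doubly_stochastic D}" "y \<in> {pairing b r D | D. doubly_stochastic D}"
    and st: "0 \<le> s" "0 \<le> t" "s + t = 1"
  then obtain D E where D: "doubly_stochastic D" "x = pairing b r D"
    and E: "doubly_stochastic E" "y = pairing b r E" by blast
  let ?F = "\<lambda>i j. s * D i j + t * E i j"
  let ?g = "\<lambda>D (i, j). complex_of_real (D i j) * (b i * r j)"
  have F: "doubly_stochastic ?F"
    unfolding doubly_stochastic_def
  proof (intro conjI allI)
    fix i j
    show "0 \<le> ?F i j" using st doubly_stochasticD(1)[OF D(1)] doubly_stochasticD(1)[OF E(1)] by simp
    show "((\<lambda>j. ?F i j) has_sum 1) UNIV" "((\<lambda>i. ?F i j) has_sum 1) UNIV"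
      using has_sum_add[OF has_sum_cmult_right[OF doubly_stochasticD(2)[OF D(1), of i], of s]
          has_sum_cmult_right[OF doubly_stochasticD(2)[OF E(1), of i], of t]]
        has_sum_add[OF has_sum_cmult_right[OF doubly_stochasticD(3)[OF D(1), of j], of s]
          has_sum_cmult_right[OF doubly_stochasticD(3)[OF E(1), of j], of t]] st(3) by simp_all
  qed
  have sum: "(?g D has_sum pairing b r D) UNIV" if "doubly_stochastic D" for D
    using abs_summable_summable[OF pairing_abs_summable[OF br that]] by (simp add: pairing_def)
  have "((\<lambda>p. complex_of_real s * ?g D p + complex_of_real t * ?g E p) has_sum
      (complex_of_real s * x + complex_of_real t * y)) UNIV"
    unfolding D E by (intro has_sum_add has_sum_cmult_right sum D E)
  also have "(\<lambda>p. complex_of_real s * ?g D p + complex_of_real t * ?g E p) = ?g ?F"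
    by (auto simp: fun_eq_iff algebra_simps)
  finally have "s *\<^sub>R x + t *\<^sub>R y = pairing b r ?F"
    unfolding pairing_def by (simp add: infsumI scaleR_conv_of_real)
  then show "s *\<^sub>R x + t *\<^sub>R y \<in> {pairing b r D | D. doubly_stochastic D}" using F by blast
qed

lemma bounded_permutation_pairings:
  assumes br: "pairable b r"
  shows "bounded (permutation_pairings b r)"
proof -
  obtain N where N: "\<And>D. doubly_stochastic D \<Longrightarrow>
    norm (pairing b r D - (\<Sum>i<N. \<Sum>j<N. complex_of_real (D i j) * (b i * r j))) \<le> 1"
    using pairing_uniform_truncation[OF br, of 1] by auto
  have "norm (pairing b r D) \<le> 1 + (\<Sum>i<N. \<Sum>j<N. norm (b i * r j))" if D: "doubly_stochastic D" for D
  proof -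
    have "norm (\<Sum>i<N. \<Sum>j<N. complex_of_real (D i j) * (b i * r j)) \<le> (\<Sum>i<N. \<Sum>j<N. norm (b i * r j))"
      by (intro sum_norm_le)
         (use doubly_stochasticD(1,4)[OF D] in \<open>auto simp: norm_mult intro!: mult_left_le_one_le\<close>)
    then show ?thesis using N[OF D] norm_triangle_sub by (smt (verit))
  qed
  then show ?thesis
    using doubly_stochastic_permutation_matrix
    by (intro boundedI[of _ "1 + (\<Sum>i<N. \<Sum>j<N. norm (b i * r j))"]) (auto simp: permutation_pairings_def)
qed

section \<open>Reduction to finitely many coordinates\<close>

text \<open>With the corner \<open>A\<close>, the completion is the block matrix with rows \<open>(A, U)\<close> and \<open>(V, A\<^sup>T)\<close>, where the
diagonal matrices \<open>U\<close> and \<open>V\<close> hold what the rows and columns of \<open>A\<close> lack to have sum \<open>1\<close>.\<close>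

lemma doubly_stochastic_completion:
  assumes D: "doubly_stochastic D"
  obtains E where "\<And>i j. 0 \<le> E i j"
    "\<And>i. i < 2 * N \<Longrightarrow> (\<Sum>j<2 * N. E i j) = 1" "\<And>j. j < 2 * N \<Longrightarrow> (\<Sum>i<2 * N. E i j) = 1"
    "\<And>i j. i < N \<Longrightarrow> j < N \<Longrightarrow> E i j = D i j"
proof -
  define u where "u i = 1 - (\<Sum>j<N. D i j)" for i
  define v where "v j = 1 - (\<Sum>i<N. D i j)" for j
  have uv: "0 \<le> u i" "0 \<le> v i" for i
  proof -
    have "(\<Sum>j<N. D i j) \<le> 1"
      by (rule has_sum_mono2[OF has_sum_finite doubly_stochasticD(2)[OF D]])
         (use doubly_stochasticD(1)[OF D] in auto)
    moreover have "(\<Sum>j<N. D j i) \<le> 1"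
      by (rule has_sum_mono2[OF has_sum_finite doubly_stochasticD(3)[OF D]])
         (use doubly_stochasticD(1)[OF D] in auto)
    ultimately show "0 \<le> u i" "0 \<le> v i" by (auto simp: u_def v_def)
  qed
  define E where "E i j =
     (if i < N then if j < N then D i j else if j = N + i then u i else 0
      else if j < N then if i = N + j then v j else 0 else D (j - N) (i - N))" for i j
  have split: "(\<Sum>k<2 * N. f k) = (\<Sum>k<N. f k) + (\<Sum>k<N. f (N + k))" for f :: "nat \<Rightarrow> real"
  proof -
    have "{..<2 * N} = {..<N} \<union> (\<lambda>k. N + k) ` {..<N}"
    proof -
      have "x \<in> (\<lambda>k. N + k) ` {..<N}" if "x < 2 * N" "\<not> x < N" for x
        using that by (intro image_eqI[of _ _ "x - N"]) auto
      then show ?thesis by auto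
    qed
    then have "(\<Sum>k<2 * N. f k) = (\<Sum>k<N. f k) + sum f ((\<lambda>k. N + k) ` {..<N})"
      by (simp only:) (rule sum.union_disjoint, auto)
    then show ?thesis by (subst (asm) sum.reindex) auto
  qed
  show ?thesis
  proof (rule that[of E])
    show "0 \<le> E i j" for i j using uv doubly_stochasticD(1)[OF D] by (auto simp: E_def)
    show "(\<Sum>j<2 * N. E i j) = 1" if i: "i < 2 * N" for i
    proof (cases "i < N")
      case True
      then show ?thesis by (simp add: split E_def u_def)
    next
      case False
      then obtain k where k: "i = N + k" "k < N" using i by (metis add_less_cancel_left le_Suc_ex mult_2 not_less)
      then show ?thesis by (simp add: split E_def v_def eq_commute[of k])
    qed
    show "(\<Sum>i<2 * N. E i j) = 1" if j: "j < 2 * N" for j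
    proof (cases "j < N")
      case True
      then show ?thesis by (simp add: split E_def v_def)
    next
      case False
      then obtain k where k: "j = N + k" "k < N" using j by (metis add_less_cancel_left le_Suc_ex mult_2 not_less)
      then show ?thesis by (simp add: split E_def u_def eq_commute[of k])
    qed
    show "E i j = D i j" if "i < N" "j < N" for i j using that by (simp add: E_def)
  qed
qed

text \<open>The matrix is replaced by the completion of a corner, continued by the identity. The two pairings
agree on the corner, so both are close to the same finite sum. The image \<open>x\<close> of \<open>\<rho>\<close> under the new
matrix is reached from \<open>\<rho>\<close> by averaging pairs of coordinates.\<close>

lemma pairing_approx_by_swap_averages:
  assumes br: "pairable b r" and r: "\<And>j. r j = u * complex_of_real (\<rho> j)"
    and D: "doubly_stochastic D" and "0 < \<epsilon>"
  obtains M x z where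
    "\<And>S. \<lbrakk>swap_averaging_closed M S; \<And>y p. y \<in> S \<Longrightarrow> p permutes {..<M} \<Longrightarrow> y \<circ> p \<in> S; \<rho> \<in> S\<rbrakk> \<Longrightarrow> x \<in> S"
    "((\<lambda>i. b i * (u * complex_of_real (x i))) has_sum z) UNIV"
    "norm (z - pairing b r D) \<le> \<epsilon>"
proof -
  obtain N where N: "\<And>D. doubly_stochastic D \<Longrightarrow>
    norm (pairing b r D - (\<Sum>i<N. \<Sum>j<N. complex_of_real (D i j) * (b i * r j))) \<le> \<epsilon> / 2"
    using pairing_uniform_truncation[OF br, of "\<epsilon> / 2"] \<open>0 < \<epsilon>\<close> by auto
  define M where "M = 2 * N"
  obtain E where E: "\<And>i j. 0 \<le> E i j"
    "\<And>i. i < M \<Longrightarrow> (\<Sum>j<M. E i j) = 1" "\<And>j. j < M \<Longrightarrow> (\<Sum>i<M. E i j) = 1"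
    "\<And>i j. i < N \<Longrightarrow> j < N \<Longrightarrow> E i j = D i j"
    using doubly_stochastic_completion[OF D, of N] unfolding M_def by blast
  \<comment> \<open>The completed corner, continued by the identity matrix.\<close>
  define F where "F i j = (if i < M \<and> j < M then E i j else if i = j then 1 else 0)" for i j
  have row: "((\<lambda>j. complex_of_real (F i j) * f j) has_sum
      (if i < M then \<Sum>j<M. complex_of_real (E i j) * f j else f i)) UNIV" for i f
    by (rule has_sum_finite_neutralI[of "if i < M then {..<M} else {i}"])
       (auto simp: F_def intro!: sum.cong split: if_splits)
  have Frow: "((\<lambda>j. F i j) has_sum 1) UNIV" for i
    by (rule has_sum_finite_neutralI[of "if i < M then {..<M} else {i}"])
       (auto simp: F_def E(2) split: if_splits)
  have Fcol: "((\<lambda>i. F i j) has_sum 1) UNIV" for j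
    by (rule has_sum_finite_neutralI[of "if j < M then {..<M} else {j}"])
       (auto simp: F_def E(3) split: if_splits)
  have F: "doubly_stochastic F"
    using Frow Fcol by (auto simp: doubly_stochastic_def F_def E(1))
  define x where "x i = (if i < M then \<Sum>j<M. E i j * \<rho> j else \<rho> i)" for i
  show ?thesis
  proof (rule that[of M x "pairing b r F"])
    fix S assume "swap_averaging_closed M S" "\<And>y p. y \<in> S \<Longrightarrow> p permutes {..<M} \<Longrightarrow> y \<circ> p \<in> S" "\<rho> \<in> S"
    then show "x \<in> S"
      by (rule swap_averaging_reaches_doubly_stochastic_image[where D = E])
         (use E in \<open>auto simp: x_def\<close>)
  next
    have "((\<lambda>j. complex_of_real (F i j) * r j) has_sum u * complex_of_real (x i)) UNIV" for i
      using row[of i r] by (cases "i < M") (simp_all add: x_def r sum_distrib_left mult_ac)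
    then show "((\<lambda>i. b i * (u * complex_of_real (x i))) has_sum pairing b r F) UNIV"
      by (rule pairing_by_rows[OF br F])
  next
    let ?t = "\<lambda>D. \<Sum>i<N. \<Sum>j<N. complex_of_real (D i j) * (b i * r j)"
    have "?t F = ?t D" by (intro sum.cong refl) (simp add: F_def M_def E(4))
    then have "pairing b r F - pairing b r D = (pairing b r F - ?t F) - (pairing b r D - ?t D)" by simp
    also have "norm \<dots> \<le> \<epsilon> / 2 + \<epsilon> / 2"
      by (rule order_trans[OF norm_triangle_ineq4 add_mono[OF N[OF F] N[OF D]]])
    finally show "norm (pairing b r F - pairing b r D) \<le> \<epsilon>" by simp
  qed
qed

text \<open>An approximate form of the Birkhoff-von Neumann theorem. The property of \<open>x\<close> that is propagated from
\<open>\<rho>\<close> is that every rearrangement of \<open>x\<close> on the first \<open>M\<close> places has its value in the convex hull. A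
bare statement on \<open>x\<close> would not survive the averaging of two coordinates, which involves the vector
with these coordinates exchanged.\<close>

lemma pairing_in_closure_convex_hull:
  assumes br: "pairable b r" and r: "\<And>j. r j = u * complex_of_real (\<rho> j)" and D: "doubly_stochastic D"
  shows "pairing b r D \<in> closure (convex hull (permutation_pairings b r))"
  unfolding closure_approachable
proof (intro allI impI)
  fix \<epsilon> :: real assume "0 < \<epsilon>"
  let ?K = "convex hull (permutation_pairings b r)"
  obtain M x z where reach:
      "\<And>S. \<lbrakk>swap_averaging_closed M S; \<And>y p. y \<in> S \<Longrightarrow> p permutes {..<M} \<Longrightarrow> y \<circ> p \<in> S; \<rho> \<in> S\<rbrakk> \<Longrightarrow> x \<in> S"
    and x: "((\<lambda>i. b i * (u * complex_of_real (x i))) has_sum z) UNIV"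
    and z: "norm (z - pairing b r D) \<le> \<epsilon> / 2"
    using pairing_approx_by_swap_averages[OF br r D, of "\<epsilon> / 2"] \<open>0 < \<epsilon>\<close> by auto
  let ?s = "\<lambda>y z. ((\<lambda>i. b i * (u * complex_of_real (y i))) has_sum z) UNIV"
  define S where "S = {y. \<forall>p. p permutes {..<M} \<longrightarrow> (\<exists>z\<in>?K. ?s (y \<circ> p) z)}"
  have "x \<in> S"
  proof (rule reach)
    show "y \<circ> p \<in> S" if "y \<in> S" "p permutes {..<M}" for y p
      unfolding S_def
    proof (intro CollectI allI impI)
      fix q assume "q permutes {..<M}"
      then have "p \<circ> q permutes {..<M}" using that(2) by (rule permutes_compose)
      then have "\<exists>z\<in>?K. ?s (y \<circ> (p \<circ> q)) z" using that(1) unfolding S_def by blast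
      then show "\<exists>z\<in>?K. ?s (y \<circ> p \<circ> q) z" by (simp only: comp_assoc)
    qed
    show "\<rho> \<in> S"
      unfolding S_def
    proof (intro CollectI allI impI)
      fix p assume p: "p permutes {..<M}"
      have "pairing b r (permutation_matrix p) \<in> ?K"
        using permutes_bij[OF p] by (intro hull_inc) (auto simp: permutation_pairings_def)
      moreover have "?s (\<rho> \<circ> p) (pairing b r (permutation_matrix p))"
        using pairing_permutation_matrix[OF br permutes_bij[OF p]] by (simp add: r)
      ultimately show "\<exists>z\<in>?K. ?s (\<rho> \<circ> p) z" by blast
    qed
    show "swap_averaging_closed M S"
      unfolding swap_averaging_closed_def
    proof (intro ballI allI impI)
      fix y i j and s :: real
      assume y: "y \<in> S" and ij: "i < M" "j < M" "i \<noteq> j" and s: "0 \<le> s" "s \<le> 1"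
      let ?t = "Transposition.transpose i j"
      let ?y = "y(i := (1 - s) * y i + s * y j, j := s * y i + (1 - s) * y j)"
      \<comment> \<open>Averaging mixes \<open>y\<close> with the vector in which the two coordinates are exchanged.\<close>
      have eq: "?y k = (1 - s) * y k + s * y (?t k)" for k
        using ij(3) by (auto simp: Transposition.transpose_def algebra_simps)
      show "?y \<in> S"
        unfolding S_def
      proof (intro CollectI allI impI)
        fix p assume p: "p permutes {..<M}"
        have "?t \<circ> p permutes {..<M}"
          by (rule permutes_compose[OF p permutes_swap_id]) (use ij in auto)
        then obtain z1 z2 where z: "z1 \<in> ?K" "?s (y \<circ> p) z1" "z2 \<in> ?K" "?s (y \<circ> (?t \<circ> p)) z2"
          using y p unfolding S_def by blast
        have "(1 - s) *\<^sub>R z1 + s *\<^sub>R z2 \<in> ?K"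
          using z s by (intro convexD[OF convex_convex_hull]) auto
        moreover have "?s (?y \<circ> p) ((1 - s) *\<^sub>R z1 + s *\<^sub>R z2)"
          using has_sum_add[OF has_sum_cmult_right[OF z(2), of "1 - s"] has_sum_cmult_right[OF z(4), of s]]
          by (simp only: eq comp_def) (simp add: scaleR_conv_of_real algebra_simps)
        ultimately show "\<exists>z\<in>?K. ?s (?y \<circ> p) z" by blast
      qed
    qed
  qed
  then obtain z' where "z' \<in> ?K" "?s (x \<circ> id) z'"
    unfolding S_def using permutes_id by blast
  then have "z \<in> ?K" using has_sum_unique[OF x, of z'] by simp
  then show "\<exists>y\<in>?K. dist y (pairing b r D) < \<epsilon>"
    using z \<open>0 < \<epsilon>\<close> by (auto simp: dist_norm intro!: bexI[of _ z])
qed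

text \<open>The values on the doubly stochastic matrices form a convex set between \<open>W\<close> and its closure, and
also between the convex hull of the values on permutation matrices and its closure.\<close>

lemma closure_pairings_eq_convex_hull:
  assumes br: "pairable b r" and r: "\<And>j. r j = u * complex_of_real (\<rho> j)"
    and W: "W \<subseteq> {pairing b r D | D. doubly_stochastic D}"
    and dense: "\<And>D. doubly_stochastic D \<Longrightarrow> pairing b r D \<in> closure W"
  shows "closure W = convex hull (closure (permutation_pairings b r))"
proof -
  let ?P = "permutation_pairings b r" and ?V = "{pairing b r D | D. doubly_stochastic D}"
  have "?P \<subseteq> ?V"
    using doubly_stochastic_permutation_matrix by (auto simp: permutation_pairings_def)
  then have PV: "convex hull ?P \<subseteq> ?V"
    by (intro hull_minimal convex_doubly_stochastic_pairings[OF br])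
  have "compact (closure ?P)" using bounded_permutation_pairings[OF br] by simp
  then have "compact (convex hull (closure ?P))" by (rule compact_convex_hull)
  then have cl: "closed (convex hull (closure ?P))" by (rule compact_imp_closed)
  have hull: "convex hull (closure ?P) = closure (convex hull ?P)"
  proof
    show "convex hull (closure ?P) \<subseteq> closure (convex hull ?P)"
      by (intro hull_minimal closure_mono hull_subset convex_closure convex_convex_hull)
    show "closure (convex hull ?P) \<subseteq> convex hull (closure ?P)"
      by (intro closure_minimal cl hull_mono closure_subset)
  qed
  have "W \<subseteq> closure (convex hull ?P)"
    using W pairing_in_closure_convex_hull[OF br r] by blast
  moreover have "convex hull ?P \<subseteq> closure W" using PV dense by blast
  ultimately have "closure W = closure (convex hull ?P)"
    by (metis closed_closure closure_minimal subset_antisym)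
  then show ?thesis using hull by simp
qed

section \<open>Inner products and orthonormal bases\<close>

lemma cinner_add_left: "cinner (x + y) z = cinner x z + cinner y (z::'a::complex_hilbert_space)"
  by (metis cinner_add_right cinner_commute complex_cnj_add)

lemma cinner_scaleC_left: "cinner (a *\<^sub>C x) y = cnj a * cinner x (y::'a::complex_hilbert_space)"
  by (metis cinner_commute cinner_scaleC_right complex_cnj_mult)

lemma cinner_scaleR_right: "cinner x (r *\<^sub>R y) = r *\<^sub>R cinner x (y::'a::complex_hilbert_space)"
  by (metis cinner_scaleC_right scaleC_of_real scaleR_conv_of_real)

lemma cinner_scaleR_left: "cinner (r *\<^sub>R x) y = r *\<^sub>R cinner x (y::'a::complex_hilbert_space)"
  by (metis cinner_scaleC_left scaleC_of_real scaleR_conv_of_real complex_cnj_complex_of_real)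

lemma cinner_zero_left [simp]: "cinner 0 (x::'a::complex_hilbert_space) = 0"
  using cinner_scaleR_left[of 0 x x] by simp

lemma cinner_zero_right [simp]: "cinner (x::'a::complex_hilbert_space) 0 = 0"
  using cinner_scaleR_right[of x 0 x] by simp

lemma cinner_diff_right: "cinner x (y - z) = cinner x y - cinner x (z::'a::complex_hilbert_space)"
  using cinner_add_right[of x "y - z" z] by simp

lemma cinner_diff_left: "cinner (x - y) z = cinner x z - cinner y (z::'a::complex_hilbert_space)"
  using cinner_add_left[of "x - y" y z] by simp

lemma cinner_sum_right: "cinner x (\<Sum>i\<in>A. f i) = (\<Sum>i\<in>A. cinner x (f i :: 'a::complex_hilbert_space))"
  by (induction A rule: infinite_finite_induct) (auto simp: cinner_add_right)

lemma cinner_self_eq_zero [simp]: "cinner x x = 0 \<longleftrightarrow> (x::'a::complex_hilbert_space) = 0"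
  by (simp add: cinner_self)

lemma power2_norm_eq_cinner: "(norm x)\<^sup>2 = Re (cinner x (x::'a::complex_hilbert_space))"
  by (simp add: cinner_self)

lemma cinner_eq_zero_commute: "cinner x y = 0 \<longleftrightarrow> cinner y (x::'a::complex_hilbert_space) = 0"
  by (metis cinner_commute complex_cnj_zero_iff)

lemma cmod_cinner_commute: "cmod (cinner x y) = cmod (cinner y (x::'a::complex_hilbert_space))"
  by (metis cinner_commute complex_mod_cnj)

lemma cinner_mult_cnj: "cinner x y * cinner y x = complex_of_real ((cmod (cinner y (x::'a::complex_hilbert_space)))\<^sup>2)"
  by (metis cinner_commute complex_norm_square mult.commute)

lemma norm_scaleC: "norm (a *\<^sub>C x) = cmod a * norm (x::'a::complex_hilbert_space)"
proof -
  have "complex_of_real ((norm (a *\<^sub>C x))\<^sup>2) = cnj a * a * complex_of_real ((norm x)\<^sup>2)"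
    by (simp only: cinner_self[symmetric] cinner_scaleC_left cinner_scaleC_right mult_ac)
  also have "\<dots> = complex_of_real ((cmod a * norm x)\<^sup>2)"
    by (simp add: power_mult_distrib complex_norm_square[symmetric] mult.commute[of "cnj a"] del: of_real_power flip: of_real_mult)
  finally have "(norm (a *\<^sub>C x))\<^sup>2 = (cmod a * norm x)\<^sup>2" using of_real_eq_iff by blast
  then show ?thesis by (simp add: power2_eq_iff_nonneg)
qed

lemma norm_add_orthogonal:
  assumes "cinner x y = (0::complex)"
  shows "(norm (x + y))\<^sup>2 = (norm x)\<^sup>2 + (norm (y::'a::complex_hilbert_space))\<^sup>2"
  using assms cinner_eq_zero_commute[of x y]
  by (simp add: power2_norm_eq_cinner cinner_add_left cinner_add_right)

lemma Cauchy_Schwarz_cinner: "cmod (cinner x y) \<le> norm x * norm (y::'a::complex_hilbert_space)"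
proof (cases "x = 0")
  case False
  define a where "a = cinner x y / complex_of_real ((norm x)\<^sup>2)"
  have "cinner x (y - a *\<^sub>C x) = cinner x y - a * complex_of_real ((norm x)\<^sup>2)"
    by (simp only: cinner_diff_right cinner_scaleC_right cinner_self)
  also have "\<dots> = 0" using False by (simp add: a_def)
  finally have "cinner (a *\<^sub>C x) (y - a *\<^sub>C x) = 0" by (simp add: cinner_scaleC_left)
  from norm_add_orthogonal[OF this] have "(cmod a * norm x)\<^sup>2 \<le> (norm y)\<^sup>2" by (simp add: norm_scaleC)
  then have "cmod a * norm x \<le> norm y" by (rule power2_le_imp_le) simp
  moreover have "cmod a = cmod (cinner x y) / (norm x)\<^sup>2"
    by (simp add: a_def norm_divide norm_power)
  ultimately show ?thesis using False by (simp add: power2_eq_square field_simps)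
qed simp

lemma bounded_bilinear_cinner: "bounded_bilinear (cinner :: 'a::complex_hilbert_space \<Rightarrow> 'a \<Rightarrow> complex)"
  by standard (auto simp: cinner_add_left cinner_add_right cinner_scaleR_left cinner_scaleR_right
      intro!: exI[of _ 1] Cauchy_Schwarz_cinner)

lemma bounded_linear_scaleC_right: "bounded_linear (\<lambda>x::'a::complex_hilbert_space. a *\<^sub>C x)"
  by (rule bounded_linear_intro[of _ "cmod a"])
     (auto simp: scaleC_add_right norm_scaleC mult_ac scaleC_scaleC simp flip: scaleC_of_real)

lemmas bounded_linear_cinner_right = bounded_bilinear.bounded_linear_right[OF bounded_bilinear_cinner]
lemmas tendsto_scaleC_right = bounded_linear.tendsto[OF bounded_linear_scaleC_right]

lemma orthonormal_seqD:
  assumes "orthonormal_seq e"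
  shows "cinner (e m) (e n) = (if m = n then 1 else 0)" "norm (e n) = 1" "e n \<noteq> 0" "inj e"
proof -
  show *: "cinner (e m) (e n) = (if m = n then 1 else 0)" for m n
    using assms by (simp add: orthonormal_seq_def)
  show "norm (e n) = 1" 
    using *[of n n] power2_norm_eq_cinner[of "e n"] by (intro power2_eq_imp_eq[of _ 1]) auto
  then show "e n \<noteq> 0" by auto
  show "inj e"
  proof (rule injI)
    fix m n assume "e m = e n"
    then have "cinner (e m) (e n) = 1" using *[of n n] by simp
    then show "m = n" using *[of m n] by (simp split: if_splits)
  qed
qed

lemma norm_orthonormal_combination:
  assumes "orthonormal_seq e" "finite F"
  shows "(norm (\<Sum>n\<in>F. a n *\<^sub>C e n))\<^sup>2 = (\<Sum>n\<in>F. (cmod (a n))\<^sup>2)"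
  using assms(2)
proof induction
  case (insert k F)
  have "cinner (a k *\<^sub>C e k) (\<Sum>n\<in>F. a n *\<^sub>C e n) = 0"
    unfolding cinner_sum_right using insert(2)
    by (intro sum.neutral) (auto simp: cinner_scaleC_left cinner_scaleC_right orthonormal_seqD(1)[OF assms(1)])
  from norm_add_orthogonal[OF this] insert show ?case
    by (simp add: norm_scaleC orthonormal_seqD(2)[OF assms(1)])
qed simp

lemma summable_orthonormal_combination:
  assumes e: "orthonormal_seq e" and a: "summable (\<lambda>n. (cmod (a n))\<^sup>2)"
  shows "summable (\<lambda>n. a n *\<^sub>C e n)"
  unfolding summable_Cauchy
proof (intro allI impI)
  fix \<epsilon> :: real assume "0 < \<epsilon>"
  then obtain N where N: "\<And>m n. N \<le> m \<Longrightarrow> norm (\<Sum>n\<in>{m..<n}. (cmod (a n))\<^sup>2) < \<epsilon>\<^sup>2"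
    using a[unfolded summable_Cauchy] by (meson zero_less_power)
  have "norm (\<Sum>n\<in>{m..<n}. a n *\<^sub>C e n) < \<epsilon>" if "N \<le> m" for m n
    using N[OF that, of n] norm_orthonormal_combination[OF e, of "{m..<n}" a] \<open>0 < \<epsilon>\<close>
    by (intro power_less_imp_less_base[of _ 2 \<epsilon>]) auto
  then show "\<exists>N. \<forall>m\<ge>N. \<forall>n. norm (\<Sum>n\<in>{m..<n}. a n *\<^sub>C e n) < \<epsilon>" by blast
qed

lemma cinner_orthonormal_sums:
  assumes e: "orthonormal_seq e" and "(\<lambda>n. a n *\<^sub>C e n) sums x"
  shows "cinner (e k) x = a k"
proof -
  have "(\<lambda>n. cinner (e k) (a n *\<^sub>C e n)) sums cinner (e k) x"
    by (rule bounded_linear.sums[OF bounded_linear_cinner_right assms(2)])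
  also have "(\<lambda>n. cinner (e k) (a n *\<^sub>C e n)) = (\<lambda>n. if n = k then a k else 0)"
    by (auto simp: cinner_scaleC_right orthonormal_seqD(1)[OF e] fun_eq_iff)
  finally show ?thesis by (rule sums_unique2) (rule sums_single)
qed

lemma Bessel_inequality:
  assumes e: "orthonormal_seq e"
  shows "summable (\<lambda>n. (cmod (cinner (e n) x))\<^sup>2)" "(\<Sum>n. (cmod (cinner (e n) x))\<^sup>2) \<le> (norm x)\<^sup>2"
proof -
  have *: "(\<Sum>n<N. (cmod (cinner (e n) x))\<^sup>2) \<le> (norm x)\<^sup>2" for N
  proof -
    let ?y = "\<Sum>n<N. cinner (e n) x *\<^sub>C e n"
    have k: "cinner (e k) ?y = cinner (e k) x" if "k < N" for k
    proof -
      have "cinner (e k) ?y = (\<Sum>n<N. if n = k then cinner (e k) x else 0)"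
        unfolding cinner_sum_right
        by (intro sum.cong) (auto simp: cinner_scaleC_right orthonormal_seqD(1)[OF e])
      then show ?thesis using that by simp
    qed
    have "cinner (x - ?y) ?y = 0"
      unfolding cinner_sum_right
    proof (intro sum.neutral ballI)
      fix n assume "n \<in> {..<N}"
      then have "cinner (e n) (x - ?y) = 0" using k by (simp add: cinner_diff_right)
      then have "cinner (x - ?y) (e n) = 0" using cinner_eq_zero_commute[of "e n"] by blast
      then show "cinner (x - ?y) (cinner (e n) x *\<^sub>C e n) = 0"
        by (simp only: cinner_scaleC_right mult_zero_right)
    qed
    from norm_add_orthogonal[OF this] norm_orthonormal_combination[OF e, of "{..<N}"]
    show ?thesis by simp
  qed
  show s: "summable (\<lambda>n. (cmod (cinner (e n) x))\<^sup>2)"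
    by (rule summableI_nonneg_bounded[of _ "(norm x)\<^sup>2"]) (use * in auto)
  show "(\<Sum>n. (cmod (cinner (e n) x))\<^sup>2) \<le> (norm x)\<^sup>2"
    by (rule suminf_le_const[OF s]) (use * in auto)
qed

lemma projection_onto_orthonormal_seq:
  assumes e: "orthonormal_seq e"
  obtains y where "(\<lambda>n. cinner (e n) x *\<^sub>C e n) sums y" "\<And>k. cinner (e k) (x - y) = 0"
proof -
  have *: "(\<lambda>n. cinner (e n) x *\<^sub>C e n) sums (\<Sum>n. cinner (e n) x *\<^sub>C e n)"
    by (intro summable_sums summable_orthonormal_combination[OF e] Bessel_inequality(1)[OF e])
  then show ?thesis
    by (rule that) (simp add: cinner_diff_right cinner_orthonormal_sums[OF e *])
qed

lemma orthonormal_basis_expansion: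
  assumes e: "orthonormal_basis e"
  shows "(\<lambda>n. cinner (e n) x *\<^sub>C e n) sums x"
proof -
  have o: "orthonormal_seq e" and c: "closure (cspan (range e)) = UNIV"
    using e by (auto simp: orthonormal_basis_def)
  obtain y where y: "(\<lambda>n. cinner (e n) x *\<^sub>C e n) sums y" "\<And>k. cinner (e k) (x - y) = 0"
    using projection_onto_orthonormal_seq[OF o] by blast
  \<comment> \<open>What is orthogonal to all \<open>e n\<close> is orthogonal to their closed span, hence to itself.\<close>
  let ?Z = "{z. cinner (x - y) z = 0}"
  have "cspan (range e) \<subseteq> ?Z"
  proof (rule complex_vector.span_minimal)
    show "range e \<subseteq> ?Z"
    proof
      fix z assume "z \<in> range e"
      then have "cinner z (x - y) = 0" using y(2) by auto
      then show "z \<in> ?Z" using cinner_eq_zero_commute[of z] by simp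
    qed
    show "complex_vector.subspace ?Z"
      by (auto simp: complex_vector.subspace_def cinner_add_right cinner_scaleC_right)
  qed
  moreover have "closed ?Z"
    by (intro closed_Collect_eq continuous_intros
        bounded_linear.continuous_on[OF bounded_linear_cinner_right])
  ultimately have "closure (cspan (range e)) \<subseteq> ?Z" by (rule closure_minimal)
  then have "x - y \<in> ?Z" using c by blast
  then have "x = y" by (simp only: mem_Collect_eq cinner_self_eq_zero right_minus_eq)
  then show ?thesis using y(1) by simp
qed

lemma orthonormal_basisI:
  assumes e: "orthonormal_seq e" and 0: "\<And>x. (\<And>n. cinner (e n) x = 0) \<Longrightarrow> x = 0"
  shows "orthonormal_basis e"
  unfolding orthonormal_basis_def
proof (intro conjI e equalityI subset_UNIV subsetI)
  fix x
  obtain y where y: "(\<lambda>n. cinner (e n) x *\<^sub>C e n) sums y" "\<And>k. cinner (e k) (x - y) = 0"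
    using projection_onto_orthonormal_seq[OF e] by blast
  then have "x = y" using 0[of "x - y"] by simp
  then have lim: "(\<lambda>N. \<Sum>n<N. cinner (e n) x *\<^sub>C e n) \<longlonglongrightarrow> x" using y(1) by (simp add: sums_def)
  have "(\<Sum>n<N. cinner (e n) x *\<^sub>C e n) \<in> cspan (range e)" for N
    by (intro complex_vector.span_sum complex_vector.span_scale complex_vector.span_base) auto
  then show "x \<in> closure (cspan (range e))"
    unfolding closure_sequential using lim by (intro exI[of _ "\<lambda>N. \<Sum>n<N. cinner (e n) x *\<^sub>C e n"]) auto
qed

lemma orthonormal_basisD:
  assumes "orthonormal_basis e"
  shows "orthonormal_seq e" "(\<And>n. cinner (e n) x = 0) \<Longrightarrow> x = 0"
proof -
  show "orthonormal_seq e" using assms by (simp add: orthonormal_basis_def)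
  assume "\<And>n. cinner (e n) x = 0"
  then show "x = 0"
    using orthonormal_basis_expansion[OF assms, of x] sums_unique2[OF _ sums_zero, of x] by simp
qed

lemma orthonormal_basis_eqI:
  assumes "orthonormal_basis e" "\<And>n. cinner (e n) x = cinner (e n) y"
  shows "x = y"
  using orthonormal_basisD(2)[OF assms(1), of "x - y"] assms(2) by (simp add: cinner_diff_right)

text \<open>Bessel's inequality for \<open>x\<close> and for \<open>y\<close>, combined by \<open>2 * a * b \<le> a\<^sup>2 + b\<^sup>2\<close>.\<close>

lemma Bessel_products:
  assumes e: "orthonormal_seq e"
  shows "(\<lambda>n. cmod (cinner x (e n) * cinner (e n) y)) summable_on UNIV"
    "(\<Sum>\<^sub>\<infinity>n. cmod (cinner x (e n) * cinner (e n) y)) \<le> ((norm x)\<^sup>2 + (norm y)\<^sup>2) / 2"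
proof -
  let ?B = "\<lambda>x n. (cmod (cinner (e n) x))\<^sup>2"
  have B: "((\<lambda>n. (?B x n + ?B y n) / 2) has_sum ((\<Sum>n. ?B x n) + (\<Sum>n. ?B y n)) / 2) UNIV"
    by (rule sums_nonneg_imp_has_sum)
       (auto intro!: sums_divide sums_add summable_sums Bessel_inequality(1)[OF e])
  have le: "cmod (cinner x (e n) * cinner (e n) y) \<le> (?B x n + ?B y n) / 2" for n
    using sum_squares_bound[of "cmod (cinner (e n) x)" "cmod (cinner (e n) y)"]
    by (simp add: norm_mult cmod_cinner_commute[of x])
  show s: "(\<lambda>n. cmod (cinner x (e n) * cinner (e n) y)) summable_on UNIV"
    by (rule summable_on_comparison_test[OF has_sum_imp_summable[OF B]]) (use le in auto)
  have "(\<Sum>\<^sub>\<infinity>n. cmod (cinner x (e n) * cinner (e n) y)) \<le> ((\<Sum>n. ?B x n) + (\<Sum>n. ?B y n)) / 2"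
    by (rule has_sum_mono[OF has_sum_infsum[OF s] B]) (use le in auto)
  then show "(\<Sum>\<^sub>\<infinity>n. cmod (cinner x (e n) * cinner (e n) y)) \<le> ((norm x)\<^sup>2 + (norm y)\<^sup>2) / 2"
    using Bessel_inequality(2)[OF e, of x] Bessel_inequality(2)[OF e, of y] by simp
qed

lemma Parseval_identity:
  assumes e: "orthonormal_basis e"
  shows "((\<lambda>n. cinner x (e n) * cinner (e n) y) has_sum cinner x y) UNIV"
proof -
  have "(\<lambda>n. cinner x (cinner (e n) y *\<^sub>C e n)) sums cinner x y"
    by (rule bounded_linear.sums[OF bounded_linear_cinner_right orthonormal_basis_expansion[OF e]])
  then have "(\<lambda>n. cinner x (e n) * cinner (e n) y) sums cinner x y"
    by (simp add: cinner_scaleC_right mult.commute)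
  moreover have "summable (\<lambda>n. cmod (cinner x (e n) * cinner (e n) y))"
    by (rule summable_on_imp_summable[OF Bessel_products(1)[OF orthonormal_basisD(1)[OF e]]])
  ultimately show ?thesis by (intro norm_summable_imp_has_sum)
qed

lemma Parseval_norm:
  assumes e: "orthonormal_basis e"
  shows "((\<lambda>n. (cmod (cinner (e n) x))\<^sup>2) has_sum (norm x)\<^sup>2) UNIV"
  using has_sum_Re[OF Parseval_identity[OF e, of x x]]
  by (simp add: cinner_mult_cnj cinner_self flip: of_real_power)

text \<open>A maximal orthonormal set of vectors with the property \<open>Q\<close> has no nonzero vector orthogonal to it.
It is countable because its members have distance \<open>sqrt 2\<close> and the space is separable, and
infinite because the space is not spanned by finitely many vectors. With \<open>Q\<close> trivial this yields
some orthonormal basis, and with joint eigenvectors for \<open>Q\<close> it yields the spectral theorem.\<close>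

lemma exists_orthonormal_basis_of_kind:
  fixes Q :: "'a::complex_hilbert_space \<Rightarrow> bool"
  assumes infinite_dimensional: "\<not> finite_cdim (UNIV :: 'a set)"
    and separable: "separable_space (euclidean :: 'a topology)"
    and extend: "\<And>S x. \<lbrakk>\<And>s. s \<in> S \<Longrightarrow> Q s; x \<noteq> 0; \<And>s. s \<in> S \<Longrightarrow> cinner s x = 0\<rbrakk> \<Longrightarrow>
      \<exists>y. Q y \<and> norm y = 1 \<and> (\<forall>s\<in>S. cinner s y = 0)"
  obtains e :: "nat \<Rightarrow> 'a" where "orthonormal_basis e" "\<And>n. Q (e n)"
proof -
  define \<A> where "\<A> = {S. (\<forall>s\<in>S. Q s \<and> norm s = 1) \<and> (\<forall>s\<in>S. \<forall>t\<in>S. s \<noteq> t \<longrightarrow> cinner s t = 0)}"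
  have "\<exists>M\<in>\<A>. \<forall>X\<in>\<A>. M \<subseteq> X \<longrightarrow> X = M"
  proof (rule subset_Zorn_nonempty)
    show "\<A> \<noteq> {}" unfolding \<A>_def by blast
    fix \<C> assume C: "\<C> \<noteq> {}" "subset.chain \<A> \<C>"
    then have sub: "\<C> \<subseteq> \<A>" and ch: "\<And>X Y. X \<in> \<C> \<Longrightarrow> Y \<in> \<C> \<Longrightarrow> X \<subseteq> Y \<or> Y \<subseteq> X"
      by (auto simp: subset.chain_def)
    have "cinner s t = 0" if "s \<in> X" "X \<in> \<C>" "t \<in> Y" "Y \<in> \<C>" "s \<noteq> t" for s t X Y
    proof -
      have "\<exists>Z\<in>\<C>. s \<in> Z \<and> t \<in> Z" using ch[of X Y] that by blast
      then show ?thesis using sub that(5) by (auto simp: \<A>_def)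
    qed
    moreover have "Q s \<and> norm s = 1" if "s \<in> \<Union>\<C>" for s
      using sub that by (auto simp: \<A>_def)
    ultimately show "\<Union>\<C> \<in> \<A>" by (auto simp: \<A>_def)
  qed
  then obtain S where SA: "S \<in> \<A>" and max: "\<And>X. X \<in> \<A> \<Longrightarrow> S \<subseteq> X \<Longrightarrow> X = S" by blast
  have S: "\<And>s. s \<in> S \<Longrightarrow> Q s" "\<And>s. s \<in> S \<Longrightarrow> norm s = 1"
      "\<And>s t. s \<in> S \<Longrightarrow> t \<in> S \<Longrightarrow> s \<noteq> t \<Longrightarrow> cinner s t = 0"
    using SA by (auto simp: \<A>_def)
  have complete: "x = 0" if x: "\<And>s. s \<in> S \<Longrightarrow> cinner s x = 0" for x
  proof (rule ccontr)
    assume "x \<noteq> 0"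
    then obtain y where y: "Q y" "norm y = 1" "\<And>s. s \<in> S \<Longrightarrow> cinner s y = 0"
      using extend[of S x] S(1) x by auto
    have "cinner y s = 0" if "s \<in> S" for s using y(3)[OF that] cinner_eq_zero_commute[of y s] by simp
    then have "insert y S \<in> \<A>"
      unfolding \<A>_def using S y by auto
    then have "y \<in> S" using max[of "insert y S"] by blast
    then have "cinner y y = 0" by (rule y(3))
    then show False using y(2) by simp
  qed
  have "infinite S"
  proof
    assume fin: "finite S"
    have "x \<in> cspan S" for x
    proof -
      let ?y = "\<Sum>s\<in>S. cinner s x *\<^sub>C s"
      have "cinner s (x - ?y) = 0" if "s \<in> S" for s
      proof -
        have "cinner s ?y = (\<Sum>t\<in>S. if t = s then cinner s x else 0)"
          unfolding cinner_sum_right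
          using S(2,3) that by (intro sum.cong) (auto simp: cinner_scaleC_right cinner_self)
        then show ?thesis using that fin by (simp add: cinner_diff_right)
      qed
      then have "x = ?y" using complete[of "x - ?y"] by simp
      moreover have "?y \<in> cspan S"
        by (intro complex_vector.span_sum complex_vector.span_scale complex_vector.span_base)
      ultimately show ?thesis by simp
    qed
    then show False using infinite_dimensional fin unfolding finite_cdim_def by blast
  qed
  have "countable S"
  proof -
    obtain X :: "'a set" where X: "countable X" "closure X = UNIV"
      using separable by (auto simp: separable_space_def)
    have "\<exists>d\<in>X. dist d s < 1 / 2" for s
      using X(2) closure_approachable[of s X] by (metis UNIV_I half_gt_zero_iff zero_less_one)
    then obtain d where d: "\<And>s. d s \<in> X" "\<And>s. dist (d s) s < 1 / 2" by metis
    have "inj_on d S"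
    proof (rule inj_onI, rule ccontr)
      fix s t assume st: "s \<in> S" "t \<in> S" "d s = d t" "s \<noteq> t"
      have "cinner s (- t) = 0" using S(3)[OF st(1,2,4)] cinner_diff_right[of s 0 t] by simp
      then have "(norm (s - t))\<^sup>2 = 2"
        using norm_add_orthogonal[of s "- t"] S(2) st by simp
      moreover have "norm (s - t) < 1"
        using d(2)[of s] d(2)[of t] st(3) dist_triangle_half_r[of "d s" s 1 t]
        by (simp add: dist_norm)
      then have "(norm (s - t))\<^sup>2 < 1" by (simp add: power_less_one_iff)
      ultimately show False by simp
    qed
    moreover have "countable (d ` S)" using X(1) d(1) by (meson countable_subset image_subsetI)
    ultimately show ?thesis by (rule countable_image_inj_on[rotated])
  qed
  define e where "e = from_nat_into S"
  have bij: "bij_betw e UNIV S"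
    unfolding e_def by (rule bij_betw_from_nat_into[OF \<open>countable S\<close> \<open>infinite S\<close>])
  have eS: "e n \<in> S" for n using bij by (auto simp: bij_betw_def)
  show ?thesis
  proof (rule that[of e])
    show "Q (e n)" for n using S(1) eS by blast
    show "orthonormal_basis e"
    proof (rule orthonormal_basisI)
      show "orthonormal_seq e"
        unfolding orthonormal_seq_def
      proof (intro allI)
        fix m n
        show "cinner (e m) (e n) = (if m = n then 1 else 0)"
          using S(2)[OF eS[of m]] S(3)[OF eS[of m] eS[of n]] bij
          by (auto simp: cinner_self bij_betw_def inj_eq)
      qed
      show "x = 0" if "\<And>n. cinner (e n) x = 0" for x
        using complete[of x] that bij by (metis bij_betw_imp_surj_on rangeE)
    qed
  qed
qed

section \<open>Adjoints\<close>

lemma bounded_clinearD: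
  assumes "bounded_clinear T"
  shows "bounded_linear T" "T (a *\<^sub>C x) = a *\<^sub>C T x" "T (x + y) = T x + T y" "T (x - y) = T x - T y" "T 0 = 0"
  using assms bounded_linear.linear[of T] linear_add[of T] linear_diff[of T] linear_0[of T]
  by (auto simp: bounded_clinear_def)

lemma bounded_clinearI:
  assumes "\<And>x y. T (x + y) = T x + T y" "\<And>a x. T (a *\<^sub>C x) = a *\<^sub>C T x" "\<And>x. norm (T x) \<le> K * norm x"
  shows "bounded_clinear T"
  unfolding bounded_clinear_def
  using assms by (auto intro!: bounded_linear_intro[of T K] simp: mult.commute simp flip: scaleC_of_real)

lemma bounded_clinear_bound:
  assumes "bounded_clinear T"
  obtains K where "0 < K" "\<And>x. norm (T x) \<le> K * norm x"
  using bounded_linear.pos_bounded[OF bounded_clinearD(1)[OF assms]] by (metis mult.commute)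

text \<open>The vector that represents \<open>y \<mapsto> \<langle>x, T y\<rangle>\<close> has the coefficients \<open>\<langle>T (e n), x\<rangle>\<close>. They are square
summable: for the partial sum \<open>v\<close> of this series, \<open>(norm v)\<^sup>2 = \<langle>x, T v\<rangle> \<le> norm x * K * norm v\<close>.\<close>

lemma exists_adjoint:
  fixes T :: "'a::complex_hilbert_space \<Rightarrow> 'a" and e :: "nat \<Rightarrow> 'a"
  assumes e: "orthonormal_basis e" and T: "bounded_clinear T"
  shows "\<exists>S. \<forall>x y. cinner (S x) y = cinner x (T y)"
proof -
  note o = orthonormal_basisD(1)[OF e]
  obtain K where K: "0 < K" "\<And>x. norm (T x) \<le> K * norm x" using bounded_clinear_bound[OF T] by blast
  have "\<exists>w. \<forall>y. cinner w y = cinner x (T y)" for x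
  proof -
    let ?a = "\<lambda>n. cinner (T (e n)) x"
    have bound: "(\<Sum>n<N. (cmod (?a n))\<^sup>2) \<le> (K * norm x)\<^sup>2" for N
    proof -
      let ?y = "\<Sum>n<N. ?a n *\<^sub>C e n"
      define s where "s = (\<Sum>n<N. (cmod (?a n))\<^sup>2)"
      have s: "(norm ?y)\<^sup>2 = s" using norm_orthonormal_combination[OF o, of "{..<N}" ?a] by (simp add: s_def)
      have "T ?y = (\<Sum>n<N. ?a n *\<^sub>C T (e n))"
        by (simp add: linear_sum[OF bounded_linear.linear[OF bounded_clinearD(1)[OF T]]] bounded_clinearD(2)[OF T])
      then have "cinner x (T ?y) = (\<Sum>n<N. cinner x (T (e n)) * cinner (T (e n)) x)"
        by (simp add: cinner_sum_right cinner_scaleC_right mult.commute)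
      also have "\<dots> = complex_of_real s" by (simp add: cinner_mult_cnj s_def)
      finally have "cmod (complex_of_real s) \<le> norm x * norm (T ?y)"
        using Cauchy_Schwarz_cinner[of x "T ?y"] by simp
      then have "s \<le> norm x * norm (T ?y)" by simp
      also have "\<dots> \<le> norm x * (K * norm ?y)" by (intro mult_left_mono K) auto
      finally have "norm ?y * norm ?y \<le> (K * norm x) * norm ?y"
        using s by (simp add: power2_eq_square mult_ac)
      then have "norm ?y \<le> K * norm x"
        using K(1) by (cases "norm ?y = 0") (auto simp: mult_le_cancel_right)
      then have "(norm ?y)\<^sup>2 \<le> (K * norm x)\<^sup>2" by (intro power_mono) auto
      then show ?thesis using s by (simp add: s_def)
    qed
    have "summable (\<lambda>n. (cmod (?a n))\<^sup>2)"
      by (rule summableI_nonneg_bounded[of _ "(K * norm x)\<^sup>2"]) (use bound in auto)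
    then have w: "(\<lambda>n. ?a n *\<^sub>C e n) sums (\<Sum>n. ?a n *\<^sub>C e n)" (is "_ sums ?w")
      by (intro summable_sums summable_orthonormal_combination[OF o])
    have "cinner ?w y = cinner x (T y)" for y
    proof (rule sums_unique2)
      show "(\<lambda>n. cinner ?w (cinner (e n) y *\<^sub>C e n)) sums cinner ?w y"
        by (rule bounded_linear.sums[OF bounded_linear_cinner_right orthonormal_basis_expansion[OF e]])
      have "(\<lambda>n. cinner x (T (cinner (e n) y *\<^sub>C e n))) sums cinner x (T y)"
        by (intro bounded_linear.sums[OF bounded_linear_cinner_right]
            bounded_linear.sums[OF bounded_clinearD(1)[OF T]] orthonormal_basis_expansion[OF e])
      moreover have "cinner ?w (e n) = cinner x (T (e n))" for n
        using cinner_orthonormal_sums[OF o w, of n] by (metis cinner_commute)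
      ultimately show "(\<lambda>n. cinner ?w (cinner (e n) y *\<^sub>C e n)) sums cinner x (T y)"
        by (simp add: bounded_clinearD(2)[OF T] cinner_scaleC_right)
    qed
    then show ?thesis by blast
  qed
  then show ?thesis by metis
qed

lemma cinner_ext: "(\<And>y. cinner x y = cinner x' y) \<Longrightarrow> x = (x'::'a::complex_hilbert_space)"
  by (metis cinner_diff_left cinner_self_eq_zero right_minus_eq)

lemma cinner_cadjoint:
  fixes T :: "'a::complex_hilbert_space \<Rightarrow> 'a" and e :: "nat \<Rightarrow> 'a"
  assumes "orthonormal_basis e" and "bounded_clinear T"
  shows "cinner (cadjoint T x) y = cinner x (T y)" "cinner x (cadjoint T y) = cinner (T x) y"
proof -
  obtain S where S: "\<And>x y. cinner (S x) y = cinner x (T y)" using exists_adjoint[OF assms] by blast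
  have "cadjoint T = S"
    unfolding cadjoint_def
  proof (rule the_equality)
    show "\<forall>x y. cinner (S x) y = cinner x (T y)" using S by blast
    fix R assume R: "\<forall>x y. cinner (R x) y = cinner x (T y)"
    show "R = S" by (intro ext cinner_ext) (simp add: S R)
  qed
  then show *: "cinner (cadjoint T x) y = cinner x (T y)" for x y using S by simp
  show "cinner x (cadjoint T y) = cinner (T x) y"
    using * cinner_commute by metis
qed

lemma bounded_clinear_cadjoint:
  fixes T :: "'a::complex_hilbert_space \<Rightarrow> 'a" and e :: "nat \<Rightarrow> 'a"
  assumes e: "orthonormal_basis e" and T: "bounded_clinear T"
  shows "bounded_clinear (cadjoint T)"
proof -
  obtain K where K: "0 < K" "\<And>x. norm (T x) \<le> K * norm x" using bounded_clinear_bound[OF T] by blast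
  show ?thesis
  proof (rule bounded_clinearI[of _ K])
    show "cadjoint T (x + y) = cadjoint T x + cadjoint T y" for x y
      by (intro cinner_ext) (simp add: cinner_cadjoint[OF e T] cinner_add_left)
    show "cadjoint T (a *\<^sub>C x) = a *\<^sub>C cadjoint T x" for a x
      by (intro cinner_ext) (simp add: cinner_cadjoint[OF e T] cinner_scaleC_left)
    fix x
    let ?y = "cadjoint T x"
    have "complex_of_real ((norm ?y)\<^sup>2) = cinner x (T ?y)"
      by (simp only: cinner_self[symmetric] cinner_cadjoint(1)[OF e T])
    then have "(norm ?y)\<^sup>2 \<le> norm x * norm (T ?y)"
      using Cauchy_Schwarz_cinner[of x "T ?y"] by (metis abs_of_nonneg norm_of_real zero_le_power2)
    also have "\<dots> \<le> norm x * (K * norm ?y)" by (intro mult_left_mono K) auto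
    finally have "norm ?y * norm ?y \<le> (K * norm x) * norm ?y" by (simp add: power2_eq_square mult_ac)
    then show "norm ?y \<le> K * norm x"
      using K(1) by (cases "norm ?y = 0") (auto simp: mult_le_cancel_right)
  qed
qed

section \<open>The spectral theorem for compact normal operators\<close>

text \<open>In terms of sequences, compactness passes from a normal operator to its real and imaginary parts,
since \<open>T x\<close> and the image of \<open>x\<close> under the adjoint have equal norms, and so both operators have Cauchy
images along the same subsequences.\<close>

definition sequentially_compact_op :: "('a::complex_hilbert_space \<Rightarrow> 'a) \<Rightarrow> bool" where
  "sequentially_compact_op A \<longleftrightarrow>
     (\<forall>x. (\<forall>n. norm (x n) \<le> 1) \<longrightarrow> (\<exists>r. strict_mono (r :: nat \<Rightarrow> nat) \<and> convergent (\<lambda>n. A (x (r n)))))"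

lemma compact_op_imp_sequentially_compact:
  fixes T :: "'a::complex_hilbert_space \<Rightarrow> 'a"
  assumes "compact_op T"
  shows "sequentially_compact_op T"
  unfolding sequentially_compact_op_def
proof (intro allI impI)
  fix x :: "nat \<Rightarrow> 'a" assume x: "\<forall>n. norm (x n) \<le> 1"
  interpret T: bounded_linear T using assms by (auto simp: compact_op_def bounded_clinear_def)
  \<comment> \<open>Scaling moves the closed unit ball into the open one.\<close>
  define y where "y n = (1 / 2) *\<^sub>R x n" for n
  have "y n \<in> ball 0 1" for n using x[rule_format, of n] by (simp add: y_def)
  then have "T (y n) \<in> closure (T ` ball 0 1)" for n using closure_subset by blast
  moreover have "seq_compact (closure (T ` ball 0 1))"
    using assms by (simp add: compact_op_def compact_eq_seq_compact_metric)
  ultimately obtain l r where r: "strict_mono (r :: nat \<Rightarrow> nat)" "((\<lambda>n. T (y n)) \<circ> r) \<longlonglongrightarrow> l"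
    unfolding seq_compact_def by metis
  have "(\<lambda>n. 2 *\<^sub>R ((\<lambda>n. T (y n)) \<circ> r) n) \<longlonglongrightarrow> 2 *\<^sub>R l" by (intro tendsto_intros r)
  then have "(\<lambda>n. T (x (r n))) \<longlonglongrightarrow> 2 *\<^sub>R l" by (simp add: y_def T.scaleR)
  then show "\<exists>r. strict_mono r \<and> convergent (\<lambda>n. T (x (r n)))" using r(1) by (auto simp: convergent_def)
qed

lemma power2_norm_diff_scaleR:
  fixes u v :: "'a::complex_hilbert_space"
  shows "(norm (u - t *\<^sub>R v))\<^sup>2 = (norm u)\<^sup>2 - 2 * t * Re (cinner u v) + t\<^sup>2 * (norm v)\<^sup>2"
proof -
  have "Re (cinner v u) = Re (cinner u v)" by (subst cinner_commute) simp
  then show ?thesis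
    unfolding power2_norm_eq_cinner[of "u - t *\<^sub>R v"] cinner_diff_left cinner_diff_right
      cinner_scaleR_left cinner_scaleR_right
    by (simp add: cinner_self power2_eq_square algebra_simps)
qed

text \<open>If \<open>A\<close> is not zero on \<open>M\<close>, let \<open>s\<close> be its norm there, and \<open>x n\<close> unit vectors of \<open>M\<close> whose images have norms tending to \<open>s\<close>.
Then \<open>A (A (x n)) - s\<^sup>2 x n\<close> tends to zero, so by compactness a subsequence of \<open>x n\<close> converges to some
\<open>w\<close> with \<open>A\<^sup>2 w = s\<^sup>2 w\<close>. As \<open>A\<^sup>2 - s\<^sup>2 = (A - s) (A + s)\<close>, either \<open>w\<close> or \<open>A w + s w\<close> is an eigenvector.\<close>

lemma compact_selfadjoint_eigenvector:
  fixes A :: "'a::complex_hilbert_space \<Rightarrow> 'a"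
  assumes A: "bounded_clinear A" "sequentially_compact_op A"
    and sa: "\<And>x y. cinner (A x) y = cinner x (A y)"
    and M: "complex_vector.subspace M" "closed M" "\<And>x. x \<in> M \<Longrightarrow> A x \<in> M"
    and x0: "x0 \<in> M" "x0 \<noteq> 0"
  obtains y a where "y \<in> M" "y \<noteq> 0" "A y = complex_of_real a *\<^sub>C y"
proof (cases "\<forall>x\<in>M. A x = 0")
  case True
  then show ?thesis using x0 by (intro that[of x0 0]) auto
next
  case False
  interpret A: bounded_linear A by (rule bounded_clinearD(1)[OF A(1)])
  have scM: "a *\<^sub>C x \<in> M" if "x \<in> M" for a x using M(1) that by (auto simp: complex_vector.subspace_def)
  have scRM: "a *\<^sub>R x \<in> M" if "x \<in> M" for a x using scM[OF that] by (metis scaleC_of_real)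
  have addM: "x + y \<in> M" if "x \<in> M" "y \<in> M" for x y using M(1) that by (auto simp: complex_vector.subspace_def)
  obtain K where K: "0 < K" "\<And>x. norm (A x) \<le> K * norm x" using bounded_clinear_bound[OF A(1)] by blast
  define X where "X = {norm (A x) | x. x \<in> M \<and> norm x = 1}"
  define s where "s = Sup X"
  have bdd: "bdd_above X"
  proof (rule bdd_aboveI[of _ K])
    show "t \<le> K" if "t \<in> X" for t using that K(2) by (auto simp: X_def) (metis mult.right_neutral)
  qed
  have unit: "norm (A x) \<le> s" if "x \<in> M" "norm x = 1" for x
    unfolding s_def by (rule cSup_upper[OF _ bdd]) (use that in \<open>auto simp: X_def\<close>)
  have le: "norm (A x) \<le> s * norm x" if x: "x \<in> M" for x
  proof (cases "x = 0")
    case False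
    have "norm (A ((1 / norm x) *\<^sub>R x)) \<le> s"
      by (rule unit) (use False scRM[OF x] in auto)
    then show ?thesis using False by (simp add: A.scaleR field_simps)
  qed (simp add: A.zero)
  obtain x1 where x1: "x1 \<in> M" "A x1 \<noteq> 0" using False by blast
  then have "0 < s * norm x1" using le[OF x1(1)] by (metis less_le_trans zero_less_norm_iff)
  then have s0: "0 < s" by (simp add: zero_less_mult_iff)
  have "X \<noteq> {}"
  proof -
    have "x1 \<noteq> 0" using x1 A.zero by auto
    then show ?thesis unfolding X_def using scRM[OF x1(1), of "1 / norm x1"] by force
  qed
  have "\<exists>x. x \<in> M \<and> norm x = 1 \<and> s - 1 / Suc n < norm (A x)" for n
  proof -
    have "s - 1 / Suc n < Sup X" by (simp add: s_def)
    then obtain t where "t \<in> X" "s - 1 / Suc n < t" using less_cSupE \<open>X \<noteq> {}\<close> by blast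
    then show ?thesis by (auto simp: X_def)
  qed
  then obtain x where x: "\<And>n. x n \<in> M" "\<And>n. norm (x n) = 1" "\<And>n. s - 1 / Suc n < norm (A (x n))" by metis
  have lim1: "(\<lambda>n. norm (A (x n))) \<longlonglongrightarrow> s"
  proof (rule tendsto_sandwich[of "\<lambda>n. s - 1 / Suc n" _ _ "\<lambda>n. s"])
    show "(\<lambda>n. s - 1 / real (Suc n)) \<longlonglongrightarrow> s"
      using tendsto_diff[OF tendsto_const LIMSEQ_inverse_real_of_nat, of s] by (simp add: inverse_eq_divide)
  qed (use x unit in \<open>auto intro!: always_eventually less_imp_le\<close>)
  define d where "d n = A (A (x n)) - s\<^sup>2 *\<^sub>R x n" for n
  have d: "(norm (d n))\<^sup>2 \<le> s\<^sup>2 * (s\<^sup>2 - (norm (A (x n)))\<^sup>2)" for n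
  proof -
    have "cinner (A (A (x n))) (x n) = complex_of_real ((norm (A (x n)))\<^sup>2)"
      by (simp only: sa[of "A (x n)"] cinner_self)
    then have 1: "Re (cinner (A (A (x n))) (x n)) = (norm (A (x n)))\<^sup>2" by (simp only: Re_complex_of_real)
    have "(norm (d n))\<^sup>2 = (norm (A (A (x n))))\<^sup>2 - 2 * s\<^sup>2 * (norm (A (x n)))\<^sup>2 + s\<^sup>2 * s\<^sup>2"
      unfolding d_def power2_norm_diff_scaleR by (simp add: 1 x(2) power2_eq_square)
    moreover have "(norm (A (A (x n))))\<^sup>2 \<le> (s * norm (A (x n)))\<^sup>2"
      by (intro power_mono le M(3) x) auto
    ultimately show ?thesis by (simp add: power_mult_distrib algebra_simps)
  qed
  have "(\<lambda>n. s\<^sup>2 * (s\<^sup>2 - (norm (A (x n)))\<^sup>2)) \<longlonglongrightarrow> s\<^sup>2 * (s\<^sup>2 - s\<^sup>2)"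
    by (intro tendsto_intros lim1)
  then have "(\<lambda>n. s\<^sup>2 * (s\<^sup>2 - (norm (A (x n)))\<^sup>2)) \<longlonglongrightarrow> 0" by simp
  then have "(\<lambda>n. (norm (d n))\<^sup>2) \<longlonglongrightarrow> 0"
    by (rule Lim_null_comparison[rotated]) (use d in auto)
  then have "(\<lambda>n. sqrt ((norm (d n))\<^sup>2)) \<longlonglongrightarrow> sqrt 0" by (rule tendsto_real_sqrt)
  then have d0: "d \<longlonglongrightarrow> 0" by (simp add: tendsto_norm_zero_iff)
  obtain r z where r: "strict_mono (r :: nat \<Rightarrow> nat)" and z: "(\<lambda>n. A (x (r n))) \<longlonglongrightarrow> z"
    using A(2) x(2) unfolding sequentially_compact_op_def convergent_def by (metis order_refl)
  define w where "w = (1 / s\<^sup>2) *\<^sub>R A z"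
  have "(\<lambda>n. d (r n)) \<longlonglongrightarrow> 0" using LIMSEQ_subseq_LIMSEQ[OF d0 r] by (simp add: comp_def)
  then have "(\<lambda>n. (1 / s\<^sup>2) *\<^sub>R (A (A (x (r n))) - d (r n))) \<longlonglongrightarrow> (1 / s\<^sup>2) *\<^sub>R (A z - 0)"
    by (intro tendsto_intros A.tendsto z)
  then have w: "(\<lambda>n. x (r n)) \<longlonglongrightarrow> w" using s0 by (simp add: d_def w_def)
  have "norm w = 1" using tendsto_norm[OF w] x(2) LIMSEQ_unique[OF _ tendsto_const] by simp
  have wM: "w \<in> M" by (rule closed_sequentially[OF M(2) _ w]) (use x in auto)
  have "A w = z" by (rule LIMSEQ_unique[OF A.tendsto[OF w] z])
  then have AA: "A (A w) = s\<^sup>2 *\<^sub>R w" using s0 by (simp add: w_def)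
  let ?v = "A w + s *\<^sub>R w"
  show ?thesis
  proof (cases "?v = 0")
    case True
    then have "A w = complex_of_real (- s) *\<^sub>C w" by (simp only: scaleC_of_real) (simp add: add_eq_0_iff)
    then show ?thesis using that[of w "- s"] wM \<open>norm w = 1\<close> by force
  next
    case False
    have "A ?v = s *\<^sub>R ?v" by (simp add: A.add A.scaleR AA power2_eq_square algebra_simps)
    then have "A ?v = complex_of_real s *\<^sub>C ?v" by (simp only: scaleC_of_real)
    moreover have "?v \<in> M" using wM M(3) scRM addM by blast
    ultimately show ?thesis using that False by blast
  qed
qed

text \<open>Unlike \<open>T (e n) = c n *\<^sub>C e n\<close>, the condition determines \<open>T\<close> without an appeal to continuity.\<close>

definition diagonalized_by :: "('a::complex_hilbert_space \<Rightarrow> 'a) \<Rightarrow> (nat \<Rightarrow> 'a) \<Rightarrow> (nat \<Rightarrow> complex) \<Rightarrow> bool" where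
  "diagonalized_by T e c \<longleftrightarrow> orthonormal_basis e \<and> (\<forall>n x. cinner (e n) (T x) = c n * cinner (e n) x)"

text \<open>The orthogonal complement \<open>M\<close> of a set of joint eigenvectors of \<open>T\<close> and its adjoint is invariant under
both, hence under the commuting selfadjoint parts \<open>A\<close> and \<open>B\<close> of \<open>T = A + \<i> B\<close>. An eigenspace of \<open>A\<close> in \<open>M\<close>
is invariant under \<open>B\<close>, and an eigenvector of \<open>B\<close> in it is a further joint eigenvector.\<close>

theorem compact_normal_diagonalizable:
  fixes T :: "'a::complex_hilbert_space \<Rightarrow> 'a"
  assumes infinite_dimensional: "\<not> finite_cdim (UNIV :: 'a set)"
    and separable: "separable_space (euclidean :: 'a topology)"
    and T: "compact_op T" "normal_op T"
  obtains e c where "diagonalized_by T e c"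
proof -
  have unitize: "norm ((1 / norm y) *\<^sub>R y) = 1" if "y \<noteq> 0" for y :: 'a using that by simp
  obtain e0 :: "nat \<Rightarrow> 'a" where e0: "orthonormal_basis e0"
  proof (rule exists_orthonormal_basis_of_kind[OF infinite_dimensional separable, of "\<lambda>_. True"])
    fix S and x :: 'a assume "x \<noteq> 0" "\<And>s. s \<in> S \<Longrightarrow> cinner s x = 0"
    then show "\<exists>y. True \<and> norm y = 1 \<and> (\<forall>s\<in>S. cinner s y = 0)"
      using unitize[of x] by (intro exI[of _ "(1 / norm x) *\<^sub>R x"]) (auto simp: cinner_scaleR_right)
  qed
  have bT: "bounded_clinear T" using T by (simp add: compact_op_def)
  define T' where "T' = cadjoint T"
  have bT': "bounded_clinear T'" unfolding T'_def by (rule bounded_clinear_cadjoint[OF e0 bT])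
  note adj = cinner_cadjoint[OF e0 bT, folded T'_def]
  have comm: "T' (T x) = T (T' x)" for x
    using T(2) by (metis T'_def comp_apply normal_op_def)
  have norm_eq: "norm (T' x) = norm (T x)" for x
  proof -
    have "cinner (T' x) (T' x) = cinner (T x) (T x)"
      by (subst adj(1)) (subst comm[symmetric], rule adj(2))
    then have "(norm (T' x))\<^sup>2 = (norm (T x))\<^sup>2" by (simp add: power2_norm_eq_cinner)
    then show ?thesis by simp
  qed
  note lin = bounded_clinearD[OF bT] and lin' = bounded_clinearD[OF bT']
  have scT: "sequentially_compact_op T" by (rule compact_op_imp_sequentially_compact[OF T(1)])
  \<comment> \<open>Both parts of \<open>T\<close>, and all linear combinations of \<open>T\<close> and its adjoint, are compact.\<close>
  define comb where "comb p q x = p *\<^sub>C T x + q *\<^sub>C T' x" for p q x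
  have b_comb: "bounded_clinear (comb p q)" for p q
  proof -
    obtain K where K: "\<And>x. norm (T x) \<le> K * norm x" using bounded_clinear_bound[OF bT] by blast
    show ?thesis
    proof (rule bounded_clinearI)
      show "comb p q (x + y) = comb p q x + comb p q y" for x y
        by (simp add: comb_def lin(3) lin'(3) scaleC_add_right)
      show "comb p q (a *\<^sub>C x) = a *\<^sub>C comb p q x" for a x
        by (simp add: comb_def lin(2) lin'(2) scaleC_add_right scaleC_scaleC mult.commute)
      fix x
      have "norm (comb p q x) \<le> cmod p * norm (T x) + cmod q * norm (T x)"
        unfolding comb_def using norm_triangle_ineq[of "p *\<^sub>C T x" "q *\<^sub>C T' x"]
        by (simp add: norm_scaleC norm_eq)
      also have "\<dots> \<le> cmod p * (K * norm x) + cmod q * (K * norm x)"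
        by (intro add_mono mult_left_mono K) auto
      finally show "norm (comb p q x) \<le> ((cmod p + cmod q) * K) * norm x" by (simp add: algebra_simps)
    qed
  qed
  have sc_comb: "sequentially_compact_op (comb p q)" for p q
    unfolding sequentially_compact_op_def
  proof (intro allI impI)
    fix x :: "nat \<Rightarrow> 'a" assume "\<forall>n. norm (x n) \<le> 1"
    then obtain r where r: "strict_mono (r :: nat \<Rightarrow> nat)" and conv: "convergent (\<lambda>n. T (x (r n)))"
      using scT unfolding sequentially_compact_op_def by blast
    have "dist (T' (x (r m))) (T' (x (r n))) = dist (T (x (r m))) (T (x (r n)))" for m n
      by (simp add: dist_norm flip: lin(4) lin'(4) add: norm_eq)
    then have "Cauchy (\<lambda>n. T' (x (r n)))"
      using conv unfolding Cauchy_convergent_iff[symmetric] Cauchy_def by simp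
    then have conv': "convergent (\<lambda>n. T' (x (r n)))" by (simp add: Cauchy_convergent_iff)
    have "convergent (\<lambda>n. comb p q (x (r n)))"
    proof -
      obtain l l' where "(\<lambda>n. T (x (r n))) \<longlonglongrightarrow> l" "(\<lambda>n. T' (x (r n))) \<longlonglongrightarrow> l'"
        using conv conv' by (auto simp: convergent_def)
      then have "(\<lambda>n. comb p q (x (r n))) \<longlonglongrightarrow> p *\<^sub>C l + q *\<^sub>C l'"
        unfolding comb_def by (intro tendsto_add tendsto_scaleC_right)
      then show ?thesis by (auto simp: convergent_def)
    qed
    then show "\<exists>r. strict_mono r \<and> convergent (\<lambda>n. comb p q (x (r n)))" using r by blast
  qed
  define A where "A = comb (1 / 2) (1 / 2)"
  define B where "B = comb (- \<i> / 2) (\<i> / 2)"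
  have sa: "cinner (A x) y = cinner x (A y)" "cinner (B x) y = cinner x (B y)" for x y
    by (simp_all add: A_def B_def comb_def cinner_add_left cinner_add_right cinner_diff_left
        cinner_diff_right cinner_scaleC_left cinner_scaleC_right adj)
  have T_AB: "T x = A x + \<i> *\<^sub>C B x" and T'_AB: "T' x = A x - \<i> *\<^sub>C B x" for x
    by (rule cinner_ext, simp add: A_def B_def comb_def cinner_add_left cinner_diff_left cinner_scaleC_left field_simps)+
  have BA: "B (A x) = A (B x)" for x
    by (rule cinner_ext)
       (simp add: A_def B_def comb_def lin(2-4) lin'(2-4) comm cinner_add_left cinner_diff_left cinner_scaleC_left field_simps)
  obtain e :: "nat \<Rightarrow> 'a" where e: "orthonormal_basis e" "\<And>n. \<exists>z. T (e n) = z *\<^sub>C e n \<and> T' (e n) = cnj z *\<^sub>C e n"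
  proof (rule exists_orthonormal_basis_of_kind[OF infinite_dimensional separable,
        of "\<lambda>y. \<exists>z. T y = z *\<^sub>C y \<and> T' y = cnj z *\<^sub>C y"])
    fix S and x :: 'a
    assume S: "\<And>s. s \<in> S \<Longrightarrow> \<exists>z. T s = z *\<^sub>C s \<and> T' s = cnj z *\<^sub>C s"
      and x: "x \<noteq> 0" "\<And>s. s \<in> S \<Longrightarrow> cinner s x = 0"
    define M where "M = {v. \<forall>s\<in>S. cinner s v = 0}"
    have subM: "complex_vector.subspace M"
      by (auto simp: M_def complex_vector.subspace_def cinner_add_right cinner_scaleC_right)
    have "M = (\<Inter>s\<in>S. {v. cinner s v = 0})" by (auto simp: M_def)
    then have closedM: "closed M"
      by (auto intro!: closed_INT closed_Collect_eq continuous_on_const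
          bounded_linear.continuous_on[OF bounded_linear_cinner_right] continuous_on_id)
    have TM: "T v \<in> M \<and> T' v \<in> M" if v: "v \<in> M" for v
    proof -
      have "cinner s (T v) = 0 \<and> cinner s (T' v) = 0" if s: "s \<in> S" for s
      proof -
        obtain z where z: "T s = z *\<^sub>C s" "T' s = cnj z *\<^sub>C s" using S[OF s] by blast
        have 0: "cinner s v = 0" using v s by (simp add: M_def)
        have "cinner s (T v) = cinner (cnj z *\<^sub>C s) v" "cinner s (T' v) = cinner (z *\<^sub>C s) v"
          by (simp_all only: adj flip: z)
        then show ?thesis by (simp add: cinner_scaleC_left 0)
      qed
      then show ?thesis by (simp add: M_def)
    qed
    have combM: "comb p q v \<in> M" if "v \<in> M" for p q v
      unfolding comb_def using TM[OF that] subM by (auto simp: complex_vector.subspace_def)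
    obtain v a where v: "v \<in> M" "v \<noteq> 0" "A v = complex_of_real a *\<^sub>C v"
    proof (rule compact_selfadjoint_eigenvector[of A M x])
      show "bounded_clinear A" "sequentially_compact_op A" by (simp_all add: A_def b_comb sc_comb)
      show "x \<in> M" using x by (simp add: M_def)
      show "A w \<in> M" if "w \<in> M" for w using combM[OF that] by (simp add: A_def)
    qed (use sa subM closedM x in auto)
    define M' where "M' = M \<inter> {w. A w = complex_of_real a *\<^sub>C w}"
    note linA = bounded_clinearD[OF b_comb, of "1/2" "1/2", folded A_def]
    note linB = bounded_clinearD[OF b_comb, of "-\<i>/2" "\<i>/2", folded B_def]
    have subM': "complex_vector.subspace M'"
      using subM by (auto simp: M'_def complex_vector.subspace_def linA scaleC_add_right scaleC_scaleC mult.commute)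
    have closedM': "closed M'"
      unfolding M'_def
      by (intro closed_Int closedM closed_Collect_eq bounded_linear.continuous_on[OF bounded_linear_scaleC_right]
          bounded_linear.continuous_on[OF linA(1)] continuous_on_id)
    obtain y b where y: "y \<in> M'" "y \<noteq> 0" "B y = complex_of_real b *\<^sub>C y"
    proof (rule compact_selfadjoint_eigenvector[of B M' v])
      show "bounded_clinear B" "sequentially_compact_op B" by (simp_all add: B_def b_comb sc_comb)
      show "v \<in> M'" using v by (simp add: M'_def)
      show "B w \<in> M'" if "w \<in> M'" for w
        using combM[of w "-\<i>/2" "\<i>/2", folded B_def] that
        by (auto simp: M'_def linB(2) simp flip: BA)
    qed (use sa subM' closedM' v in auto)
    have Ay: "A y = complex_of_real a *\<^sub>C y" and yM: "y \<in> M" using y by (auto simp: M'_def)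
    define z where "z = Complex a b"
    have z: "z = complex_of_real a + \<i> * complex_of_real b" "cnj z = complex_of_real a - \<i> * complex_of_real b"
      by (auto simp: z_def complex_eq_iff)
    have Ty: "T y = z *\<^sub>C y" and T'y: "T' y = cnj z *\<^sub>C y"
      unfolding z T_AB[of y] T'_AB[of y] Ay y(3)
      by (simp_all add: scaleC_scaleC scaleC_add_left complex_vector.scale_left_diff_distrib)
    let ?y = "complex_of_real (1 / norm y) *\<^sub>C y"
    have "norm ?y = 1" using unitize[OF y(2)] by (simp only: scaleC_of_real)
    moreover have "T ?y = z *\<^sub>C ?y" "T' ?y = cnj z *\<^sub>C ?y"
      by (simp_all only: lin(2) lin'(2) Ty T'y scaleC_scaleC mult.commute)
    moreover have "cinner s ?y = 0" if "s \<in> S" for s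
      using yM that by (simp add: M_def cinner_scaleC_right)
    ultimately show "\<exists>y. (\<exists>z. T y = z *\<^sub>C y \<and> T' y = cnj z *\<^sub>C y) \<and> norm y = 1 \<and> (\<forall>s\<in>S. cinner s y = 0)"
      by blast
  qed (rule that)
  then obtain c where c: "\<And>n. T' (e n) = cnj (c n) *\<^sub>C e n" by metis
  have "cinner (e n) (T x) = c n * cinner (e n) x" for n x
    by (simp add: c cinner_scaleC_left flip: adj(1))
  then show ?thesis using that e(1) unfolding diagonalized_by_def by blast
qed

lemma diagonalized_by_eigenvector:
  assumes "diagonalized_by T e c"
  shows "T (e n) = c n *\<^sub>C e n"
proof (rule orthonormal_basis_eqI)
  show e: "orthonormal_basis e" using assms by (simp add: diagonalized_by_def)
  show "cinner (e m) (T (e n)) = cinner (e m) (c n *\<^sub>C e n)" for m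
    using assms orthonormal_seqD(1)[OF orthonormal_basisD(1)[OF e]]
    by (simp add: diagonalized_by_def cinner_scaleC_right)
qed

text \<open>Otherwise infinitely many of the vectors \<open>T (e n) = c n *\<^sub>C e n\<close> would have mutual distances bounded
below.\<close>

lemma compact_diagonal_tendsto_zero:
  assumes T: "compact_op T" and d: "diagonalized_by T e c"
  shows "c \<longlonglongrightarrow> 0"
proof (rule ccontr)
  assume "\<not> c \<longlonglongrightarrow> 0"
  then obtain \<epsilon> where \<epsilon>: "0 < \<epsilon>" "\<And>N. \<exists>n\<ge>N. \<epsilon> \<le> cmod (c n)"
    unfolding LIMSEQ_def by (auto simp: not_less)
  have o: "orthonormal_seq e" using d by (auto simp: diagonalized_by_def dest: orthonormal_basisD)
  let ?I = "{n. \<epsilon> \<le> cmod (c n)}"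
  have inf: "infinite ?I" using \<epsilon>(2) by (auto simp: infinite_nat_iff_unbounded_le)
  let ?k = "enumerate ?I"
  have k: "strict_mono ?k" "\<And>n. \<epsilon> \<le> cmod (c (?k n))"
    using strict_mono_enumerate[OF inf] enumerate_in_set[OF inf] by auto
  obtain r where r: "strict_mono (r :: nat \<Rightarrow> nat)" "convergent (\<lambda>n. T (e (?k (r n))))"
    using compact_op_imp_sequentially_compact[OF T, unfolded sequentially_compact_op_def,
        rule_format, of "\<lambda>n. e (?k n)"] orthonormal_seqD(2)[OF o] by auto
  then have "Cauchy (\<lambda>n. T (e (?k (r n))))" by (simp add: Cauchy_convergent_iff)
  then obtain N where N: "\<And>m n. N \<le> m \<Longrightarrow> N \<le> n \<Longrightarrow> norm (T (e (?k (r m))) - T (e (?k (r n)))) < \<epsilon>"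
    using \<epsilon>(1) unfolding Cauchy_iff by blast
  define p q where "p = ?k (r N)" and "q = ?k (r (Suc N))"
  have "r N < r (Suc N)" using r(1) by (simp add: strict_mono_Suc_iff)
  then have "p < q" unfolding p_def q_def by (rule strict_monoD[OF k(1)])
  then have "p \<noteq> q" by simp
  have "(norm (T (e p) - T (e q)))\<^sup>2 = (norm (c p *\<^sub>C e p + (- c q) *\<^sub>C e q))\<^sup>2"
    by (simp add: diagonalized_by_eigenvector[OF d] complex_vector.scale_minus_left)
  also have "\<dots> = (cmod (c p))\<^sup>2 + (cmod (c q))\<^sup>2"
    using norm_orthonormal_combination[OF o, of "{p, q}" "\<lambda>n. if n = p then c p else - c q"] \<open>p \<noteq> q\<close>
    by simp
  finally have "(cmod (c p))\<^sup>2 \<le> (norm (T (e p) - T (e q)))\<^sup>2" by simp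
  moreover have "\<epsilon>\<^sup>2 \<le> (cmod (c p))\<^sup>2" using k(2) \<epsilon>(1) by (intro power_mono) (auto simp: p_def)
  moreover have "(norm (T (e p) - T (e q)))\<^sup>2 < \<epsilon>\<^sup>2"
    using N[of N "Suc N"] unfolding p_def q_def by (intro power_strict_mono) auto
  ultimately show False by linarith
qed

section \<open>Traces and the numerical range\<close>

text \<open>Insert the Schmidt decomposition into \<open>c n = \<langle>e n, C (e n)\<rangle>\<close> and sum over \<open>n\<close> first: for each singular
value \<open>s k\<close> the factor \<open>\<Sum>n. \<bar>\<langle>f k, e n\<rangle> \<langle>e n, g k\<rangle>\<bar>\<close> is at most \<open>1\<close>, so that the sum of the \<open>s k\<close> is a bound.\<close>

lemma trace_class_diagonal_summable:
  assumes C: "trace_class C" and d: "diagonalized_by C e c"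
  shows "(\<lambda>n. cmod (c n)) summable_on UNIV"
proof -
  obtain s f g where sd: "schmidt_decomposition C s f g" and s: "summable s"
    using C by (auto simp: trace_class_def)
  have f: "orthonormal_seq f" and g: "orthonormal_seq g" and s0: "\<And>k. 0 \<le> s k"
    and Cx: "\<And>x. (\<lambda>k. (complex_of_real (s k) * cinner (f k) x) *\<^sub>C g k) sums C x"
    using sd by (auto simp: schmidt_decomposition_def)
  have e: "orthonormal_seq e" using d by (auto simp: diagonalized_by_def dest: orthonormal_basisD)
  define q where "q n k = cmod (cinner (f k) (e n) * cinner (e n) (g k))" for n k
  have q1: "(\<Sum>n\<in>F. q n k) \<le> 1" if "finite F" for F k
  proof -
    have "(\<Sum>n\<in>F. q n k) \<le> (\<Sum>\<^sub>\<infinity>n. q n k)"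
      unfolding q_def using Bessel_products(1)[OF e, of "f k" "g k"] that by (intro finite_sum_le_infsum) auto
    also have "\<dots> \<le> 1"
      unfolding q_def using Bessel_products(2)[OF e, of "f k" "g k"]
      by (simp add: orthonormal_seqD(2)[OF f] orthonormal_seqD(2)[OF g])
    finally show ?thesis .
  qed
  have sq: "summable (\<lambda>k. s k * q n k)" for n
  proof (rule summable_comparison_test'[OF s])
    fix k
    have "q n k \<le> 1" using q1[of "{n}" k] by simp
    then show "norm (s k * q n k) \<le> s k" using s0[of k] by (simp add: q_def mult_left_le)
  qed
  have c: "cmod (c n) \<le> (\<Sum>k. s k * q n k)" for n
  proof -
    have "(\<lambda>k. cinner (e n) ((complex_of_real (s k) * cinner (f k) (e n)) *\<^sub>C g k)) sums cinner (e n) (C (e n))"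
      by (rule bounded_linear.sums[OF bounded_linear_cinner_right Cx])
    moreover have "cinner (e n) (C (e n)) = c n"
      using d orthonormal_seqD(1)[OF e, of n n] by (simp add: diagonalized_by_def)
    ultimately have c: "(\<lambda>k. complex_of_real (s k) * (cinner (f k) (e n) * cinner (e n) (g k))) sums c n"
      by (simp add: cinner_scaleC_right mult_ac)
    have norm: "cmod (complex_of_real (s k) * (cinner (f k) (e n) * cinner (e n) (g k))) = s k * q n k" for k
      using s0 by (simp add: q_def norm_mult)
    show ?thesis
      using summable_norm[of "\<lambda>k. complex_of_real (s k) * (cinner (f k) (e n) * cinner (e n) (g k))"]
        sq[of n] sums_unique[OF c] unfolding norm by simp
  qed
  have "(\<Sum>n<N. cmod (c n)) \<le> suminf s" for N
  proof -
    have "(\<Sum>n<N. cmod (c n)) \<le> (\<Sum>n<N. \<Sum>k. s k * q n k)" by (intro sum_mono c)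
    also have "\<dots> = (\<Sum>k. \<Sum>n<N. s k * q n k)" by (rule suminf_sum[symmetric]) (rule sq)
    also have "\<dots> \<le> suminf s"
    proof (rule suminf_le[OF _ _ s])
      show "(\<Sum>n<N. s k * q n k) \<le> s k" for k
        using mult_left_mono[OF q1[of "{..<N}" k] s0[of k]] by (simp add: sum_distrib_left)
      show "summable (\<lambda>k. \<Sum>n<N. s k * q n k)" by (intro summable_sum sq)
    qed
    finally show ?thesis .
  qed
  then have "summable (\<lambda>n. cmod (c n))" by (intro summableI_nonneg_bounded) auto
  then show ?thesis by (simp add: summable_on_UNIV_nonneg_real_iff)
qed

text \<open>In any orthonormal basis \<open>g\<close>, the double series of \<open>c n * \<langle>g k, e n\<rangle> * \<langle>e n, X (g k)\<rangle>\<close> converges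
absolutely. Summation over \<open>n\<close> first gives the trace in the basis \<open>g\<close>, and summation over \<open>k\<close> first
gives an expression that does not involve \<open>g\<close>.\<close>

lemma op_trace_diagonal_compose:
  assumes d: "diagonalized_by C e c" and c: "(\<lambda>n. cmod (c n)) summable_on UNIV" and X: "bounded_clinear X"
    and x: "((\<lambda>n. c n * cinner (e n) (X (e n))) has_sum z) UNIV"
  shows "op_trace (C \<circ> X) = z"
proof -
  have e: "orthonormal_basis e" and C: "\<And>n x. cinner (e n) (C x) = c n * cinner (e n) x"
    using d by (auto simp: diagonalized_by_def)
  note adj = cinner_cadjoint[OF e X]
  obtain K where K: "0 < K" "\<And>x. norm (cadjoint X x) \<le> K * norm x"
    using bounded_clinear_bound[OF bounded_clinear_cadjoint[OF e X]] by blast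
  have sums: "(\<lambda>k. cinner (g k) ((C \<circ> X) (g k))) sums z" if g: "orthonormal_basis g" for g
  proof -
    define w where "w n = cadjoint X (e n)" for n
    define a where "a n k = c n * (cinner (w n) (g k) * cinner (g k) (e n))" for n k
    let ?q = "\<lambda>n. cmod (c n) * (\<Sum>\<^sub>\<infinity>k. cmod (cinner (w n) (g k) * cinner (g k) (e n)))"
    have "((\<lambda>k. cmod (a n k)) has_sum ?q n) UNIV" for n
      using has_sum_cmult_right[OF has_sum_infsum[OF Bessel_products(1)[OF orthonormal_basisD(1)[OF g], of "w n" "e n"]], of "cmod (c n)"]
      by (simp add: a_def norm_mult)
    moreover have "?q summable_on UNIV"
    proof (rule summable_on_comparison_test)
      show "(\<lambda>n. cmod (c n) * ((K\<^sup>2 + 1) / 2)) summable_on UNIV" by (rule summable_on_cmult_left[OF c])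
      fix n
      have "(norm (w n))\<^sup>2 \<le> K\<^sup>2"
        using K(2)[of "e n"] orthonormal_seqD(2)[OF orthonormal_basisD(1)[OF e], of n]
        by (intro power_mono) (auto simp: w_def)
      then have "(\<Sum>\<^sub>\<infinity>k. cmod (cinner (w n) (g k) * cinner (g k) (e n))) \<le> (K\<^sup>2 + 1) / 2"
        using Bessel_products(2)[OF orthonormal_basisD(1)[OF g], of "w n" "e n"]
          orthonormal_seqD(2)[OF orthonormal_basisD(1)[OF e], of n] by simp
      then show "?q n \<le> cmod (c n) * ((K\<^sup>2 + 1) / 2)" by (intro mult_left_mono) auto
      show "0 \<le> ?q n" by (intro mult_nonneg_nonneg infsum_nonneg) auto
    qed
    ultimately have "(\<lambda>(n, k). cmod (a n k)) summable_on (SIGMA n:UNIV. UNIV)"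
      by (intro summable_on_SigmaI[where g = ?q]) auto
    then have "(\<lambda>p. norm (case p of (n, k) \<Rightarrow> a n k)) summable_on UNIV"
      by (simp add: case_prod_unfold)
    then have "(\<lambda>(n, k). a n k) summable_on UNIV" by (rule abs_summable_summable)
    then obtain S where S: "((\<lambda>(n, k). a n k) has_sum S) (UNIV \<times> UNIV)" by (auto simp: summable_on_def)
    have "((\<lambda>n. c n * cinner (w n) (e n)) has_sum S) UNIV"
    proof (rule has_sum_SigmaD[OF S])
      show "((\<lambda>k. case (n, k) of (n, k) \<Rightarrow> a n k) has_sum c n * cinner (w n) (e n)) UNIV" for n
        using has_sum_cmult_right[OF Parseval_identity[OF g, of "w n" "e n"], of "c n"] by (simp add: a_def)
    qed
    then have "S = z" using has_sum_unique[OF _ x] by (simp add: w_def adj)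
    have S': "((\<lambda>(k, n). a n k) has_sum S) (UNIV \<times> UNIV)"
      using S by (subst (asm) has_sum_swap) (simp add: case_prod_unfold)
    have "((\<lambda>k. cinner (g k) (C (X (g k)))) has_sum S) UNIV"
    proof (rule has_sum_SigmaD[OF S'])
      fix k
      have "cinner (w n) (g k) = cinner (e n) (X (g k))" for n by (simp add: w_def adj)
      then have "a n k = cinner (g k) (e n) * cinner (e n) (C (X (g k)))" for n
        by (simp add: a_def C mult_ac)
      then show "((\<lambda>n. case (k, n) of (k, n) \<Rightarrow> a n k) has_sum cinner (g k) (C (X (g k)))) UNIV"
        using Parseval_identity[OF e, of "g k" "C (X (g k))"] by simp
    qed
    then show ?thesis using \<open>S = z\<close> has_sum_imp_sums by auto
  qed
  show ?thesis
    unfolding op_trace_def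
  proof (rule the_equality)
    show "\<forall>g. orthonormal_basis g \<longrightarrow> (\<lambda>n. cinner (g n) ((C \<circ> X) (g n))) sums z" using sums by blast
    fix y assume "\<forall>g. orthonormal_basis g \<longrightarrow> (\<lambda>n. cinner (g n) ((C \<circ> X) (g n))) sums y"
    then show "y = z" using e sums[OF e] sums_unique2 by blast
  qed
qed

lemma unitary_op_preserves:
  assumes U: "unitary_op U" and e: "orthonormal_basis e"
  shows "cinner (U x) (U y) = cinner x y" "orthonormal_basis (\<lambda>n. U (e n))"
proof -
  have bU: "bounded_clinear U" and inv: "\<And>x. cadjoint U (U x) = x" "\<And>x. U (cadjoint U x) = x"
    using U by (auto simp: unitary_op_def fun_eq_iff)
  note adj = cinner_cadjoint[OF e bU]
  show *: "cinner (U x) (U y) = cinner x y" for x y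
    by (simp add: inv(1) flip: adj(1))
  show "orthonormal_basis (\<lambda>n. U (e n))"
  proof (rule orthonormal_basisI)
    show "orthonormal_seq (\<lambda>n. U (e n))"
      using orthonormal_basisD(1)[OF e] by (simp add: orthonormal_seq_def *)
    fix x assume "\<And>n. cinner (U (e n)) x = 0"
    then have "cadjoint U x = 0" by (intro orthonormal_basisD(2)[OF e]) (simp add: adj)
    then show "x = 0" using inv(2)[of x] bounded_clinearD(5)[OF bU] by simp
  qed
qed

text \<open>\<open>U x\<close> is the vector with the same coefficients in the basis \<open>f\<close> as \<open>x\<close> has in the basis \<open>p\<close>.\<close>

lemma exists_unitary_between_bases:
  assumes p: "orthonormal_basis p" and f: "orthonormal_basis f"
  obtains U where "unitary_op U" "\<And>n. U (p n) = f n" "\<And>x n. cinner (f n) (U x) = cinner (p n) x"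
proof -
  have "\<exists>y. \<forall>n. cinner (f n) y = cinner (p n) x"
    if p: "orthonormal_basis p" and f: "orthonormal_basis f" for p f and x :: 'a
  proof -
    have "(\<lambda>n. cinner (p n) x *\<^sub>C f n) sums (\<Sum>n. cinner (p n) x *\<^sub>C f n)"
      by (intro summable_sums summable_orthonormal_combination Bessel_inequality(1) orthonormal_basisD(1) p f)
    from cinner_orthonormal_sums[OF orthonormal_basisD(1)[OF f] this] show ?thesis by blast
  qed
  then obtain U V where U: "\<And>x n. cinner (f n) (U x) = cinner (p n) x"
    and V: "\<And>x n. cinner (p n) (V x) = cinner (f n) x"
    using p f by metis
  have inv: "U (V x) = x" "V (U x) = x" for x
    by (rule orthonormal_basis_eqI[OF f], simp add: U V) (rule orthonormal_basis_eqI[OF p], simp add: U V)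
  have bU: "bounded_clinear U"
  proof (rule bounded_clinearI[of _ 1])
    show "U (x + y) = U x + U y" for x y
      by (rule orthonormal_basis_eqI[OF f]) (simp add: U cinner_add_right)
    show "U (a *\<^sub>C x) = a *\<^sub>C U x" for a x
      by (rule orthonormal_basis_eqI[OF f]) (simp add: U cinner_scaleC_right)
    fix x
    have "(norm (U x))\<^sup>2 = (norm x)\<^sup>2"
      using has_sum_unique[OF Parseval_norm[OF f, of "U x"]] Parseval_norm[OF p, of x] by (simp add: U)
    then show "norm (U x) \<le> 1 * norm x" by simp
  qed
  have iso: "cinner (U x) (U y) = cinner x y" for x y
  proof (rule has_sum_unique)
    show "((\<lambda>n. cinner (U x) (f n) * cinner (f n) (U y)) has_sum cinner (U x) (U y)) UNIV"
      by (rule Parseval_identity[OF f])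
    have "cinner (U x) (f n) = cinner x (p n)" for n using U[of n x] by (metis cinner_commute)
    then show "((\<lambda>n. cinner (U x) (f n) * cinner (f n) (U y)) has_sum cinner x y) UNIV"
      using Parseval_identity[OF p, of x y] by (simp add: U)
  qed
  have "cadjoint U = V"
  proof (intro ext cinner_ext)
    fix x y
    have "cinner (cadjoint U x) y = cinner (U (V x)) (U y)" by (simp add: cinner_cadjoint[OF f bU] inv)
    then show "cinner (cadjoint U x) y = cinner (V x) y" by (simp only: iso)
  qed
  then have "unitary_op U" unfolding unitary_op_def using bU inv by (auto simp: fun_eq_iff)
  moreover have "U (p n) = f n" for n
    using orthonormal_seqD(1)[OF orthonormal_basisD(1)[OF f]] orthonormal_seqD(1)[OF orthonormal_basisD(1)[OF p]]
    by (intro orthonormal_basis_eqI[OF f]) (simp add: U)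
  ultimately show ?thesis using that U by blast
qed

text \<open>The first argument fixes the Hilbert space. With two arbitrary bases instead of a unitary operator
and two given bases, closure under transposition is evident.\<close>

definition orthostochastic :: "'a::complex_hilbert_space itself \<Rightarrow> (nat \<Rightarrow> nat \<Rightarrow> real) \<Rightarrow> bool" where
  "orthostochastic _ D \<longleftrightarrow> (\<exists>p h :: nat \<Rightarrow> 'a. orthonormal_basis p \<and> orthonormal_basis h \<and>
     D = (\<lambda>i j. (cmod (cinner (p j) (h i)))\<^sup>2))"

lemma orthostochastic_imp_doubly_stochastic:
  "orthostochastic TYPE('a::complex_hilbert_space) D \<Longrightarrow> doubly_stochastic D"
proof -
  assume "orthostochastic TYPE('a) D"
  then obtain p h :: "nat \<Rightarrow> 'a" where p: "orthonormal_basis p" and h: "orthonormal_basis h"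
    and D: "D = (\<lambda>i j. (cmod (cinner (p j) (h i)))\<^sup>2)" by (auto simp: orthostochastic_def)
  have "((\<lambda>j. D i j) has_sum 1) UNIV" for i
    using Parseval_norm[OF p, of "h i"] orthonormal_seqD(2)[OF orthonormal_basisD(1)[OF h], of i] by (simp add: D)
  moreover have "((\<lambda>i. D i j) has_sum 1) UNIV" for j
    using Parseval_norm[OF h, of "p j"] orthonormal_seqD(2)[OF orthonormal_basisD(1)[OF p], of j]
    by (simp add: D cmod_cinner_commute[of "p j"])
  ultimately show ?thesis by (auto simp: doubly_stochastic_def D)
qed

lemma orthostochastic_transpose:
  "orthostochastic TYPE('a::complex_hilbert_space) D \<Longrightarrow> orthostochastic TYPE('a) (matrix_transpose D)"
  unfolding orthostochastic_def matrix_transpose_def by (metis cmod_cinner_commute)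

text \<open>A unitary operator \<open>U\<close> gives the matrix of the bases \<open>f\<close> and \<open>U \<circ> e\<close>. Conversely, a unitary operator
that maps \<open>p\<close> to \<open>f\<close> maps \<open>h\<close> to some basis, and \<open>U\<close> is chosen to map \<open>e\<close> to that basis.\<close>

lemma C_numerical_range_eq_pairings:
  fixes C T :: "'a::complex_hilbert_space \<Rightarrow> 'a"
  assumes C: "diagonalized_by C e c" "(\<lambda>n. cmod (c n)) summable_on UNIV"
    and T: "diagonalized_by T f t" "bounded_clinear T" and ct: "pairable c t"
  shows "C_numerical_range C T = {pairing c t D | D. orthostochastic TYPE('a) D}"
proof -
  have e: "orthonormal_basis e" and f: "orthonormal_basis f"
    and Tf: "\<And>m x. cinner (f m) (T x) = t m * cinner (f m) x"
    using C T by (auto simp: diagonalized_by_def)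
  have trace: "op_trace (C \<circ> cadjoint U \<circ> T \<circ> U) = pairing c t (\<lambda>i j. (cmod (cinner (f j) (U (e i))))\<^sup>2)"
    if U: "unitary_op U" for U
  proof -
    let ?D = "\<lambda>i j. (cmod (cinner (f j) (U (e i))))\<^sup>2"
    have bU: "bounded_clinear U" using U by (simp add: unitary_op_def)
    note bU' = bounded_clinear_cadjoint[OF e bU]
    have D: "doubly_stochastic ?D"
      by (rule orthostochastic_imp_doubly_stochastic[where 'a = 'a])
         (use f unitary_op_preserves(2)[OF U e] in \<open>auto simp: orthostochastic_def\<close>)
    have "((\<lambda>i. c i * cinner (U (e i)) (T (U (e i)))) has_sum pairing c t ?D) UNIV"
    proof (rule pairing_by_rows[OF ct D])
      fix i
      let ?h = "U (e i)"
      have "cinner ?h (f j) * cinner (f j) (T ?h) = complex_of_real (?D i j) * t j" for j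
      proof -
        have "cinner ?h (f j) * cinner (f j) (T ?h) = (cinner ?h (f j) * cinner (f j) ?h) * t j"
          by (simp only: Tf mult_ac)
        then show ?thesis by (simp only: cinner_mult_cnj)
      qed
      then show "((\<lambda>j. complex_of_real (?D i j) * t j) has_sum cinner ?h (T ?h)) UNIV"
        using Parseval_identity[OF f, of ?h "T ?h"] by simp
    qed
    then have "((\<lambda>i. c i * cinner (e i) ((cadjoint U \<circ> T \<circ> U) (e i))) has_sum pairing c t ?D) UNIV"
      by (simp add: cinner_cadjoint[OF e bU])
    moreover have "bounded_clinear (cadjoint U \<circ> T \<circ> U)"
    proof -
      have "bounded_linear (\<lambda>x. cadjoint U (T (U x)))"
        by (intro bounded_linear_compose[OF bounded_clinearD(1)[OF bU']]
            bounded_linear_compose[OF bounded_clinearD(1)[OF T(2)]] bounded_clinearD(1)[OF bU])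
      then show ?thesis
        by (simp add: bounded_clinear_def comp_def bounded_clinearD(2)[OF bU] bounded_clinearD(2)[OF bU']
            bounded_clinearD(2)[OF T(2)])
    qed
    ultimately have "op_trace (C \<circ> (cadjoint U \<circ> T \<circ> U)) = pairing c t ?D"
      by (intro op_trace_diagonal_compose[OF C])
    then show ?thesis by (simp only: comp_assoc)
  qed
  show ?thesis
  proof
    show "C_numerical_range C T \<subseteq> {pairing c t D | D. orthostochastic TYPE('a) D}"
    proof
      fix z assume "z \<in> C_numerical_range C T"
      then obtain U where U: "unitary_op U" "z = op_trace (C \<circ> cadjoint U \<circ> T \<circ> U)"
        by (auto simp: C_numerical_range_def)
      moreover have "orthostochastic TYPE('a) (\<lambda>i j. (cmod (cinner (f j) (U (e i))))\<^sup>2)"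
        using f unitary_op_preserves(2)[OF U(1) e] by (auto simp: orthostochastic_def)
      ultimately show "z \<in> {pairing c t D | D. orthostochastic TYPE('a) D}" using trace by blast
    qed
    show "{pairing c t D | D. orthostochastic TYPE('a) D} \<subseteq> C_numerical_range C T"
    proof clarify
      fix D assume "orthostochastic TYPE('a) D"
      then obtain p h :: "nat \<Rightarrow> 'a" where p: "orthonormal_basis p" and h: "orthonormal_basis h"
        and D: "D = (\<lambda>i j. (cmod (cinner (p j) (h i)))\<^sup>2)" by (auto simp: orthostochastic_def)
      obtain V where V: "unitary_op V" "\<And>x n. cinner (f n) (V x) = cinner (p n) x"
        using exists_unitary_between_bases[OF p f] by metis
      obtain U where U: "unitary_op U" "\<And>n. U (e n) = V (h n)"
        using exists_unitary_between_bases[OF e unitary_op_preserves(2)[OF V(1) h]] by metis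
      have "pairing c t D = op_trace (C \<circ> cadjoint U \<circ> T \<circ> U)"
        by (simp add: trace[OF U(1)] U(2) V(2) D)
      then show "pairing c t D \<in> C_numerical_range C T"
        unfolding C_numerical_range_def using U(1) by blast
    qed
  qed
qed

section \<open>Diagonals of selfadjoint operators\<close>

lemma orthonormal_basis_rotate_pair:
  fixes h :: "nat \<Rightarrow> 'a::complex_hilbert_space" and \<alpha> \<beta> :: real
  assumes h: "orthonormal_basis h" and ij: "i \<noteq> j"
    and ab: "\<alpha>\<^sup>2 + \<beta>\<^sup>2 = 1" and w: "cmod \<omega> = 1"
  shows "orthonormal_basis (h(i := complex_of_real \<alpha> *\<^sub>C h i + (complex_of_real \<beta> * \<omega>) *\<^sub>C h j,
                              j := complex_of_real (- \<beta>) *\<^sub>C h i + (complex_of_real \<alpha> * \<omega>) *\<^sub>C h j))"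
    (is "orthonormal_basis ?g")
proof (rule orthonormal_basisI)
  note o = orthonormal_seqD(1)[OF orthonormal_basisD(1)[OF h]]
  have ww: "\<omega> * cnj \<omega> = 1" using w by (simp flip: complex_norm_square)
  have ab': "complex_of_real \<alpha> * complex_of_real \<alpha> + complex_of_real \<beta> * complex_of_real \<beta> = 1"
    using ab by (simp add: power2_eq_square flip: of_real_mult of_real_add)
  have gi: "?g i = complex_of_real \<alpha> *\<^sub>C h i + (complex_of_real \<beta> * \<omega>) *\<^sub>C h j"
    and gj: "?g j = complex_of_real (- \<beta>) *\<^sub>C h i + (complex_of_real \<alpha> * \<omega>) *\<^sub>C h j"
    and gk: "\<And>k. k \<noteq> i \<Longrightarrow> k \<noteq> j \<Longrightarrow> ?g k = h k"
    using ij by auto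
  note ci = cinner_add_left cinner_add_right cinner_scaleC_left cinner_scaleC_right
  have p: "cinner (?g i) (?g i) = 1" "cinner (?g j) (?g j) = 1" "cinner (?g i) (?g j) = 0" "cinner (?g j) (?g i) = 0"
  proof -
    have "cinner (?g i) (?g i) = complex_of_real \<alpha> * complex_of_real \<alpha> + complex_of_real \<beta> * complex_of_real \<beta> * (\<omega> * cnj \<omega>)"
      unfolding gi ci using ij by (simp add: o algebra_simps)
    then show "cinner (?g i) (?g i) = 1" by (simp only: ww ab' mult_1_right)
    have "cinner (?g j) (?g j) = complex_of_real \<beta> * complex_of_real \<beta> + complex_of_real \<alpha> * complex_of_real \<alpha> * (\<omega> * cnj \<omega>)"
      unfolding gj ci using ij by (simp add: o algebra_simps)
    then show "cinner (?g j) (?g j) = 1" using ab' by (simp only: ww mult_1_right add.commute)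
    have "cinner (?g i) (?g j) = complex_of_real \<alpha> * complex_of_real \<beta> * (\<omega> * cnj \<omega>) - complex_of_real \<alpha> * complex_of_real \<beta>"
      unfolding gi gj ci using ij by (simp add: o algebra_simps)
    then show "cinner (?g i) (?g j) = 0" by (simp add: ww)
    then show "cinner (?g j) (?g i) = 0" by (simp only: cinner_eq_zero_commute[of "?g j"])
  qed
  have q: "cinner (h k) (?g i) = 0" "cinner (h k) (?g j) = 0" "cinner (?g i) (h k) = 0" "cinner (?g j) (h k) = 0"
    if "k \<noteq> i" "k \<noteq> j" for k
    unfolding gi gj ci using that by (simp_all add: o)
  show "orthonormal_seq ?g"
    unfolding orthonormal_seq_def
  proof (intro allI)
    fix m n
    consider "m = i" | "m = j" | "m \<noteq> i" "m \<noteq> j" by blast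
    moreover consider "n = i" | "n = j" | "n \<noteq> i" "n \<noteq> j" by blast
    ultimately show "cinner (?g m) (?g n) = (if m = n then 1 else 0)"
      using p q gk o ij by (metis (no_types, lifting))
  qed
  fix x assume x: "\<And>n. cinner (?g n) x = 0"
  define a where "a = cinner (h i) x"
  define b where "b = cnj \<omega> * cinner (h j) x"
  \<comment> \<open>The coefficients \<open>a\<close> and \<open>b\<close> satisfy the two equations of a rotation applied to \<open>(a, b)\<close>.\<close>
  have 1: "complex_of_real \<alpha> * a + complex_of_real \<beta> * b = 0"
    using x[of i] unfolding gi ci by (simp add: a_def b_def mult_ac)
  have 2: "complex_of_real \<alpha> * b - complex_of_real \<beta> * a = 0"
    using x[of j] unfolding gj ci by (simp add: a_def b_def mult_ac)
  have "a = (complex_of_real \<alpha> * complex_of_real \<alpha> + complex_of_real \<beta> * complex_of_real \<beta>) * a"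
    by (simp only: ab' mult_1_left)
  also have "\<dots> = complex_of_real \<alpha> * (complex_of_real \<alpha> * a + complex_of_real \<beta> * b)
      - complex_of_real \<beta> * (complex_of_real \<alpha> * b - complex_of_real \<beta> * a)"
    by (simp add: algebra_simps)
  finally have a0: "a = 0" by (simp only: 1 2) simp
  have "b = (complex_of_real \<alpha> * complex_of_real \<alpha> + complex_of_real \<beta> * complex_of_real \<beta>) * b"
    by (simp only: ab' mult_1_left)
  also have "\<dots> = complex_of_real \<beta> * (complex_of_real \<alpha> * a + complex_of_real \<beta> * b)
      + complex_of_real \<alpha> * (complex_of_real \<alpha> * b - complex_of_real \<beta> * a)"
    by (simp add: algebra_simps)
  finally have "b = 0" by (simp only: 1 2) simp
  then have b0: "cinner (h j) x = 0" using w by (auto simp: b_def)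
  show "x = 0"
  proof (rule orthonormal_basisD(2)[OF h])
    show "cinner (h n) x = 0" for n
      using a0 b0 x[of n] gk[of n] by (cases "n = i \<or> n = j") (auto simp: a_def)
  qed
qed

lemma Re_complex_of_real_mult: "Re (complex_of_real a * z) = a * Re z"
  by simp

lemma power2_cmod_combination:
  fixes \<alpha> \<beta> :: real
  assumes "cmod \<omega> = 1"
  shows "(cmod (complex_of_real \<alpha> * P + complex_of_real \<beta> * \<omega> * Q))\<^sup>2
    = \<alpha>\<^sup>2 * (cmod P)\<^sup>2 + \<beta>\<^sup>2 * (cmod Q)\<^sup>2 + 2 * \<alpha> * \<beta> * Re (\<omega> * (cnj P * Q))"
proof -
  have add: "(cmod (a + b))\<^sup>2 = (cmod a)\<^sup>2 + (cmod b)\<^sup>2 + 2 * Re (cnj a * b)" for a b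
    unfolding cmod_power2 by (simp add: power2_eq_square algebra_simps)
  have "cnj (complex_of_real \<alpha> * P) * (complex_of_real \<beta> * \<omega> * Q)
      = complex_of_real (\<alpha> * \<beta>) * (\<omega> * (cnj P * Q))"
    by (simp add: mult_ac)
  then have "Re (cnj (complex_of_real \<alpha> * P) * (complex_of_real \<beta> * \<omega> * Q)) = \<alpha> * \<beta> * Re (\<omega> * (cnj P * Q))"
    by (simp only: Re_complex_of_real_mult)
  then show ?thesis by (simp only: add) (simp add: norm_mult assms power_mult_distrib)
qed

text \<open>The diagonals \<open>(\<langle>h i, R (h i)\<rangle>)\<^sub>i\<close> of the selfadjoint operator \<open>R\<close> with eigenvectors \<open>f\<close> and eigenvalues
\<open>\<rho>\<close>, for all orthonormal bases \<open>h\<close>, form a set that is closed under averaging two coordinates: \<open>h i\<close>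
and \<open>h j\<close> are rotated in their plane by an angle with cosine \<open>sqrt (1 - s)\<close>, after \<open>h j\<close> has been
multiplied by a phase that makes \<open>\<langle>h i, R (h j)\<rangle>\<close> purely imaginary. Diagonals of \<open>R\<close> are the images
of \<open>\<rho>\<close> under orthostochastic matrices.\<close>

lemma pairing_in_closure_orthostochastic:
  fixes f :: "nat \<Rightarrow> 'a::complex_hilbert_space"
  assumes f: "orthonormal_basis f" and br: "pairable b r"
    and r: "\<And>j. r j = u * complex_of_real (\<rho> j)" "u \<noteq> 0" and D: "doubly_stochastic D"
  shows "pairing b r D \<in> closure {pairing b r E | E. orthostochastic TYPE('a) E}"
  unfolding closure_approachable
proof (intro allI impI)
  fix \<epsilon> :: real assume "0 < \<epsilon>"
  obtain M x z where reach:
      "\<And>S. \<lbrakk>swap_averaging_closed M S; \<And>y p. y \<in> S \<Longrightarrow> p permutes {..<M} \<Longrightarrow> y \<circ> p \<in> S; \<rho> \<in> S\<rbrakk> \<Longrightarrow> x \<in> S"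
    and x: "((\<lambda>i. b i * (u * complex_of_real (x i))) has_sum z) UNIV"
    and z: "norm (z - pairing b r D) \<le> \<epsilon> / 2"
    using pairing_approx_by_swap_averages[OF br r(1) D, of "\<epsilon> / 2"] \<open>0 < \<epsilon>\<close> by auto
  have "r \<longlonglongrightarrow> 0"
    using br unfolding pairable_def
    by (metis summable_LIMSEQ_zero summable_on_imp_summable tendsto_norm_zero_cancel)
  then obtain K where K: "0 < K" "\<And>j. cmod (r j) \<le> K"
    using convergent_imp_Bseq[of r] by (auto simp: convergent_def Bseq_def)
  have \<rho>: "\<bar>\<rho> j\<bar> \<le> K / cmod u" for j
    using K(2)[of j] r(2) by (simp add: r(1) norm_mult field_simps)
  let ?q = "\<lambda>v j. \<rho> j * (cmod (cinner (f j) v))\<^sup>2"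
  define S where "S = {x. \<exists>h. orthonormal_basis h \<and> (\<forall>i. (?q (h i) has_sum x i) UNIV)}"
  have "x \<in> S"
  proof (rule reach)
    show "y \<circ> p \<in> S" if y: "y \<in> S" and p: "p permutes {..<M}" for y p
    proof -
      obtain h where h: "orthonormal_basis h" "\<And>i. (?q (h i) has_sum y i) UNIV" using y by (auto simp: S_def)
      have "orthonormal_basis (h \<circ> p)"
      proof (rule orthonormal_basisI)
        show "orthonormal_seq (h \<circ> p)"
          using orthonormal_seqD(1)[OF orthonormal_basisD(1)[OF h(1)]] permutes_inj[OF p]
          by (auto simp: orthonormal_seq_def inj_eq)
        show "v = 0" if v: "\<And>n. cinner ((h \<circ> p) n) v = 0" for v
        proof (rule orthonormal_basisD(2)[OF h(1)])
          show "cinner (h n) v = 0" for n using v[of "inv p n"] permutes_inverses(1)[OF p] by simp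
        qed
      qed
      then show ?thesis unfolding S_def using h(2) by (auto intro!: exI[of _ "h \<circ> p"])
    qed
    show "\<rho> \<in> S"
    proof -
      have "(?q (f i) has_sum \<rho> i) UNIV" for i
        by (rule has_sum_finite_neutralI[of "{i}"])
           (auto simp: orthonormal_seqD(1)[OF orthonormal_basisD(1)[OF f]])
      then show ?thesis using f by (auto simp: S_def)
    qed
    show "swap_averaging_closed M S"
      unfolding swap_averaging_closed_def
    proof (intro ballI allI impI)
      fix y i j and s :: real
      assume y: "y \<in> S" and ij: "i < M" "j < M" "i \<noteq> j" and s: "0 \<le> s" "s \<le> 1"
      let ?y = "y(i := (1 - s) * y i + s * y j, j := s * y i + (1 - s) * y j)"
      obtain h where h: "orthonormal_basis h" "\<And>i. (?q (h i) has_sum y i) UNIV" using y by (auto simp: S_def)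
      let ?c = "\<lambda>k. cinner (h i) (f k) * cinner (f k) (h j)"
      have "(\<lambda>k. cmod (complex_of_real (\<rho> k) * ?c k)) summable_on UNIV"
      proof (rule summable_on_comparison_test)
        show "(\<lambda>k. K / cmod u * cmod (?c k)) summable_on UNIV"
          by (rule summable_on_cmult_right[OF Bessel_products(1)[OF orthonormal_basisD(1)[OF f]]])
        show "cmod (complex_of_real (\<rho> k) * ?c k) \<le> K / cmod u * cmod (?c k)" for k
          unfolding norm_mult[of "complex_of_real (\<rho> k)"] using \<rho>[of k] by (intro mult_right_mono) auto
      qed auto
      then obtain w where w: "((\<lambda>k. complex_of_real (\<rho> k) * ?c k) has_sum w) UNIV"
        using abs_summable_summable by (force simp: summable_on_def)
      \<comment> \<open>\<open>w = \<langle>h i, R (h j)\<rangle>\<close> is the off-diagonal entry, and \<open>\<omega> * w\<close> is purely imaginary.\<close>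
      define \<omega> where "\<omega> = (if w = 0 then 1 else \<i> * cnj w / complex_of_real (cmod w))"
      have \<omega>: "cmod \<omega> = 1" "Re (\<omega> * w) = 0"
      proof -
        show "cmod \<omega> = 1" by (simp add: \<omega>_def norm_mult norm_divide)
        have "\<i> * cnj w / complex_of_real (cmod w) * w = \<i> * complex_of_real (cmod w)" if "w \<noteq> 0"
          using that complex_norm_square[of w] by (simp add: field_simps power2_eq_square)
        then show "Re (\<omega> * w) = 0" by (auto simp: \<omega>_def)
      qed
      have rotated: "(?q (complex_of_real \<alpha> *\<^sub>C h i + (complex_of_real \<beta> * \<omega>) *\<^sub>C h j) has_sum
          \<alpha>\<^sup>2 * y i + \<beta>\<^sup>2 * y j) UNIV" for \<alpha> \<beta> :: real
      proof -
        have "((\<lambda>k. Re (\<omega> * (complex_of_real (\<rho> k) * ?c k))) has_sum Re (\<omega> * w)) UNIV"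
          by (intro has_sum_Re has_sum_cmult_right w)
        then have "((\<lambda>k. \<alpha>\<^sup>2 * ?q (h i) k + \<beta>\<^sup>2 * ?q (h j) k
            + 2 * \<alpha> * \<beta> * Re (\<omega> * (complex_of_real (\<rho> k) * ?c k))) has_sum
            (\<alpha>\<^sup>2 * y i + \<beta>\<^sup>2 * y j + 2 * \<alpha> * \<beta> * 0)) UNIV"
          unfolding \<omega>(2) by (intro has_sum_add has_sum_cmult_right h(2))
        moreover have "\<alpha>\<^sup>2 * ?q (h i) k + \<beta>\<^sup>2 * ?q (h j) k + 2 * \<alpha> * \<beta> * Re (\<omega> * (complex_of_real (\<rho> k) * ?c k))
            = ?q (complex_of_real \<alpha> *\<^sub>C h i + (complex_of_real \<beta> * \<omega>) *\<^sub>C h j) k" for k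
        proof -
          have cnj: "cnj (cinner (f k) (h i)) = cinner (h i) (f k)" using cinner_commute[of "h i" "f k"] by simp
          have "\<omega> * (complex_of_real (\<rho> k) * ?c k) = complex_of_real (\<rho> k) * (\<omega> * ?c k)"
            by (simp only: mult_ac)
          then have "Re (\<omega> * (complex_of_real (\<rho> k) * ?c k)) = \<rho> k * Re (\<omega> * ?c k)"
            by (simp only: Re_complex_of_real_mult)
          then show ?thesis
            by (simp only: cinner_add_right cinner_scaleC_right power2_cmod_combination[OF \<omega>(1)] cnj)
               (simp only: algebra_simps)
        qed
        ultimately show ?thesis by simp
      qed
      define \<alpha> \<beta> where "\<alpha> = sqrt (1 - s)" and "\<beta> = sqrt s"
      have ab: "\<alpha>\<^sup>2 = 1 - s" "\<beta>\<^sup>2 = s" using s by (auto simp: \<alpha>_def \<beta>_def)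
      let ?h = "h(i := complex_of_real \<alpha> *\<^sub>C h i + (complex_of_real \<beta> * \<omega>) *\<^sub>C h j,
                  j := complex_of_real (- \<beta>) *\<^sub>C h i + (complex_of_real \<alpha> * \<omega>) *\<^sub>C h j)"
      have "orthonormal_basis ?h"
        by (rule orthonormal_basis_rotate_pair[OF h(1) ij(3) _ \<omega>(1)]) (simp add: ab)
      moreover have "(?q (?h k) has_sum ?y k) UNIV" for k
        using rotated[of \<alpha> \<beta>] rotated[of "- \<beta>" \<alpha>] h(2)[of k] ij(3) by (auto simp: ab)
      ultimately show "?y \<in> S" unfolding S_def by blast
    qed
  qed
  then obtain h where h: "orthonormal_basis h" "\<And>i. (?q (h i) has_sum x i) UNIV" by (auto simp: S_def)
  define E where "E = (\<lambda>i j. (cmod (cinner (f j) (h i)))\<^sup>2)"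
  have E: "orthostochastic TYPE('a) E" using f h(1) by (auto simp: orthostochastic_def E_def)
  have "((\<lambda>i. b i * (u * complex_of_real (x i))) has_sum pairing b r E) UNIV"
  proof (rule pairing_by_rows[OF br orthostochastic_imp_doubly_stochastic[OF E]])
    fix i
    have "((\<lambda>j. u * complex_of_real (?q (h i) j)) has_sum u * complex_of_real (x i)) UNIV"
      by (intro has_sum_cmult_right has_sum_of_real h(2))
    then show "((\<lambda>j. complex_of_real (E i j) * r j) has_sum u * complex_of_real (x i)) UNIV"
      by (simp add: E_def r(1) mult_ac)
  qed
  then have "z = pairing b r E" using has_sum_unique[OF x] by blast
  then show "\<exists>y\<in>{pairing b r E | E. orthostochastic TYPE('a) E}. dist y (pairing b r D) < \<epsilon>"
    using z E \<open>0 < \<epsilon>\<close> by (auto simp: dist_norm intro!: bexI[of _ z])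
qed

section \<open>Modified eigenvalue sequences and the spectrum\<close>

text \<open>As infinite sets have card \<open>0\<close>, finiteness is compared separately. Corresponding fibres are then in
bijection, since any two infinite sets of naturals are.\<close>

lemma exists_permutation_of_fibre_counts:
  fixes f g :: "nat \<Rightarrow> 'b"
  assumes "\<And>z. (finite {n. f n = z} \<longleftrightarrow> finite {n. g n = z}) \<and> card {n. f n = z} = card {n. g n = z}"
  obtains \<pi> where "bij \<pi>" "f = g \<circ> \<pi>"
proof -
  have "\<exists>h. bij_betw h {n. f n = z} {n. g n = z}" for z
  proof (cases "finite {n. f n = z}")
    case True
    then show ?thesis using assms[of z] finite_same_card_bij[of "{n. f n = z}" "{n. g n = z}"] by blast
  next
    case False
    then have "infinite {n. g n = z}" using assms[of z] by simp
    with False have "bij_betw (from_nat_into {n. g n = z} \<circ> to_nat_on {n. f n = z}) {n. f n = z} {n. g n = z}"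
      by (intro bij_betw_trans[OF to_nat_on_infinite bij_betw_from_nat_into]) auto
    then show ?thesis by blast
  qed
  then obtain h where h: "\<And>z. bij_betw (h z) {n. f n = z} {n. g n = z}" by metis
  define \<pi> where "\<pi> n = h (f n) n" for n
  have g: "g (\<pi> n) = f n" for n
    using bij_betw_apply[OF h[of "f n"], of n] by (simp add: \<pi>_def)
  have "bij \<pi>"
  proof (rule bijI)
    show "inj \<pi>"
    proof (rule injI)
      fix m n assume eq: "\<pi> m = \<pi> n"
      have fe: "f m = f n" using g[of m] g[of n] by (simp add: eq)
      then have "h (f n) m = h (f n) n" using eq by (simp add: \<pi>_def)
      then show "m = n" using bij_betw_imp_inj_on[OF h[of "f n"]] fe by (simp add: inj_on_def)
    qed
    show "surj \<pi>"
    proof (rule surjI[of _ "\<lambda>m. inv_into {n. f n = g m} (h (g m)) m"])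
      fix m
      let ?n = "inv_into {n. f n = g m} (h (g m)) m"
      have m: "m \<in> h (g m) ` {n. f n = g m}" using bij_betw_imp_surj_on[OF h[of "g m"]] by simp
      have "f ?n = g m" using inv_into_into[OF m] by simp
      then show "\<pi> ?n = m" using f_inv_into_f[OF m] by (simp add: \<pi>_def)
    qed
  qed
  moreover have "f = g \<circ> \<pi>" by (simp add: fun_eq_iff g)
  ultimately show ?thesis by (rule that)
qed

text \<open>The closed span of the basis vectors with index in \<open>I\<close>, described by its orthogonal complement.\<close>

definition basis_span :: "(nat \<Rightarrow> 'a::complex_hilbert_space) \<Rightarrow> nat set \<Rightarrow> 'a set" where
  "basis_span e I = {x. \<forall>n. n \<notin> I \<longrightarrow> cinner (e n) x = 0}"

lemma basis_in_basis_span: "orthonormal_basis e \<Longrightarrow> n \<in> I \<Longrightarrow> e n \<in> basis_span e I"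
  by (auto simp: basis_span_def orthonormal_seqD(1) orthonormal_basisD(1))

lemma independent_orthonormal:
  assumes e: "orthonormal_basis e"
  shows "complex_vector.independent (e ` I)"
  unfolding complex_vector.dependent_explicit
proof clarify
  fix t u v assume t: "finite t" "t \<subseteq> e ` I" "(\<Sum>v\<in>t. u v *\<^sub>C v) = 0" and v: "v \<in> t" "u v \<noteq> 0"
  have "cinner v (\<Sum>w\<in>t. u w *\<^sub>C w) = (\<Sum>w\<in>t. if w = v then u v else 0)"
    unfolding cinner_sum_right
  proof (intro sum.cong refl)
    fix w assume "w \<in> t"
    then obtain m n where mn: "w = e m" "v = e n" using t(2) v(1) by blast
    then show "cinner v (u w *\<^sub>C w) = (if w = v then u v else 0)"
      using orthonormal_seqD(1,4)[OF orthonormal_basisD(1)[OF e]]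
      by (auto simp: cinner_scaleC_right inj_eq)
  qed
  then show False using t v by simp
qed

lemma basis_span_finite:
  assumes e: "orthonormal_basis e" and I: "finite I"
  shows "basis_span e I = cspan (e ` I)" "cdim (basis_span e I) = card I" "finite_cdim (basis_span e I)"
proof -
  note o = orthonormal_seqD[OF orthonormal_basisD(1)[OF e]]
  show eq: "basis_span e I = cspan (e ` I)"
  proof
    show "cspan (e ` I) \<subseteq> basis_span e I"
    proof (rule complex_vector.span_minimal)
      show "complex_vector.subspace (basis_span e I)"
        by (auto simp: basis_span_def complex_vector.subspace_def cinner_add_right cinner_scaleC_right)
    qed (use basis_in_basis_span[OF e] in auto)
    show "basis_span e I \<subseteq> cspan (e ` I)"
    proof
      fix x assume x: "x \<in> basis_span e I"
      have "x = (\<Sum>n\<in>I. cinner (e n) x *\<^sub>C e n)"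
      proof (rule orthonormal_basis_eqI[OF e])
        fix m
        have "cinner (e m) (\<Sum>n\<in>I. cinner (e n) x *\<^sub>C e n) = (\<Sum>n\<in>I. if n = m then cinner (e m) x else 0)"
          unfolding cinner_sum_right by (intro sum.cong refl) (simp add: cinner_scaleC_right o(1))
        then show "cinner (e m) x = cinner (e m) (\<Sum>n\<in>I. cinner (e n) x *\<^sub>C e n)"
          using x I by (auto simp: basis_span_def)
      qed
      also have "\<dots> \<in> cspan (e ` I)"
        by (intro complex_vector.span_sum complex_vector.span_scale complex_vector.span_base) auto
      finally show "x \<in> cspan (e ` I)" .
    qed
  qed
  show "cdim (basis_span e I) = card I"
    unfolding eq complex_vector.dim_span_eq_card_independent[OF independent_orthonormal[OF e]]
    by (rule card_image) (use o(4) in \<open>auto intro: inj_on_subset\<close>)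
  show "finite_cdim (basis_span e I)" unfolding eq finite_cdim_def using I by blast
qed

lemma finite_cdim_basis_subset:
  assumes e: "orthonormal_basis e" and S: "finite_cdim S" "e ` I \<subseteq> S"
  shows "finite I"
proof -
  obtain B where "finite B" "S \<subseteq> cspan B" using S(1) by (auto simp: finite_cdim_def)
  then have "finite (e ` I)"
    using complex_vector.independent_span_bound[OF _ independent_orthonormal[OF e], of B I] S(2) by blast
  moreover have "inj_on e I"
    using orthonormal_seqD(4)[OF orthonormal_basisD(1)[OF e]] by (rule inj_on_subset) simp
  ultimately show ?thesis by (rule finite_imageD)
qed

text \<open>In coordinates \<open>(T - z)\<^sup>k\<close> multiplies by \<open>(c n - z)\<^sup>k\<close>, so that generalized eigenvectors are
eigenvectors, and algebraic multiplicities count how often a value occurs in \<open>c\<close>.\<close>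

lemma diagonalized_spaces:
  assumes d: "diagonalized_by T e c"
  shows "algebraic_multiplicity T z = cdim (basis_span e {n. c n = z})"
    "op_kernel T = basis_span e {n. c n = 0}" "range T \<subseteq> basis_span e {n. c n \<noteq> 0}"
    "e ` {n. c n \<noteq> 0} \<subseteq> range T"
proof -
  have e: "orthonormal_basis e" and T: "\<And>n x. cinner (e n) (T x) = c n * cinner (e n) x"
    using d by (auto simp: diagonalized_by_def)
  have pow: "cinner (e n) (((\<lambda>x. T x - z *\<^sub>C x) ^^ k) x) = (c n - z) ^ k * cinner (e n) x" for n k x z
    by (induction k) (auto simp: T cinner_diff_right cinner_scaleC_right algebra_simps)
  have ker: "op_kernel ((\<lambda>x. T x - z *\<^sub>C x) ^^ Suc 0) = basis_span e {n. c n = z}" for z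
  proof -
    have "T x - z *\<^sub>C x = 0 \<longleftrightarrow> (\<forall>n. c n \<noteq> z \<longrightarrow> cinner (e n) x = 0)" for x
    proof
      assume "T x - z *\<^sub>C x = 0"
      then have "(c n - z) * cinner (e n) x = 0" for n using pow[of n "Suc 0" z x] by simp
      then show "\<forall>n. c n \<noteq> z \<longrightarrow> cinner (e n) x = 0" by auto
    next
      assume *: "\<forall>n. c n \<noteq> z \<longrightarrow> cinner (e n) x = 0"
      show "T x - z *\<^sub>C x = 0"
      proof (rule orthonormal_basisD(2)[OF e])
        show "cinner (e n) (T x - z *\<^sub>C x) = 0" for n
          using pow[of n "Suc 0" z x] * by (cases "c n = z") auto
      qed
    qed
    then show ?thesis by (auto simp: op_kernel_def basis_span_def)
  qed
  have "(\<Union>k. op_kernel ((\<lambda>x. T x - z *\<^sub>C x) ^^ k)) = basis_span e {n. c n = z}"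
  proof
    show "basis_span e {n. c n = z} \<subseteq> (\<Union>k. op_kernel ((\<lambda>x. T x - z *\<^sub>C x) ^^ k))"
      using ker by blast
    show "(\<Union>k. op_kernel ((\<lambda>x. T x - z *\<^sub>C x) ^^ k)) \<subseteq> basis_span e {n. c n = z}"
    proof clarify
      fix k x assume "x \<in> op_kernel ((\<lambda>x. T x - z *\<^sub>C x) ^^ k)"
      then have "(c n - z) ^ k * cinner (e n) x = 0" for n
        using pow[of n k z x] by (simp add: op_kernel_def)
      then show "x \<in> basis_span e {n. c n = z}" by (auto simp: basis_span_def)
    qed
  qed
  then show "algebraic_multiplicity T z = cdim (basis_span e {n. c n = z})"
    by (simp add: algebraic_multiplicity_def)
  show "op_kernel T = basis_span e {n. c n = 0}" using ker[of 0] by (simp add: op_kernel_def)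
  show "range T \<subseteq> basis_span e {n. c n \<noteq> 0}" by (auto simp: basis_span_def T)
  show "e ` {n. c n \<noteq> 0} \<subseteq> range T"
  proof clarify
    fix n assume n: "c n \<noteq> 0"
    have "T ((1 / c n) *\<^sub>C e n) = e n"
      by (rule orthonormal_basis_eqI[OF e])
         (use n in \<open>simp add: T cinner_scaleC_right orthonormal_seqD(1)[OF orthonormal_basisD(1)[OF e]]\<close>)
    then show "e n \<in> range T" by (metis rangeI)
  qed
qed

lemma diagonalized_dimensions:
  assumes d: "diagonalized_by T e c" and c: "c \<longlonglongrightarrow> 0"
  shows "z \<noteq> 0 \<Longrightarrow> finite {n. c n = z}"
    "z \<noteq> 0 \<Longrightarrow> algebraic_multiplicity T z = card {n. c n = z}"
    "finite_cdim (range T) \<longleftrightarrow> finite {n. c n \<noteq> 0}"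
    "finite_cdim (op_kernel T) \<longleftrightarrow> finite {n. c n = 0}"
    "finite {n. c n = 0} \<Longrightarrow> cdim (op_kernel T) = card {n. c n = 0}"
proof -
  have e: "orthonormal_basis e" using d by (auto simp: diagonalized_by_def)
  note sp = diagonalized_spaces[OF d]
  show fin: "finite {n. c n = z}" if z: "z \<noteq> 0" for z
  proof -
    obtain N where "\<And>n. N \<le> n \<Longrightarrow> cmod (c n) < cmod z"
      using LIMSEQ_D[OF c, of "cmod z"] z by auto
    then have "n < N" if "c n = z" for n using that by (meson leI less_irrefl)
    then have "{n. c n = z} \<subseteq> {..<N}" by blast
    then show ?thesis by (rule finite_subset) simp
  qed
  show "z \<noteq> 0 \<Longrightarrow> algebraic_multiplicity T z = card {n. c n = z}"
    using basis_span_finite(2)[OF e fin] by (simp add: sp(1))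
  show "finite_cdim (range T) \<longleftrightarrow> finite {n. c n \<noteq> 0}"
  proof
    assume "finite_cdim (range T)"
    then show "finite {n. c n \<noteq> 0}" using finite_cdim_basis_subset[OF e _ sp(4)] by blast
  next
    assume "finite {n. c n \<noteq> 0}"
    then have "finite_cdim (basis_span e {n. c n \<noteq> 0})" by (rule basis_span_finite(3)[OF e])
    then show "finite_cdim (range T)" unfolding finite_cdim_def using sp(3) by (meson order_trans)
  qed
  show "finite_cdim (op_kernel T) \<longleftrightarrow> finite {n. c n = 0}"
    unfolding sp(2) using basis_span_finite(3)[OF e] finite_cdim_basis_subset[OF e]
    using basis_in_basis_span[OF e] by (meson image_subsetI)
  show "finite {n. c n = 0} \<Longrightarrow> cdim (op_kernel T) = card {n. c n = 0}"
    unfolding sp(2) by (rule basis_span_finite(2)[OF e])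
qed

lemma finite_nonzero_transfer:
  fixes f g :: "nat \<Rightarrow> complex"
  assumes eq: "\<And>z. z \<noteq> 0 \<Longrightarrow> finite {n. f n = z} \<and> finite {n. g n = z} \<and> card {n. f n = z} = card {n. g n = z}"
  shows "finite {n. f n \<noteq> 0} \<longleftrightarrow> finite {n. g n \<noteq> 0}"
proof -
  have "finite {n. g n \<noteq> 0}" if fin: "finite {n. f n \<noteq> 0}"
    and eq: "\<And>z. z \<noteq> 0 \<Longrightarrow> finite {n. f n = z} \<and> finite {n. g n = z} \<and> card {n. f n = z} = card {n. g n = z}"
    for f g :: "nat \<Rightarrow> complex"
  proof -
    have "{n. g n \<noteq> 0} \<subseteq> (\<Union>z\<in>f ` {n. f n \<noteq> 0}. {n. g n = z})"
    proof
      fix n assume "n \<in> {n. g n \<noteq> 0}"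
      then have z: "g n \<noteq> 0" by simp
      have "card {m. g m = g n} \<noteq> 0" using eq[OF z] by auto
      then have "card {m. f m = g n} \<noteq> 0" using eq[OF z] by simp
      then have "{m. f m = g n} \<noteq> {}" by (metis card.empty)
      then obtain m where m: "f m = g n" by blast
      then have "g n \<in> f ` {n. f n \<noteq> 0}" using z by (intro image_eqI[of _ _ m]) auto
      then show "n \<in> (\<Union>z\<in>f ` {n. f n \<noteq> 0}. {n. g n = z})" by blast
    qed
    moreover have "finite (\<Union>z\<in>f ` {n. f n \<noteq> 0}. {n. g n = z})"
      using fin eq by (intro finite_UN_I) auto
    ultimately show ?thesis by (rule finite_subset)
  qed
  from this[of f g] this[of g f] show ?thesis using eq by auto
qed

lemma eigenvalue_seq_nonzero:
  assumes "eigenvalue_seq T l" and "infinite {n. l n \<noteq> 0}"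
  shows "l n \<noteq> 0"
proof
  assume "l n = 0"
  then have "l m = 0" if "n \<le> m" for m
    using assms(1) that by (force simp: eigenvalue_seq_def decseq_def)
  then have "{n. l n \<noteq> 0} \<subseteq> {..<n}" using leI by blast
  then show False using assms(2) finite_subset by blast
qed

text \<open>Nonzero values occur in both sequences with their algebraic multiplicities, and the three cases of
the definition are made such that zero occurs \<open>dim (ker T)\<close> times. If the range is finite-dimensional,
both sequences have infinitely many zeros; in the other two cases the eigenvalue sequence itself
has no zeros, and the zeros are those added to it.\<close>

lemma modified_eigenvalue_seq_is_permutation:
  assumes d: "diagonalized_by T e c" and c: "c \<longlonglongrightarrow> 0" and t: "modified_eigenvalue_seq T t"
  obtains \<pi> where "bij \<pi>" "t = c \<circ> \<pi>"
proof (rule exists_permutation_of_fibre_counts[of t c])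
  note dim = diagonalized_dimensions[OF d c]
  obtain l where l: "eigenvalue_seq T l" and tl: "if finite_cdim (range T) then t = l
        else if finite_cdim (op_kernel T) then
          t = (\<lambda>n. if n < cdim (op_kernel T) then 0 else l (n - cdim (op_kernel T)))
        else (\<exists>r. strict_mono r \<and> infinite (- range r) \<and>
               (\<forall>n. t (r n) = l n) \<and> (\<forall>m. m \<notin> range r \<longrightarrow> t m = 0))"
    using t by (auto simp: modified_eigenvalue_seq_def)
  have lc: "finite {n. l n = z} \<and> finite {n. c n = z} \<and> card {n. l n = z} = card {n. c n = z}" if "z \<noteq> 0" for z
    using l that dim(1,2)[OF that] by (simp add: eigenvalue_seq_def)
  have nonzero: "finite {n. l n \<noteq> 0} \<longleftrightarrow> finite {n. c n \<noteq> 0}" by (rule finite_nonzero_transfer) (rule lc)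
  have inf0: "infinite {n. f n = 0}" if "finite {n. f n \<noteq> 0}" for f :: "nat \<Rightarrow> complex"
  proof
    assume "finite {n. f n = 0}"
    with that have "finite ({n. f n \<noteq> 0} \<union> {n. f n = 0})" by simp
    moreover have "{n. f n \<noteq> 0} \<union> {n. f n = 0} = UNIV" by auto
    ultimately show False by simp
  qed
  fix z
  consider (fin_range) "finite {n. c n \<noteq> 0}" | (fin_ker) "infinite {n. c n \<noteq> 0}" "finite {n. c n = 0}"
    | (inf) "infinite {n. c n \<noteq> 0}" "infinite {n. c n = 0}" by blast
  then show "(finite {n. t n = z} \<longleftrightarrow> finite {n. c n = z}) \<and> card {n. t n = z} = card {n. c n = z}"
  proof cases
    case fin_range
    then have "t = l" using tl dim(3) by simp
    then show ?thesis
      using lc[of z] inf0[of c] inf0[of l] fin_range nonzero by (cases "z = 0") auto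
  next
    case fin_ker
    define k where "k = card {n. c n = 0}"
    have k: "cdim (op_kernel T) = k" unfolding k_def by (rule dim(5)[OF fin_ker(2)])
    have "t = (\<lambda>n. if n < cdim (op_kernel T) then 0 else l (n - cdim (op_kernel T)))"
      using tl dim(3,4) fin_ker by simp
    then have t: "t = (\<lambda>n. if n < k then 0 else l (n - k))" by (simp only: k)
    have l0: "l n \<noteq> 0" for n by (rule eigenvalue_seq_nonzero[OF l]) (use nonzero fin_ker in simp)
    show ?thesis
    proof (cases "z = 0")
      case True
      then have "{n. t n = z} = {..<k}" using l0 by (auto simp: t)
      then show ?thesis using True fin_ker by (simp add: k_def)
    next
      case False
      have "{n. t n = z} = (\<lambda>n. n + k) ` {n. l n = z}"
      proof
        show "{n. t n = z} \<subseteq> (\<lambda>n. n + k) ` {n. l n = z}"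
        proof
          fix n assume "n \<in> {n. t n = z}"
          then show "n \<in> (\<lambda>n. n + k) ` {n. l n = z}"
            using False by (intro image_eqI[of _ _ "n - k"]) (auto simp: t split: if_splits)
        qed
      qed (auto simp: t)
      then show ?thesis using lc[OF False] by (simp add: card_image)
    qed
  next
    case inf
    obtain r where r: "strict_mono r" "infinite (- range r)" "\<And>n. t (r n) = l n" "\<And>m. m \<notin> range r \<Longrightarrow> t m = 0"
      using tl dim(3,4) inf by auto
    have l0: "l n \<noteq> 0" for n by (rule eigenvalue_seq_nonzero[OF l]) (use nonzero inf in simp)
    show ?thesis
    proof (cases "z = 0")
      case True
      then have "{n. t n = z} = - range r" using l0 r by auto
      then show ?thesis using True inf r(2) by simp
    next
      case False
      have "{n. t n = z} = r ` {n. l n = z}"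
      proof
        show "{n. t n = z} \<subseteq> r ` {n. l n = z}"
        proof
          fix m assume m: "m \<in> {n. t n = z}"
          then obtain n where "m = r n" using r(4)[of m] False by auto
          then show "m \<in> r ` {n. l n = z}" using m r(3) by auto
        qed
      qed (auto simp: r(3))
      moreover have "inj r" using r(1) by (rule strict_mono_imp_inj_on)
      ultimately show ?thesis using lc[OF False] by (simp add: card_image inj_on_subset)
    qed
  qed
qed

text \<open>Repeatedly pick, among the indices not yet used, one with largest modulus; it exists because \<open>c\<close>
tends to zero. An index with \<open>c n \<noteq> 0\<close> is used eventually, for otherwise infinitely many picked
entries would be at least as large.\<close>

lemma exists_decreasing_enumeration:
  fixes c :: "nat \<Rightarrow> complex"
  assumes c: "c \<longlonglongrightarrow> 0"
  obtains h where "inj h" "decseq (\<lambda>k. cmod (c (h k)))" "\<And>n. c n \<noteq> 0 \<Longrightarrow> n \<in> range h"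
proof -
  have ex: "\<exists>n. n \<notin> F \<and> (\<forall>m. m \<notin> F \<longrightarrow> cmod (c m) \<le> cmod (c n))" if F: "finite F" for F
  proof (cases "\<forall>m. m \<notin> F \<longrightarrow> c m = 0")
    case True
    moreover obtain n where "n \<notin> F" using ex_new_if_finite[OF infinite_UNIV_nat F] by blast
    ultimately show ?thesis by auto
  next
    case False
    then obtain m where m: "m \<notin> F" "c m \<noteq> 0" by blast
    obtain N where N: "\<And>n. N \<le> n \<Longrightarrow> cmod (c n) < cmod (c m)"
      using LIMSEQ_D[OF c, of "cmod (c m)"] m by auto
    define A where "A = {..<N} - F"
    have mA: "m \<in> A" using m N[of m] by (auto simp: A_def not_le intro: leI)
    have A: "finite A" "A \<noteq> {}" using mA by (auto simp: A_def)
    have "Max ((\<lambda>k. cmod (c k)) ` A) \<in> (\<lambda>k. cmod (c k)) ` A" using A by (intro Max_in) auto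
    then obtain n where "n \<in> A" and max: "Max ((\<lambda>k. cmod (c k)) ` A) = cmod (c n)" by blast
    moreover have "cmod (c k) \<le> cmod (c n)" if "k \<in> A" for k
      unfolding max[symmetric] using A that by (intro Max_ge) auto
    ultimately have n: "n \<in> A" "\<And>k. k \<in> A \<Longrightarrow> cmod (c k) \<le> cmod (c n)" by auto
    have "cmod (c k) \<le> cmod (c n)" if "k \<notin> F" for k
    proof (cases "k < N")
      case True
      then show ?thesis using n(2)[of k] that by (simp add: A_def)
    next
      case False
      then show ?thesis using N[of k] n(2)[OF mA] by simp
    qed
    then show ?thesis using n(1) by (auto simp: A_def)
  qed
  define pick where "pick F = (SOME n. n \<notin> F \<and> (\<forall>m. m \<notin> F \<longrightarrow> cmod (c m) \<le> cmod (c n)))" for F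
  define F where "F = rec_nat {} (\<lambda>_ F. insert (pick F) F)"
  have F: "F 0 = {}" "F (Suc k) = insert (pick (F k)) (F k)" for k by (simp_all add: F_def)
  have fin: "finite (F k)" for k by (induction k) (simp_all add: F)
  define h where "h k = pick (F k)" for k
  have h: "h k \<notin> F k" "\<And>m. m \<notin> F k \<Longrightarrow> cmod (c m) \<le> cmod (c (h k))" for k
    using someI_ex[OF ex[OF fin[of k]]] unfolding h_def pick_def by auto
  have Fh: "F k = h ` {..<k}" for k by (induction k) (auto simp: F h_def lessThan_Suc)
  show ?thesis
  proof (rule that[of h])
    have "h m \<noteq> h n" if "m < n" for m n
    proof -
      have "h m \<in> F n" using that by (simp add: Fh)
      then show ?thesis using h(1)[of n] by auto
    qed
    then show inj: "inj h" by (metis injI linorder_neqE_nat)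
    show "decseq (\<lambda>k. cmod (c (h k)))"
    proof (rule decseq_SucI)
      show "cmod (c (h (Suc k))) \<le> cmod (c (h k))" for k
        using h(1)[of "Suc k"] by (intro h(2)) (simp add: F)
    qed
    show "n \<in> range h" if n: "c n \<noteq> 0" for n
    proof (rule ccontr)
      assume "n \<notin> range h"
      then have le: "cmod (c n) \<le> cmod (c (h k))" for k by (intro h(2)) (auto simp: Fh)
      obtain N where N: "\<And>m. N \<le> m \<Longrightarrow> cmod (c m) < cmod (c n)"
        using LIMSEQ_D[OF c, of "cmod (c n)"] n by auto
      have "h k < N" for k using le[of k] N[of "h k"] by (cases "N \<le> h k") auto
      then have "range h \<subseteq> {..<N}" by blast
      then show False using inj finite_subset range_inj_infinite by blast
    qed
  qed
qed

lemma exists_modified_eigenvalue_seq: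
  assumes d: "diagonalized_by T e c" and c: "c \<longlonglongrightarrow> 0"
  obtains t where "modified_eigenvalue_seq T t"
proof -
  note dim = diagonalized_dimensions[OF d c]
  obtain h where h: "inj h" "decseq (\<lambda>k. cmod (c (h k)))" "\<And>n. c n \<noteq> 0 \<Longrightarrow> n \<in> range h"
    using exists_decreasing_enumeration[OF c] by blast
  have l: "eigenvalue_seq T (c \<circ> h)"
    unfolding eigenvalue_seq_def
  proof (intro conjI allI impI)
    show "decseq (\<lambda>n. cmod ((c \<circ> h) n))" using h(2) by simp
    fix z :: complex assume z: "z \<noteq> 0"
    have eq: "{n. c n = z} = h ` {k. (c \<circ> h) k = z}" using h(3) z by (auto simp: image_iff)
    have inj: "inj_on h {k. (c \<circ> h) k = z}" using h(1) by (rule inj_on_subset) simp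
    show "finite {k. (c \<circ> h) k = z}" using dim(1)[OF z] inj unfolding eq by (rule finite_imageD)
    show "card {k. (c \<circ> h) k = z} = algebraic_multiplicity T z"
      unfolding dim(2)[OF z] eq by (rule card_image[OF inj, symmetric])
  qed
  \<comment> \<open>Case of infinite-dimensional range and kernel: the zeros are put on the odd places.\<close>
  define s where "s m = (if even m then (c \<circ> h) (m div 2) else 0)" for m :: nat
  have r: "strict_mono (\<lambda>n. 2 * n :: nat)" by (auto simp: strict_mono_def)
  have inf: "infinite (- range (\<lambda>n. 2 * n :: nat))"
  proof -
    have "range (\<lambda>n. 2 * n + 1) \<subseteq> - range (\<lambda>n. 2 * n :: nat)" by (auto, presburger)
    moreover have "infinite (range (\<lambda>n. 2 * n + 1 :: nat))" by (rule range_inj_infinite) (auto simp: inj_on_def)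
    ultimately show ?thesis using finite_subset by blast
  qed
  have s: "\<exists>r. strict_mono r \<and> infinite (- range r) \<and> (\<forall>n. s (r n) = (c \<circ> h) n) \<and> (\<forall>m. m \<notin> range r \<longrightarrow> s m = 0)"
    by (rule exI[of _ "\<lambda>n. 2 * n"]) (use r inf in \<open>auto simp: s_def elim!: evenE\<close>)
  define t where "t = (if finite_cdim (range T) then c \<circ> h else if finite_cdim (op_kernel T) then
    (\<lambda>n. if n < cdim (op_kernel T) then 0 else (c \<circ> h) (n - cdim (op_kernel T))) else s)"
  have "modified_eigenvalue_seq T t"
    unfolding modified_eigenvalue_seq_def t_def using l s by (intro exI[of _ "c \<circ> h"]) simp
  then show ?thesis by (rule that)
qed

text \<open>Reordering the absolutely convergent series moves the rearrangements of both sequences into the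
permutation.\<close>

lemma C_spectrum_eq_permutation_pairings:
  assumes C: "diagonalized_by C e c" and T: "diagonalized_by T f t"
    and lim: "c \<longlonglongrightarrow> 0" "t \<longlonglongrightarrow> 0" and ct: "pairable c t"
  shows "C_spectrum C T = permutation_pairings c t"
proof -
  have sum: "(\<Sum>n. c (\<pi> n) * t (\<rho> n)) = pairing c t (permutation_matrix (\<rho> \<circ> inv \<pi>))"
    if \<pi>: "bij \<pi>" and \<rho>: "bij \<rho>" for \<pi> \<rho> :: "nat \<Rightarrow> nat"
  proof -
    have "bij (\<rho> \<circ> inv \<pi>)" by (rule bij_comp[OF bij_imp_bij_inv[OF \<pi>] \<rho>])
    from pairing_permutation_matrix[OF ct this]
    have "((\<lambda>n. c (\<pi> n) * t ((\<rho> \<circ> inv \<pi>) (\<pi> n))) has_sum pairing c t (permutation_matrix (\<rho> \<circ> inv \<pi>))) UNIV"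
      using has_sum_reindex_bij_betw[OF \<pi>, of "\<lambda>i. c i * t ((\<rho> \<circ> inv \<pi>) i)"] by blast
    then have "((\<lambda>n. c (\<pi> n) * t (\<rho> n)) has_sum pairing c t (permutation_matrix (\<rho> \<circ> inv \<pi>))) UNIV"
      using bij_is_inj[OF \<pi>] by simp
    then show ?thesis using has_sum_imp_sums sums_unique by metis
  qed
  show ?thesis
  proof
    show "C_spectrum C T \<subseteq> permutation_pairings c t"
    proof
      fix z assume "z \<in> C_spectrum C T"
      then obtain \<gamma> \<tau> and \<sigma> :: "nat \<Rightarrow> nat" where z: "z = (\<Sum>n. \<gamma> n * \<tau> (\<sigma> n))" "bij \<sigma>"
        and mod: "modified_eigenvalue_seq C \<gamma>" "modified_eigenvalue_seq T \<tau>"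
        by (auto simp: C_spectrum_def)
      obtain \<pi> where \<pi>: "bij \<pi>" "\<gamma> = c \<circ> \<pi>" by (rule modified_eigenvalue_seq_is_permutation[OF C lim(1) mod(1)])
      obtain \<rho> where \<rho>: "bij \<rho>" "\<tau> = t \<circ> \<rho>" by (rule modified_eigenvalue_seq_is_permutation[OF T lim(2) mod(2)])
      have \<rho>\<sigma>: "bij (\<rho> \<circ> \<sigma>)" by (rule bij_comp[OF z(2) \<rho>(1)])
      have "z = pairing c t (permutation_matrix (\<rho> \<circ> \<sigma> \<circ> inv \<pi>))"
        using sum[OF \<pi>(1) \<rho>\<sigma>] by (simp add: z(1) \<pi>(2) \<rho>(2))
      moreover have "bij (\<rho> \<circ> \<sigma> \<circ> inv \<pi>)" by (rule bij_comp[OF bij_imp_bij_inv[OF \<pi>(1)] \<rho>\<sigma>])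
      ultimately show "z \<in> permutation_pairings c t" by (auto simp: permutation_pairings_def)
    qed
    show "permutation_pairings c t \<subseteq> C_spectrum C T"
    proof
      fix z assume "z \<in> permutation_pairings c t"
      then obtain \<sigma> where \<sigma>: "bij \<sigma>" "z = pairing c t (permutation_matrix \<sigma>)"
        by (auto simp: permutation_pairings_def)
      obtain \<gamma> where \<gamma>: "modified_eigenvalue_seq C \<gamma>" by (rule exists_modified_eigenvalue_seq[OF C lim(1)])
      obtain \<tau> where \<tau>: "modified_eigenvalue_seq T \<tau>" by (rule exists_modified_eigenvalue_seq[OF T lim(2)])
      obtain \<pi> where \<pi>: "bij \<pi>" "\<gamma> = c \<circ> \<pi>" by (rule modified_eigenvalue_seq_is_permutation[OF C lim(1) \<gamma>])
      obtain \<rho> where \<rho>: "bij \<rho>" "\<tau> = t \<circ> \<rho>" by (rule modified_eigenvalue_seq_is_permutation[OF T lim(2) \<tau>])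
      define \<sigma>' where "\<sigma>' = inv \<rho> \<circ> \<sigma> \<circ> \<pi>"
      have \<sigma>': "bij \<sigma>'"
        unfolding \<sigma>'_def by (intro bij_comp bij_imp_bij_inv \<sigma> \<pi> \<rho>)
      have "\<rho> (\<sigma>' n) = (\<sigma> \<circ> \<pi>) n" for n
        by (simp add: \<sigma>'_def surj_f_inv_f[OF bij_is_surj[OF \<rho>(1)]])
      then have "(\<Sum>n. \<gamma> n * \<tau> (\<sigma>' n)) = pairing c t (permutation_matrix (\<sigma> \<circ> \<pi> \<circ> inv \<pi>))"
        using sum[OF \<pi>(1) bij_comp[OF \<pi>(1) \<sigma>(1)]] by (simp add: \<pi>(2) \<rho>(2))
      also have "\<sigma> \<circ> \<pi> \<circ> inv \<pi> = \<sigma>"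
        using bij_is_surj[OF \<pi>(1)] by (simp add: fun_eq_iff surj_f_inv_f)
      finally have "z = (\<Sum>n. \<gamma> n * \<tau> (\<sigma>' n))" using \<sigma>(2) by simp
      then show "z \<in> C_spectrum C T" unfolding C_spectrum_def using \<gamma> \<tau> \<sigma>' by blast
    qed
  qed
qed

section \<open>Collinear spectra and the closure of the numerical range\<close>

text \<open>The differences \<open>c n - c m\<close> lie on a line through zero, and so do their limits \<open>c n\<close> for \<open>m \<rightarrow> \<infinity>\<close>.\<close>

lemma collinear_null_sequence:
  fixes c :: "nat \<Rightarrow> complex"
  assumes c: "c \<longlonglongrightarrow> 0" and col: "collinear (range c)"
  obtains u \<rho> where "u \<noteq> 0" "\<And>n. c n = u * complex_of_real (\<rho> n)"
proof -
  obtain v where v: "\<And>m n. \<exists>k. c n - c m = k *\<^sub>R v"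
    using col unfolding collinear_def by blast
  have "c n \<in> span {v}" for n
  proof (rule closed_sequentially[OF closed_span])
    show "c n - c m \<in> span {v}" for m using v[of n m] by (auto simp: span_singleton)
    show "(\<lambda>m. c n - c m) \<longlonglongrightarrow> c n" using tendsto_diff[OF tendsto_const c, of "c n"] by simp
  qed
  then obtain \<rho> where \<rho>: "\<And>n. c n = \<rho> n *\<^sub>R v" unfolding span_singleton by (auto simp: image_iff) metis
  show ?thesis
  proof (cases "v = 0")
    case True
    then show ?thesis using \<rho> by (intro that[of 1 "\<lambda>_. 0"]) auto
  next
    case False
    then show ?thesis using \<rho> by (intro that[of v \<rho>]) (auto simp: scaleR_conv_of_real)
  qed
qed

theorem corollary3p18:
  fixes C T :: "'a::complex_hilbert_space \<Rightarrow> 'a"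
  assumes infinite_dimensional: "\<not> finite_cdim (UNIV :: 'a set)"
    and separable: "separable_space (euclidean :: 'a topology)"
    and "trace_class C" and "normal_op C"
    and "compact_op T" and "normal_op T"
    and "collinear (eigenvalues C) \<or> collinear (eigenvalues T)"
  shows "closure (C_numerical_range C T) = convex hull (closure (C_spectrum C T))"
proof -
  have cC: "compact_op C" using \<open>trace_class C\<close> by (simp add: trace_class_def)
  obtain e c where C: "diagonalized_by C e c"
    using compact_normal_diagonalizable[OF infinite_dimensional separable cC \<open>normal_op C\<close>] by blast
  obtain f t where T: "diagonalized_by T f t"
    using compact_normal_diagonalizable[OF infinite_dimensional separable \<open>compact_op T\<close> \<open>normal_op T\<close>] by blast
  have c0: "c \<longlonglongrightarrow> 0" by (rule compact_diagonal_tendsto_zero[OF cC C])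
  have t0: "t \<longlonglongrightarrow> 0" by (rule compact_diagonal_tendsto_zero[OF \<open>compact_op T\<close> T])
  have csum: "(\<lambda>n. cmod (c n)) summable_on UNIV"
    by (rule trace_class_diagonal_summable[OF \<open>trace_class C\<close> C])
  have ct: "pairable c t" using csum t0 by (simp add: pairable_def)
  have f: "orthonormal_basis f" using T by (simp add: diagonalized_by_def)
  have W: "C_numerical_range C T = {pairing c t D | D. orthostochastic TYPE('a) D}"
    by (rule C_numerical_range_eq_pairings[OF C csum T _ ct]) (use \<open>compact_op T\<close> in \<open>simp add: compact_op_def\<close>)
  have W': "C_numerical_range C T = {pairing t c D | D. orthostochastic TYPE('a) D}"
    unfolding W
  proof (intro equalityI subsetI; clarify)
    fix D assume D: "orthostochastic TYPE('a) D"
    show "\<exists>E. pairing c t D = pairing t c E \<and> orthostochastic TYPE('a) E"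
      using orthostochastic_transpose[OF D] pairing_transpose[of t c D] by metis
    show "\<exists>E. pairing t c D = pairing c t E \<and> orthostochastic TYPE('a) E"
      using orthostochastic_transpose[OF D] pairing_transpose[of c t D] by metis
  qed
  have P: "C_spectrum C T = permutation_pairings c t"
    by (rule C_spectrum_eq_permutation_pairings[OF C T c0 t0 ct])
  have spectrum: "range s \<subseteq> eigenvalues A" if "diagonalized_by A g s" for A :: "'a \<Rightarrow> 'a" and g s
    using diagonalized_by_eigenvector[OF that] that orthonormal_seqD(3)[OF orthonormal_basisD(1), of g]
    by (auto simp: eigenvalues_def diagonalized_by_def)
  from assms(7) show ?thesis
  proof
    assume "collinear (eigenvalues C)"
    then have "collinear (range c)" using spectrum[OF C] by (rule collinear_subset)
    then obtain u \<rho> where u: "u \<noteq> 0" "\<And>n. c n = u * complex_of_real (\<rho> n)"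
      using collinear_null_sequence[OF c0] by blast
    have tc: "pairable t c" using ct by (simp only: pairable_commute)
    show ?thesis
      unfolding P W' permutation_pairings_commute[of c t]
    proof (rule closure_pairings_eq_convex_hull[OF tc u(2)])
      show "{pairing t c D | D. orthostochastic TYPE('a) D} \<subseteq> {pairing t c D | D. doubly_stochastic D}"
        using orthostochastic_imp_doubly_stochastic by blast
      show "pairing t c D \<in> closure {pairing t c D | D. orthostochastic TYPE('a) D}"
        if "doubly_stochastic D" for D
        by (rule pairing_in_closure_orthostochastic[OF f tc u(2,1) that])
    qed
  next
    assume "collinear (eigenvalues T)"
    then have "collinear (range t)" using spectrum[OF T] by (rule collinear_subset)
    then obtain u \<rho> where u: "u \<noteq> 0" "\<And>n. t n = u * complex_of_real (\<rho> n)"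
      using collinear_null_sequence[OF t0] by blast
    show ?thesis
      unfolding P W
    proof (rule closure_pairings_eq_convex_hull[OF ct u(2)])
      show "{pairing c t D | D. orthostochastic TYPE('a) D} \<subseteq> {pairing c t D | D. doubly_stochastic D}"
        using orthostochastic_imp_doubly_stochastic by blast
      show "pairing c t D \<in> closure {pairing c t D | D. orthostochastic TYPE('a) D}"
        if "doubly_stochastic D" for D
        by (rule pairing_in_closure_orthostochastic[OF f ct u(2,1) that])
    qed
  qed
qed

end
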